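(* Let $N\ge 1$ be a natural number and let $T>0$ be a real number. Put $$\Xi(T)=\exp\left(-\frac{T^2}{2\left(128\,\bar r^2\bar\Lambda+(16\,\bar r\bar\Lambda)^{1/3}\,T\right)^{3/2}}\right),\qquad K=\left\lceil\sqrt N\right\rceil .$$ Then for each choice of sign $\pm$, $$\gamma\left(\mathrm{KL}^{\pm}(T,N)\right)\ \ge\ 1-\left(\sum_{n=N}^{K^2-1}\Xi(T)^{\sqrt n}+\frac{\Xi(T)^K}{1-\Xi(T)}\left(2K+1+\frac{4\,\Xi(T)}{1-\Xi(T)}\right)\right).$$ In particular, if $N=K^2$ is the square of an integer, then for each choice of sign $\pm$, $$\gamma\left(\mathrm{KL}^{\pm}(T,N)\right)\ \ge\ 1-(1-\Xi(T))^{-1}\left(2\sqrt N+1+\frac{4\,\Xi(T)}{1-\Xi(T)}\right)\Xi(T)^{\sqrt N}.$$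
   Context: Let $\mathbb X=[0,1]\setminus\mathbb Q$ with its Borel $\sigma$-algebra, and let $\gamma$ be the Gauss probability measure $d\gamma(x)=\frac{dx}{(1+x)\log 2}$ ($\log$ is the natural logarithm). Each $\omega\in\mathbb X$ has a unique infinite continued fraction expansion $\omega=[a_1,a_2,\ldots]=\cfrac{1}{a_1+\cfrac{1}{a_2+\cdots}}$ with positive integers $a_j=a_j(\omega)$. For $n\ge 1$ let $M_n(\omega)=a_1(\omega)\cdots a_n(\omega)$. Let $$\kappa=\int_{\mathbb X}\log a_1\,d\gamma=\int_0^1\log\lfloor x^{-1}\rfloor\frac{dx}{(1+x)\log 2}.$$ For $T>0$ and $N\in\mathbb N$, set $$\mathrm{KL}^+(T,N)=\{\omega\in\mathbb X: M_n(\omega)\le e^{(\kappa+T)n}\ \text{for all } n\ge N\},$$ $$\mathrm{KL}^-(T,N)=\{\omega\in\mathbb X: e^{(\kappa-T)n}\le M_n(\omega)\ \text{for all } n\ge N\}.$$ The universal constants are $$\bar r=\sqrt{\frac{3}{2\log 2}},\qquad \bar\Lambda=1+\left(\log 2-\tfrac12\right)^{1/2}+\left(\frac{\pi^2\log 2}{12}-\frac12\right)^{1/2}\frac{1}{1-\lambda_0^{1/2}},$$ where $\lambda_0\approx 0.3037$ is the Gauss-Kuzmin-Wirsing constant, i.e. the second largest absolute value of an eigenvalue (the largest being $1$) of the Gauss-Kuzmin-Wirsing transfer operator $(Lf)(x)=\sum_{k\ge1}\frac{1}{(x+k)^2}f\left(\frac1{x+k}\right)$, acting e.g. on functions holomorphic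 in the disc $|z-1|<3/2$ and continuous on its closure. An empty sum equals $0$. *)

theory Defs
  imports "HOL-Complex_Analysis.Complex_Analysis"
begin

definition irr_interval :: "real set" where
  "irr_interval = {0..1} - \<rat>"

definition gauss_measure :: "real measure" where
  "gauss_measure =
     density (restrict_space lborel irr_interval) (\<lambda>x. ennreal (1 / ((1 + x) * ln 2)))"

fun cf_value :: "nat list \<Rightarrow> real" where
  "cf_value [] = 0"
| "cf_value (a # as) = 1 / (real a + cf_value as)"

text \<open>Digits are indexed from 1. The entry at index 0 is the integer part, fixed to be 0, so
  that an irrational number in the unit interval has exactly one expansion.\<close>

definition is_cf_expansion :: "(nat \<Rightarrow> nat) \<Rightarrow> real \<Rightarrow> bool" where
  "is_cf_expansion a \<omega> \<longleftrightarrow>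
     a 0 = 0 \<and> (\<forall>j\<ge>1. 0 < a j) \<and> (\<lambda>n. cf_value (map a [1..<Suc n])) \<longlonglongrightarrow> \<omega>"

definition cf_digit :: "real \<Rightarrow> nat \<Rightarrow> nat" where
  "cf_digit \<omega> = (THE a. is_cf_expansion a \<omega>)"

definition digit_prod :: "nat \<Rightarrow> real \<Rightarrow> nat" where
  "digit_prod n \<omega> = (\<Prod>j=1..n. cf_digit \<omega> j)"

definition kappa :: real where
  "kappa = (\<integral>\<omega>. ln (real (cf_digit \<omega> 1)) \<partial>gauss_measure)"

definition KL_plus :: "real \<Rightarrow> nat \<Rightarrow> real set" where
  "KL_plus T N =
     {\<omega> \<in> irr_interval. \<forall>n\<ge>N. real (digit_prod n \<omega>) \<le> exp ((kappa + T) * real n)}"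

definition KL_minus :: "real \<Rightarrow> nat \<Rightarrow> real set" where
  "KL_minus T N =
     {\<omega> \<in> irr_interval. \<forall>n\<ge>N. exp ((kappa - T) * real n) \<le> real (digit_prod n \<omega>)}"

definition gkw_operator :: "(complex \<Rightarrow> complex) \<Rightarrow> complex \<Rightarrow> complex" where
  "gkw_operator f z =
     (\<Sum>k. 1 / (z + of_nat (Suc k))\<^sup>2 * f (1 / (z + of_nat (Suc k))))"

text \<open>Elements of the disc algebra are represented by functions on the whole plane of which only
  the values on the closed disc matter; each map \<open>z \<mapsto> 1 / (z + k)\<close> with \<open>k \<ge> 1\<close> sends the closed
  disc into itself.\<close>

definition gkw_eigenvalue :: "complex \<Rightarrow> bool" where
  "gkw_eigenvalue \<mu> \<longleftrightarrow>
     (\<exists>f. f holomorphic_on ball 1 (3/2) \<and> continuous_on (cball 1 (3/2)) f \<and>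
          (\<exists>z\<in>cball 1 (3/2). f z \<noteq> 0) \<and>
          (\<forall>z\<in>cball 1 (3/2). gkw_operator f z = \<mu> * f z))"

text \<open>The largest modulus of an eigenvalue is 1. The operator is compact, so the supremum below is
  attained and is the second largest modulus.\<close>

definition gkw_constant :: real where
  "gkw_constant = Sup {cmod \<mu> | \<mu>. gkw_eigenvalue \<mu> \<and> cmod \<mu> < 1}"

definition r_bar :: real where
  "r_bar = sqrt (3 / (2 * ln 2))"

definition Lambda_bar :: real where
  "Lambda_bar = 1 + sqrt (ln 2 - 1/2) +
     sqrt (pi\<^sup>2 * ln 2 / 12 - 1/2) * (1 / (1 - sqrt gkw_constant))"

definition Xi :: "real \<Rightarrow> real" where
  "Xi T = exp (- (T\<^sup>2 /
     (2 * (128 * r_bar\<^sup>2 * Lambda_bar + (16 * r_bar * Lambda_bar) powr (1/3) * T) powr (3/2))))"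

end

theory Submission
  imports Defs "HOL-Real_Asymp.Real_Asymp"
begin

text \<open>
  Write \<open>P\<close> for the transfer operator of the Gauss map normalised by the Gauss measure,
  \<open>(P f)(x) = (\<Sum>k\<ge>1. p\<^sub>k(x) f(1/(x+k)))\<close> with \<open>p\<^sub>k(x) = (1+x)/((x+k)(x+k+1))\<close>. It is the
  conditional expectation of \<open>f(\<omega>)\<close> given that the Gauss map sends \<open>\<omega>\<close> to \<open>x\<close>. One observation
  carries the whole proof: when \<open>x\<close> grows, every preimage \<open>1/(x+k)\<close> decreases, and the distribution
  \<open>p(x)\<close> moves towards larger \<open>k\<close>, that is, towards smaller preimages. So \<open>P\<close> turns increasing
  functions into decreasing ones; quantitatively, a function whose increments are dominated by those
  of \<open>h\<close> is sent to one whose increments are dominated by those of \<open>-P h\<close>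
  (\<open>variation_le_gauss_op\<close>). Since \<open>-P\<close> sends the identity to a function with slopes between \<open>1/81\<close>
  and \<open>7/8\<close>, the operator contracts Lipschitz constants by the factor \<open>7/8\<close>.

  The large deviation estimate is Gordin's martingale approximation. Let \<open>m\<close> be the conditional mean of
  \<open>log a\<^sub>1\<close>. Its iterates \<open>P\<^sup>j m\<close> converge to \<open>kappa\<close> at the rate \<open>(7/8)\<^sup>j\<close>, so
  the partial sums \<open>u\<close> of these iterates are Lipschitz with constant \<open>8\<close> and solve the Poisson equation
  \<open>m - kappa + P u - u = 0\<close> up to an arbitrarily small error. Conditionally on the image point, the
  variable \<open>log a\<^sub>1 - kappa + u(\<omega>) - u(x)\<close> is then almost centred and has exponential moments, so the
  exponential moment of order \<open>s\<close> of \<open>log M\<^sub>n - kappa n\<close> is at most \<open>exp(3201 s\<^sup>2 n + 16 \<bar>s\<bar>)\<close>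
  for \<open>\<bar>s\<bar> \<le> 1/20\<close> (\<open>exponential_moment_bound\<close>). Chernoff's inequality gives decay that is exponential in \<open>n\<close>,
  which is much more than the rate \<open>exp(-\<epsilon> \<surd>n)\<close> with \<open>exp(-\<epsilon>) = Xi T\<close> that is asserted. The two rates
  are compared only when the asserted lower bound is positive; this forces \<open>\<epsilon> \<surd>n \<ge> 1/2\<close> for all
  \<open>n \<ge> N\<close>, hence large \<open>n\<close> when \<open>T\<close> is small, and leaves room for all constants. Summing over
  \<open>n \<ge> N\<close>, with the \<open>2k+1\<close> integers between \<open>k\<^sup>2\<close> and \<open>(k+1)\<^sup>2\<close> grouped together, gives the theorem.

  The comparison uses a lower bound for \<open>Lambda_bar\<close>, and so the inequality \<open>gkw_constant \<le> 1\<close>. The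
  constant is the supremum of a set of moduli below \<open>1\<close>, so the point is that this set is not
  empty: the Gauss-Kuzmin-Wirsing operator \<open>L\<close> must have an eigenvalue inside the open unit disc. It is found
  by the same order reversal. For the kernel \<open>E(z,y) = (1+y)/(1+zy)\<^sup>2\<close>, applying \<open>L\<close> in \<open>z\<close> is the
  same as applying \<open>P\<close> in \<open>y\<close>. Therefore the functions \<open>f\<^sub>n = (-L)\<^sup>n (E(\<cdot>,1) - E(\<cdot>,0))\<close> are bounded on a
  complex disc by a multiple of the positive numbers \<open>f\<^sub>n(0)\<close>, which behave like powers of some \<open>\<rho>\<close> between
  \<open>1/81\<close> and \<open>7/8\<close> on the exponential scale. Suitable weighted averages of the \<open>f\<^sub>n\<close> form a normal family of approximate eigenfunctions, and
  Montel's theorem yields an eigenfunction for \<open>-\<rho>\<close> (\<open>exists_small_gkw_eigenvalue\<close>).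
\<close>

section \<open>The Gauss operator reverses order\<close>

text \<open>The index \<open>k\<close> belongs to the digit \<open>k + 1\<close>: this is the conditional probability, under the Gauss
  measure, that the first digit is \<open>k + 1\<close> given that the Gauss map sends the point to \<open>x\<close>.\<close>

definition gauss_weight :: "nat \<Rightarrow> real \<Rightarrow> real" where
  "gauss_weight k x = (1 + x) / ((x + real k + 1) * (x + real k + 2))"

definition gauss_branch :: "nat \<Rightarrow> real \<Rightarrow> real" where
  "gauss_branch k x = 1 / (x + real k + 1)"

definition gauss_op :: "(real \<Rightarrow> 'a::banach) \<Rightarrow> real \<Rightarrow> 'a" where
  "gauss_op f x = (\<Sum>k. gauss_weight k x *\<^sub>R f (gauss_branch k x))"

text \<open>With \<open>h(x) = c x\<close> this is a Lipschitz condition, and with \<open>f = h\<close> it says that \<open>h\<close> is increasing.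
  Allowing a general \<open>h\<close>, and vector values of \<open>f\<close>, is what makes the relation stable under the Gauss operator.\<close>

definition variation_le :: "(real \<Rightarrow> 'a::real_normed_vector) \<Rightarrow> (real \<Rightarrow> real) \<Rightarrow> bool" where
  "variation_le f h \<longleftrightarrow> (\<forall>x y. 0 \<le> x \<and> x \<le> y \<and> y \<le> 1 \<longrightarrow> norm (f y - f x) \<le> h y - h x)"

lemma gauss_weight_nonneg: "0 \<le> x \<Longrightarrow> 0 \<le> gauss_weight k x"
  by (simp add: gauss_weight_def)

lemma gauss_branch_in: "0 \<le> x \<Longrightarrow> gauss_branch k x \<in> {0..1}"
  by (auto simp: gauss_branch_def field_simps)

lemma gauss_branch_antimono_arg: "0 \<le> x \<Longrightarrow> x \<le> y \<Longrightarrow> gauss_branch k y \<le> gauss_branch k x"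
  by (auto simp: gauss_branch_def intro!: divide_left_mono mult_pos_pos)

lemma gauss_branch_antimono_index: "0 \<le> x \<Longrightarrow> gauss_branch (Suc k) x \<le> gauss_branch k x"
  by (auto simp: gauss_branch_def intro!: divide_left_mono mult_pos_pos)

text \<open>The closed form is decreasing in \<open>x\<close>: a larger \<open>x\<close> makes large digits more likely.\<close>

lemma sum_gauss_weight:
  assumes "0 \<le> x"
  shows "(\<Sum>k<n. gauss_weight k x) = real n / (x + real n + 1)"
proof (induction n)
  case (Suc n)
  define a where "a = x + real n + 1"
  have a: "a > 0" using assms by (auto simp: a_def)
  have e: "x + real n + 1 = a" "x + real n + 2 = a + 1" "x + (real n + 1) + 1 = a + 1"
      "1 + x = a - real n" "real (Suc n) = real n + 1"
    by (simp_all add: a_def)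
  have "gauss_weight n x = real (Suc n) / (x + real (Suc n) + 1) - real n / (x + real n + 1)"
    unfolding gauss_weight_def e using a by (simp add: divide_simps) (simp add: algebra_simps)
  then show ?case using Suc by simp
qed simp

lemma gauss_weight_sums:
  assumes "0 \<le> x"
  shows "(\<lambda>k. gauss_weight k x) sums 1"
proof -
  have "(\<lambda>n. real n / (x + real n + 1)) \<longlonglongrightarrow> 1" by real_asymp
  then show ?thesis unfolding sums_def by (simp add: sum_gauss_weight[OF assms])
qed

lemma gauss_op_norm_summable:
  fixes f :: "real \<Rightarrow> 'a::banach"
  assumes "0 \<le> x" and "\<And>y. y \<in> {0..1} \<Longrightarrow> norm (f y) \<le> C"
  shows "summable (\<lambda>k. norm (gauss_weight k x *\<^sub>R f (gauss_branch k x)))"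
proof (rule summable_comparison_test')
  show "summable (\<lambda>k. gauss_weight k x * C)"
    using sums_mult2[OF gauss_weight_sums[OF assms(1)], of C] by (simp add: sums_iff)
  show "norm (norm (gauss_weight k x *\<^sub>R f (gauss_branch k x))) \<le> gauss_weight k x * C" for k
    using gauss_weight_nonneg[OF assms(1), of k] assms(2)[OF gauss_branch_in[OF assms(1)], of k]
    by (auto intro!: mult_left_mono)
qed

lemma gauss_op_sums:
  fixes f :: "real \<Rightarrow> 'a::banach"
  assumes "0 \<le> x" and "\<And>y. y \<in> {0..1} \<Longrightarrow> norm (f y) \<le> C"
  shows "(\<lambda>k. gauss_weight k x *\<^sub>R f (gauss_branch k x)) sums gauss_op f x"
  unfolding gauss_op_def
  by (rule summable_sums[OF summable_norm_cancel[OF gauss_op_norm_summable[OF assms]]])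

lemma norm_gauss_op_le:
  fixes f :: "real \<Rightarrow> 'a::banach"
  assumes "0 \<le> x" and "\<And>y. y \<in> {0..1} \<Longrightarrow> norm (f y) \<le> C"
  shows "norm (gauss_op f x) \<le> C"
proof -
  have "norm (gauss_op f x) \<le> (\<Sum>k. norm (gauss_weight k x *\<^sub>R f (gauss_branch k x)))"
    unfolding gauss_op_def by (rule summable_norm[OF gauss_op_norm_summable[OF assms]])
  also have "\<dots> \<le> (\<Sum>k. gauss_weight k x * C)"
  proof (rule suminf_le[OF _ gauss_op_norm_summable[OF assms]])
    show "norm (gauss_weight k x *\<^sub>R f (gauss_branch k x)) \<le> gauss_weight k x * C" for k
      using gauss_weight_nonneg[OF assms(1), of k] assms(2)[OF gauss_branch_in[OF assms(1)], of k]
      by (auto intro!: mult_left_mono)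
    show "summable (\<lambda>k. gauss_weight k x * C)"
      using sums_mult2[OF gauss_weight_sums[OF assms(1)], of C] by (simp add: sums_iff)
  qed
  also have "\<dots> = C" using sums_mult2[OF gauss_weight_sums[OF assms(1)], of C] by (simp add: sums_iff)
  finally show ?thesis .
qed

lemma variation_leD:
  "variation_le f h \<Longrightarrow> 0 \<le> x \<Longrightarrow> x \<le> y \<Longrightarrow> y \<le> 1 \<Longrightarrow> norm (f y - f x) \<le> h y - h x"
  by (simp add: variation_le_def)

lemma gauss_op_scaleR:
  fixes f :: "real \<Rightarrow> 'a::banach"
  assumes "0 \<le> x" "\<And>y. y \<in> {0..1} \<Longrightarrow> norm (f y) \<le> B"
  shows "gauss_op (\<lambda>y. a *\<^sub>R f y) x = a *\<^sub>R gauss_op f x"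
proof -
  have "(\<lambda>k. a *\<^sub>R (gauss_weight k x *\<^sub>R f (gauss_branch k x))) sums (a *\<^sub>R gauss_op f x)"
    by (rule sums_scaleR_right[OF gauss_op_sums[OF assms]])
  then show ?thesis unfolding gauss_op_def by (simp add: sums_iff mult.commute)
qed

lemma variation_le_bounded:
  fixes f :: "real \<Rightarrow> 'a::real_normed_vector"
  assumes "variation_le f h"
  obtains C where "\<And>y. y \<in> {0..1} \<Longrightarrow> norm (f y) \<le> C" "\<And>y. y \<in> {0..1} \<Longrightarrow> \<bar>h y\<bar> \<le> C"
proof
  let ?C = "norm (f 0) + \<bar>h 0\<bar> + \<bar>h 1\<bar> + (h 1 - h 0)"
  fix y :: real assume y: "y \<in> {0..1}"
  have "norm (f y - f 0) \<le> h y - h 0" "norm (f 1 - f y) \<le> h 1 - h y"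
    using assms y by (auto simp: variation_le_def)
  moreover have "norm (f y) \<le> norm (f 0) + norm (f y - f 0)"
    by (metis add.commute diff_add_cancel norm_triangle_ineq)
  moreover have "0 \<le> norm (f y - f 0)" "0 \<le> norm (f 1 - f y)" "0 \<le> norm (f 0)" by auto
  ultimately show "norm (f y) \<le> ?C" "\<bar>h y\<bar> \<le> ?C" by linarith+
qed

lemma summation_by_parts:
  fixes g :: "nat \<Rightarrow> 'a::real_vector" and d :: "nat \<Rightarrow> real"
  shows "(\<Sum>k<n. d k *\<^sub>R g k) =
    (\<Sum>k<n. d k) *\<^sub>R g n + (\<Sum>k<n. (\<Sum>j<Suc k. d j) *\<^sub>R (g k - g (Suc k)))"
  by (induction n) (auto simp: algebra_simps)

text \<open>Two effects add up when the argument increases from \<open>x\<close> to \<open>y\<close>: each branch point moves down, and weight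
  moves to branches with larger index, which lie further down. Abel summation writes the second effect
  as a combination of the differences of \<open>f\<close> between consecutive branch points, with nonnegative
  coefficients. All increments of \<open>f\<close> are then taken downwards with nonnegative coefficients, and the
  triangle inequality bounds them by the same expression for \<open>h\<close>.\<close>

lemma variation_le_gauss_op:
  fixes f :: "real \<Rightarrow> 'a::banach"
  assumes "variation_le f h"
  shows "variation_le (gauss_op f) (\<lambda>x. - gauss_op h x)"
  unfolding variation_le_def
proof (intro allI impI, elim conjE)
  fix x y :: real assume xy: "0 \<le> x" "x \<le> y" "y \<le> 1"
  then have y: "0 \<le> y" by simp
  obtain C where C: "\<And>y. y \<in> {0..1} \<Longrightarrow> norm (f y) \<le> C" "\<And>y. y \<in> {0..1} \<Longrightarrow> norm (h y) \<le> C"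
    using variation_le_bounded[OF assms] by auto
  define a where "a = (\<lambda>k. gauss_branch k x)"
  define b where "b = (\<lambda>k. gauss_branch k y)"
  define p where "p = (\<lambda>k. gauss_weight k x)"
  define d where "d = (\<lambda>k. gauss_weight k x - gauss_weight k y)"
  define D where "D = (\<lambda>n. \<Sum>k<n. d k)"
  have ab: "a k \<in> {0..1}" "b k \<in> {0..1}" "b k \<le> a k" "b (Suc k) \<le> b k" for k
    using gauss_branch_in[OF xy(1)] gauss_branch_in[OF y] gauss_branch_antimono_arg[OF xy(1,2)]
      gauss_branch_antimono_index[OF y] by (auto simp: a_def b_def)
  have p: "p k \<ge> 0" for k using gauss_weight_nonneg[OF xy(1)] by (simp add: p_def)
  have D_eq: "D n = real n / (x + real n + 1) - real n / (y + real n + 1)" for n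
    by (simp add: D_def d_def sum_subtractf sum_gauss_weight xy y)
  have D: "D n \<ge> 0" for n
    unfolding D_eq using xy by (auto intro!: divide_left_mono mult_pos_pos)
  have D0: "D \<longlonglongrightarrow> 0" unfolding D_eq by real_asymp
  \<comment> \<open>The first sum moves the branch points at fixed weights, the rest moves the weights at
    fixed branch points.\<close>
  have split: "(\<Sum>k<n. p k *\<^sub>R g (a k)) - (\<Sum>k<n. gauss_weight k y *\<^sub>R g (b k)) =
     (\<Sum>k<n. p k *\<^sub>R (g (a k) - g (b k))) +
     (\<Sum>k<n. D (Suc k) *\<^sub>R (g (b k) - g (b (Suc k)))) + D n *\<^sub>R g (b n)"
    for g :: "real \<Rightarrow> 'b::real_vector" and n
  proof -
    have "(\<Sum>k<n. p k *\<^sub>R g (a k)) - (\<Sum>k<n. gauss_weight k y *\<^sub>R g (b k)) =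
      (\<Sum>k<n. p k *\<^sub>R (g (a k) - g (b k))) + (\<Sum>k<n. d k *\<^sub>R g (b k))"
      by (simp add: sum_subtractf[symmetric] sum.distrib[symmetric] p_def d_def algebra_simps)
    then show ?thesis
      using summation_by_parts[of d "\<lambda>k. g (b k)" n] by (simp add: D_def algebra_simps)
  qed
  have le: "norm ((\<Sum>k<n. p k *\<^sub>R f (a k)) - (\<Sum>k<n. gauss_weight k y *\<^sub>R f (b k)))
     \<le> ((\<Sum>k<n. p k *\<^sub>R h (a k)) - (\<Sum>k<n. gauss_weight k y *\<^sub>R h (b k))) + 2 * C * D n" for n
  proof -
    have "norm (p k *\<^sub>R (f (a k) - f (b k))) \<le> p k *\<^sub>R (h (a k) - h (b k))" for k
      using assms ab[of k] p[of k] by (auto simp: variation_le_def intro!: mult_left_mono)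
    then have 1: "norm (\<Sum>k<n. p k *\<^sub>R (f (a k) - f (b k))) \<le> (\<Sum>k<n. p k *\<^sub>R (h (a k) - h (b k)))"
      by (rule sum_norm_le)
    have "norm (D (Suc k) *\<^sub>R (f (b k) - f (b (Suc k)))) \<le> D (Suc k) *\<^sub>R (h (b k) - h (b (Suc k)))" for k
      using assms ab[of k] ab[of "Suc k"] D[of "Suc k"]
      by (auto simp: variation_le_def intro!: mult_left_mono)
    then have 2: "norm (\<Sum>k<n. D (Suc k) *\<^sub>R (f (b k) - f (b (Suc k))))
        \<le> (\<Sum>k<n. D (Suc k) *\<^sub>R (h (b k) - h (b (Suc k))))"
      by (rule sum_norm_le)
    have 3: "norm (D n *\<^sub>R f (b n)) \<le> C * D n" "- (D n *\<^sub>R h (b n)) \<le> C * D n"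
      using C[OF ab(2)[of n]] D[of n] mult_left_mono[of "norm (f (b n))" C "D n"]
        mult_left_mono[of "- h (b n)" C "D n"] by (auto simp: mult.commute)
    show ?thesis unfolding split using 1 2 3
      norm_triangle_ineq[of "(\<Sum>k<n. p k *\<^sub>R (f (a k) - f (b k))) + (\<Sum>k<n. D (Suc k) *\<^sub>R (f (b k) - f (b (Suc k))))" "D n *\<^sub>R f (b n)"]
      norm_triangle_ineq[of "\<Sum>k<n. p k *\<^sub>R (f (a k) - f (b k))" "\<Sum>k<n. D (Suc k) *\<^sub>R (f (b k) - f (b (Suc k)))"]
      by linarith
  qed
  have lim: "(\<lambda>n. (\<Sum>k<n. p k *\<^sub>R g (a k)) - (\<Sum>k<n. gauss_weight k y *\<^sub>R g (b k)))
      \<longlonglongrightarrow> gauss_op g x - gauss_op g y"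
    if "\<And>y. y \<in> {0..1} \<Longrightarrow> norm (g y) \<le> C" for g :: "real \<Rightarrow> 'b::banach"
    using gauss_op_sums[OF xy(1) that] gauss_op_sums[OF y that]
    unfolding sums_def a_def b_def p_def by (intro tendsto_diff)
  have "norm (gauss_op f x - gauss_op f y) \<le> (gauss_op h x - gauss_op h y) + 2 * C * 0"
    using le by (intro LIMSEQ_le[OF tendsto_norm[OF lim[OF C(1)]]
      tendsto_add[OF lim[OF C(2)] tendsto_mult[OF tendsto_const D0]]]) auto
  then show "norm (gauss_op f y - gauss_op f x) \<le> - gauss_op h y - - gauss_op h x"
    by (simp add: norm_minus_commute)
qed

text \<open>These are the terms of the series for the image of the identity, in the form obtained by
  Abel summation, in which every single term is decreasing in \<open>x\<close>.\<close>

lemma identity_slope_term_bounds: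
  fixes x y :: real and k :: nat
  assumes "0 \<le> x" "x \<le> y" 
  defines "t \<equiv> \<lambda>x. real (Suc k) / ((x + real k + 1) * (x + real k + 2)\<^sup>2)"
  shows "t y \<le> t x" "t x - t y \<le> 7 / 2 * (y - x) / (real (Suc k) * real (k + 2) * real (k + 3))"
proof -
  define a where "a = x + real k + 1"
  define b where "b = y + real k + 1"
  have ab: "real k + 1 \<le> a" "a \<le> b" "0 < a" "0 < b" using assms(1,2) by (auto simp: a_def b_def)
  have t: "t x = (real k + 1) / (a * (a+1)\<^sup>2)" "t y = (real k + 1) / (b * (b+1)\<^sup>2)"
    by (simp_all add: t_def a_def b_def add_ac)
  show "t y \<le> t x" unfolding t using ab
    by (intro divide_left_mono mult_mono power_mono mult_pos_pos) auto
  have e: "1 / (a * (a+1)\<^sup>2) - 1 / (b * (b+1)\<^sup>2) =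
     (b - a) * (1 / (a * b * (b+1)\<^sup>2) + 1 / (a * (a+1)\<^sup>2 * (b+1)) + 1 / (a * (a+1) * (b+1)\<^sup>2))"
    using ab by (simp add: divide_simps) (simp add: algebra_simps power2_eq_square)
  define c where "c = real k + 1"
  have c: "1 \<le> c" "c \<le> a" "c \<le> b" "0 < c" using ab by (auto simp: c_def)
  have "1 / (a * b * (b+1)\<^sup>2) \<le> 1 / (c * c * (c+1)\<^sup>2)"
    "1 / (a * (a+1)\<^sup>2 * (b+1)) \<le> 1 / (c * (c+1)\<^sup>2 * (c+1))"
    "1 / (a * (a+1) * (b+1)\<^sup>2) \<le> 1 / (c * (c+1) * (c+1)\<^sup>2)"
    using ab c by (auto intro!: divide_left_mono mult_mono power_mono mult_pos_pos)
  then have "1 / (a * (a+1)\<^sup>2) - 1 / (b * (b+1)\<^sup>2) \<le> (b - a) *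
     (1 / (c * c * (c+1)\<^sup>2) + 1 / (c * (c+1)\<^sup>2 * (c+1)) + 1 / (c * (c+1) * (c+1)\<^sup>2))"
    unfolding e using ab by (intro mult_left_mono add_mono) auto
  then have "t x - t y \<le> c * ((b - a) *
     (1 / (c * c * (c+1)\<^sup>2) + 1 / (c * (c+1)\<^sup>2 * (c+1)) + 1 / (c * (c+1) * (c+1)\<^sup>2)))"
    unfolding t c_def[symmetric] using mult_left_mono[of _ _ c] c by (fastforce simp: algebra_simps)
  also have "\<dots> = (b - a) * ((1 / (c * (c+1)\<^sup>2)) + 2 / (c+1)^3)"
    using c by (simp add: divide_simps power2_eq_square power3_eq_cube)
  also have "\<dots> \<le> (b - a) * (7 / 2 / (c * (c+1) * (c+2)))"
  proof (intro mult_left_mono)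
    have "(1 / (c * (c+1)\<^sup>2)) \<le> (3/2) / (c * (c+1) * (c+2))"
      using c by (simp add: divide_simps power2_eq_square)
    moreover have "2 / (c+1)^3 \<le> 2 / (c * (c+1) * (c+2))"
      using c by (intro divide_left_mono mult_pos_pos zero_less_power)
        (auto simp: power3_eq_cube algebra_simps)
    moreover have "7 / 2 / (c * (c+1) * (c+2)) = (3/2) / (c * (c+1) * (c+2)) + 2 / (c * (c+1) * (c+2))"
      by (simp add: add_divide_distrib[symmetric])
    ultimately show "1 / (c * (c+1)\<^sup>2) + 2 / (c+1)^3 \<le> 7 / 2 / (c * (c+1) * (c+2))" by linarith
  qed (use ab in auto)
  finally have bound: "t x - t y \<le> (b - a) * (7 / 2 / (c * (c+1) * (c+2)))" .
  show "t x - t y \<le> 7 / 2 * (y - x) / (real (Suc k) * real (k + 2) * real (k + 3))"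
  proof -
    have e: "b - a = y - x" "real (Suc k) = c" "real (k + 2) = c + 1" "real (k + 3) = c + 2"
      by (simp_all add: a_def b_def c_def)
    show ?thesis using bound unfolding e by (simp only: times_divide_eq_right mult.commute divide_divide_eq_left)
  qed
qed

text \<open>The terms differ from those that define the operator by the telescoping differences of
  \<open>k / (x + k + 1)\<close> times the branch point.\<close>

lemma gauss_op_identity_sums:
  assumes "0 \<le> x"
  shows "(\<lambda>k. real (Suc k) / ((x + real k + 1) * (x + real k + 2)\<^sup>2)) sums gauss_op (\<lambda>y. y) x"
proof -
  have 1: "(\<lambda>k. gauss_weight k x *\<^sub>R gauss_branch k x) sums gauss_op (\<lambda>y. y) x"
    using gauss_op_sums[of x "\<lambda>y. y" 1] assms by auto
  define r where "r = (\<lambda>k. real k / (x + real k + 1) * gauss_branch k x)"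
  have "r \<longlonglongrightarrow> 0" unfolding r_def gauss_branch_def by real_asymp
  then have 2: "(\<lambda>k. r k - r (Suc k)) sums (r 0 - 0)" by (rule telescope_sums')
  have eq: "gauss_weight k x *\<^sub>R gauss_branch k x + (r k - r (Suc k)) =
     real (Suc k) / ((x + real k + 1) * (x + real k + 2)\<^sup>2)" for k
  proof -
    define a where "a = x + real k + 1"
    define c where "c = real k"
    have a: "a > 0" using assms by (auto simp: a_def)
    have x: "1 + x = a - c" by (simp add: a_def c_def)
    have e: "x + c + 1 = a" "x + c + 2 = a + 1" "x + (c + 1) + 1 = a + 1"
        "real k = c" "real (Suc k) = c + 1"
      by (simp_all add: a_def c_def)
    have "gauss_weight k x *\<^sub>R gauss_branch k x + (r k - r (Suc k)) =
      (a - c) / (a * (a + 1)) * (1 / a) + (c / a * (1 / a) - (c + 1) / (a + 1) * (1 / (a + 1)))"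
      unfolding r_def gauss_weight_def gauss_branch_def e x real_scaleR_def by (rule refl)
    also have "\<dots> = (c + 1) / (a * (a + 1)\<^sup>2)"
    proof -
      define b where "b = inverse a"
      define d where "d = inverse (a + 1)"
      have "a * b = 1" "(a + 1) * d = 1" using a by (auto simp: b_def d_def)
      then have "(a - c) * (b * d) * b + (c * b * b - (c + 1) * d * d) = (c + 1) * (b * d\<^sup>2)"
        by algebra
      then show ?thesis by (simp add: b_def d_def divide_inverse power_inverse)
    qed
    finally show ?thesis unfolding e .
  qed
  have "r 0 = 0" by (simp add: r_def)
  then show ?thesis using sums_add[OF 1 2] unfolding eq by simp
qed

lemma reciprocal_triple_sums:
  "(\<lambda>k. 1 / (real (Suc k) * real (k + 2) * real (k + 3))) sums (1/4)"
proof -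
  define r where "r = (\<lambda>k. 1 / (2 * (real k + 1) * (real k + 2)))"
  have "r \<longlonglongrightarrow> 0" unfolding r_def by real_asymp
  then have "(\<lambda>k. r k - r (Suc k)) sums (r 0 - 0)" by (rule telescope_sums')
  moreover have "r k - r (Suc k) = 1 / (real (Suc k) * real (k + 2) * real (k + 3))" for k
  proof -
    define a where "a = real k + 1"
    have a: "a > 0" "real k + 1 = a" "real k + 2 = a + 1" "real k + 3 = a + 2"
      by (auto simp: a_def)
    have "r k - r (Suc k) = 1 / (2 * a * (a + 1)) - 1 / (2 * (a + 1) * (a + 2))"
      by (simp add: r_def a_def add_ac)
    also have "\<dots> = 1 / (a * (a + 1) * (a + 2))"
      using a(1) by (simp add: divide_simps) (simp add: algebra_simps)
    finally show ?thesis using a by (simp add: add_ac)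
  qed
  ultimately show ?thesis by (simp add: r_def)
qed

text \<open>The upper bound sums the termwise bounds; the lower bound keeps only the first term of the series.\<close>

lemma gauss_op_identity_slope:
  shows gauss_op_identity_slope_upper: "variation_le (gauss_op (\<lambda>y. y)) (\<lambda>y. 7/8 * y)"
    and gauss_op_identity_slope_lower: "variation_le (\<lambda>y. 1/81 * y) (\<lambda>x. - gauss_op (\<lambda>y. y) x)"
proof -
  have *: "gauss_op (\<lambda>y. y) x - gauss_op (\<lambda>y. y) y \<in> {1/81 * (y-x)..7/8*(y-x)}"
    if xy: "0 \<le> x" "x \<le> y" "y \<le> 1" for x y :: real
  proof -
    define t where "t = (\<lambda>(k::nat) x. real (Suc k) / ((x + real k + 1) * (x + real k + 2)\<^sup>2))"
    have b: "t k y \<le> t k x" "t k x - t k y \<le> 7 / 2 * (y - x) * (1 / (real (Suc k) * real (k + 2) * real (k + 3)))" for k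
      using identity_slope_term_bounds[of x y k] xy unfolding t_def by auto
    have s: "(\<lambda>k. t k x - t k y) sums (gauss_op (\<lambda>y. y) x - gauss_op (\<lambda>y. y) y)"
      unfolding t_def by (intro sums_diff gauss_op_identity_sums) (use xy in auto)
    have "gauss_op (\<lambda>y. y) x - gauss_op (\<lambda>y. y) y \<le> 7 / 2 * (y - x) * (1/4)"
      by (rule sums_le[OF b(2) s sums_mult[OF reciprocal_triple_sums]])
    moreover have "(\<Sum>k\<in>{0}. t k x - t k y) \<le> (\<Sum>k. t k x - t k y)"
      by (rule sum_le_suminf) (use s b in \<open>auto simp: sums_iff\<close>)
    then have "t 0 x - t 0 y \<le> gauss_op (\<lambda>y. y) x - gauss_op (\<lambda>y. y) y"
      using s by (simp add: sums_iff)
    moreover have "1/81 * (y - x) \<le> t 0 x - t 0 y"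
    proof -
      have e: "t 0 x - t 0 y = ((y+1)*(y+2)\<^sup>2 - (x+1)*(x+2)\<^sup>2) / (((x+1)*(x+2)\<^sup>2) * ((y+1)*(y+2)\<^sup>2))"
        unfolding t_def using xy by (simp add: divide_simps)
      have "((x+1)*(x+2)\<^sup>2) * ((y+1)*(y+2)\<^sup>2) \<le> (2 * 3\<^sup>2) * (2 * 3\<^sup>2)"
        using xy by (intro mult_mono power_mono) auto
      moreover have "0 < ((x+1)*(x+2)\<^sup>2) * ((y+1)*(y+2)\<^sup>2)"
        using xy by (intro mult_pos_pos) auto
      moreover have "4 * (y - x) \<le> (y+1)*(y+2)\<^sup>2 - (x+1)*(x+2)\<^sup>2"
      proof -
        have "(y+1)*(y+2)\<^sup>2 - (x+1)*(x+2)\<^sup>2 - 4 * (y - x) =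
          (y - x) * (y*y + x*y + x*x + 5 * (x + y) + 4)" by (simp add: algebra_simps power2_eq_square)
        moreover have "\<dots> \<ge> 0" using xy by (intro mult_nonneg_nonneg add_nonneg_nonneg) auto
        ultimately show ?thesis by linarith
      qed
      ultimately have "(4 * (y - x)) / 324 \<le> t 0 x - t 0 y"
        unfolding e using xy by (intro frac_le) auto
      then show ?thesis by simp
    qed
    ultimately show ?thesis by auto
  qed
  show "variation_le (gauss_op (\<lambda>y. y)) (\<lambda>y. 7/8 * y)"
    unfolding variation_le_def
  proof (intro allI impI, elim conjE)
    fix x y :: real assume xy: "0 \<le> x" "x \<le> y" "y \<le> 1"
    then have "0 \<le> 1/81 * (y - x)" by auto
    then show "norm (gauss_op (\<lambda>y. y) y - gauss_op (\<lambda>y. y) x) \<le> 7/8 * y - 7/8 * x"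
      using *[OF xy] xy by (auto simp: abs_if)
  qed
  show "variation_le (\<lambda>y. 1/81 * y) (\<lambda>x. - gauss_op (\<lambda>y. y) x)"
    unfolding variation_le_def using * by (fastforce simp: abs_if)
qed

section \<open>A second eigenvalue of the Gauss-Kuzmin-Wirsing operator\<close>

text \<open>Here \<open>\<rho>\<close> is the exponential growth rate of the sequence. For \<open>s\<close> slightly below \<open>\<rho>\<close> the quotients
  \<open>c n / s ^ n\<close> are unbounded, so that their partial sums eventually dwarf the first term. They grow
  slower than \<open>(1 + \<epsilon>/2) ^ n\<close>; if each term were a fixed proportion of the preceding partial sum, the partial
  sums would grow faster than that. So some term is negligible against the partial sum before it.
  In this way the boundary terms of truncated geometric averages become negligible even if the
  series itself converges at the critical rate.\<close>

lemma approximate_growth_rate: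
  fixes c :: "nat \<Rightarrow> real"
  assumes pos: "\<And>n. c n > 0" and lower: "\<And>n. \<delta> * c n \<le> c (Suc n)"
    and upper: "\<And>n. c (Suc n) \<le> q * c n" and "0 < \<delta>" "q \<le> 1"
  obtains \<rho> where "\<delta> \<le> \<rho>" "\<rho> \<le> q"
    "\<And>\<epsilon>. 0 < \<epsilon> \<Longrightarrow> \<exists>s M. 0 < s \<and> \<bar>s - \<rho>\<bar> \<le> \<epsilon> \<and>
        c 0 + c (Suc M) / s ^ Suc M \<le> \<epsilon> * (\<Sum>n\<le>M. c n / s ^ n)"
proof -
  define S where "S = {s. 0 < s \<and> (\<exists>B. \<forall>n. c n \<le> B * s ^ n)}"
  have "\<delta> * c 0 \<le> q * c 0" using lower[of 0] upper[of 0] by linarith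
  then have "\<delta> \<le> q" using pos[of 0] by simp
  then have q: "0 < q" using \<open>0 < \<delta>\<close> by linarith
  have up: "c n \<le> c 0 * q ^ n" for n
  proof (induction n)
    case (Suc n)
    have "c (Suc n) \<le> q * c n" by (rule upper)
    also have "\<dots> \<le> q * (c 0 * q ^ n)" using Suc q by (intro mult_left_mono) auto
    finally show ?case by (simp add: algebra_simps)
  qed simp
  have low: "c 0 * \<delta> ^ n \<le> c n" for n
  proof (induction n)
    case (Suc n)
    have "\<delta> * (c 0 * \<delta> ^ n) \<le> \<delta> * c n" using Suc \<open>0 < \<delta>\<close> by (intro mult_left_mono) auto
    also have "\<dots> \<le> c (Suc n)" by (rule lower)
    finally show ?case by (simp add: algebra_simps)
  qed simp
  have qS: "q \<in> S" using q up by (auto simp: S_def)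
  have S_lower: "\<delta> \<le> s" if "s \<in> S" for s
  proof (rule ccontr)
    assume "\<not> \<delta> \<le> s"
    obtain B where s: "0 < s" and B: "\<And>n. c n \<le> B * s ^ n" using \<open>s \<in> S\<close> by (auto simp: S_def)
    have "1 < \<delta> / s" using \<open>\<not> \<delta> \<le> s\<close> s by simp
    then obtain n where n: "B / c 0 < (\<delta> / s) ^ n" using real_arch_pow by blast
    have "c 0 * \<delta> ^ n \<le> B * s ^ n" using low[of n] B[of n] by linarith
    then have "(\<delta> / s) ^ n \<le> B / c 0" using s pos[of 0] by (simp add: power_divide field_simps)
    then show False using n by linarith
  qed
  define \<rho> where "\<rho> = Inf S"
  have bdd: "bdd_below S" using S_lower by (auto simp: bdd_below_def)
  have \<rho>: "\<delta> \<le> \<rho>" "\<rho> \<le> q"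
    unfolding \<rho>_def using qS S_lower by (auto intro!: cInf_greatest cInf_lower bdd)
  show ?thesis
  proof (rule that[OF \<rho>])
    fix \<epsilon> :: real assume \<epsilon>: "0 < \<epsilon>"
    \<comment> \<open>Just below the growth rate, but so close that the growth rate stays below s (1 +
      epsilon/2).\<close>
    define s where "s = \<rho> / (1 + \<epsilon> / 4)"
    have s: "0 < s" "s < \<rho>" using \<epsilon> \<rho> \<open>0 < \<delta>\<close> by (auto simp: s_def field_simps)
    have "\<rho> - s = s * \<epsilon> / 4" using \<epsilon> by (simp add: s_def field_simps)
    moreover have "s * \<epsilon> \<le> 1 * \<epsilon>" using s \<rho> \<open>q \<le> 1\<close> \<epsilon> by (intro mult_right_mono) auto
    ultimately have s_near: "\<bar>s - \<rho>\<bar> \<le> \<epsilon>" using \<epsilon> s unfolding abs_le_iff by linarith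
    have "s \<notin> S" using s cInf_lower[OF _ bdd] unfolding \<rho>_def by force
    have "\<rho> < s * (1 + \<epsilon> / 2)" using \<epsilon> \<rho> \<open>0 < \<delta>\<close> by (simp add: s_def field_simps)
    then obtain s' where s': "s' \<in> S" "s' < s * (1 + \<epsilon> / 2)"
      using cInf_lessD[of S] qS unfolding \<rho>_def by blast
    then obtain B where "0 < s'" and B: "\<And>n. c n \<le> B * s' ^ n" by (auto simp: S_def)
    define d where "d = (\<lambda>n. c n / s ^ n)"
    define A where "A = (\<lambda>M. \<Sum>n\<le>M. d n)"
    have d: "d n > 0" for n using pos s by (simp add: d_def)
    have A: "A M > 0" for M unfolding A_def using d by (intro sum_pos) auto
    have "\<exists>M. c 0 + d (Suc M) \<le> \<epsilon> * A M"
    proof (rule ccontr)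
      assume "\<nexists>M. c 0 + d (Suc M) \<le> \<epsilon> * A M"
      then have less: "\<epsilon> * A M < c 0 + d (Suc M)" for M
        by (auto simp: not_le)
      \<comment> \<open>From M0 on, the first term is at most half of the permitted error.\<close>
      obtain M0 where M0: "2 * c 0 / \<epsilon> < d M0"
      proof (rule ccontr)
        assume "\<not> thesis"
        then have "\<forall>n. c n \<le> 2 * c 0 / \<epsilon> * s ^ n"
          using that s by (force simp: d_def field_simps not_less)
        then have "\<exists>B. \<forall>n. c n \<le> B * s ^ n" by blast
        then show False using \<open>s \<notin> S\<close> s by (simp add: S_def)
      qed
      have A_mono: "A M0 \<le> A (M0 + j)" for j
        unfolding A_def using d by (intro sum_mono2) (auto intro: less_imp_le)
      have "d M0 \<le> A M0" unfolding A_def using d by (intro member_le_sum) (auto intro: less_imp_le)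
      have grow: "\<epsilon> / 2 * A (M0 + j) \<le> d (Suc (M0 + j))" for j
      proof -
        have "2 * c 0 / \<epsilon> < A (M0 + j)" using M0 \<open>d M0 \<le> A M0\<close> A_mono[of j] by linarith
        then have "c 0 < \<epsilon> / 2 * A (M0 + j)" using \<epsilon> by (simp add: field_simps)
        then show ?thesis using less[of "M0 + j"] by linarith
      qed
      have A_grow: "(1 + \<epsilon> / 2) ^ j * A M0 \<le> A (M0 + j)" for j
      proof (induction j)
        case (Suc j)
        have "(1 + \<epsilon> / 2) * ((1 + \<epsilon> / 2) ^ j * A M0) \<le> (1 + \<epsilon> / 2) * A (M0 + j)"
          using Suc \<epsilon> by (intro mult_left_mono) auto
        also have "\<dots> \<le> A (M0 + j) + d (Suc (M0 + j))" using grow[of j] by (simp add: algebra_simps)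
        also have "\<dots> = A (M0 + Suc j)" by (simp add: A_def)
        finally show ?case by (simp add: algebra_simps)
      qed simp
      define r where "r = s' / s"
      have r: "0 < r" "1 < (1 + \<epsilon> / 2) / r" 
        using s' s \<open>0 < s'\<close> by (auto simp: r_def field_simps)
      have d_le: "d n \<le> B * r ^ n" for n
        using B[of n] s by (simp add: d_def r_def power_divide field_simps)
      obtain j where j: "B * r ^ Suc M0 / (\<epsilon> / 2 * A M0) < ((1 + \<epsilon> / 2) / r) ^ j"
        using real_arch_pow[OF r(2)] by blast
      have "\<epsilon> / 2 * ((1 + \<epsilon> / 2) ^ j * A M0) \<le> \<epsilon> / 2 * A (M0 + j)"
        using A_grow[of j] \<epsilon> by (intro mult_left_mono) auto
      also have "\<dots> \<le> B * r ^ Suc (M0 + j)" using grow[of j] d_le[of "Suc (M0 + j)"] by linarith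
      finally have le: "\<epsilon> / 2 * ((1 + \<epsilon> / 2) ^ j * A M0) \<le> B * r ^ Suc (M0 + j)" .
      define e where "e = 1 + \<epsilon> / 2"
      have "B * r ^ Suc M0 < (e / r) ^ j * (\<epsilon> / 2 * A M0)"
        using j \<epsilon> A[of M0] by (simp add: e_def pos_divide_less_eq)
      then have "B * r ^ Suc M0 * r ^ j < (e / r) ^ j * (\<epsilon> / 2 * A M0) * r ^ j"
        using r by (intro mult_strict_right_mono) auto
      then have "B * r ^ Suc (M0 + j) < \<epsilon> / 2 * (e ^ j * A M0)"
        using r(1) by (simp add: power_divide power_add mult_ac)
      then show False using le by (simp add: e_def)
    qed
    then show "\<exists>s M. 0 < s \<and> \<bar>s - \<rho>\<bar> \<le> \<epsilon> \<and>
        c 0 + c (Suc M) / s ^ Suc M \<le> \<epsilon> * (\<Sum>n\<le>M. c n / s ^ n)"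
      using s s_near unfolding d_def A_def by blast
  qed
qed

definition gkw_kernel :: "complex \<Rightarrow> real \<Rightarrow> complex" where
  "gkw_kernel z y = (1 + of_real y) / (1 + z * of_real y)\<^sup>2"

text \<open>Both sides are the series of \<open>(1 + y) / (z + y + k)\<^sup>2\<close>, in which \<open>y\<close> and \<open>z\<close> enter symmetrically up to
  the factor \<open>1 + y\<close>.\<close>

lemma gkw_operator_kernel:
  assumes z: "Re z \<ge> -1/2" and y: "0 \<le> y"
  shows "gkw_operator (\<lambda>w. gkw_kernel w y) z = gauss_op (gkw_kernel z) y"
  unfolding gkw_operator_def gauss_op_def
proof (rule suminf_cong)
  fix k
  define u where "u = z + of_nat (Suc k)"
  define v where "v = complex_of_real (y + real k + 1)"
  have u: "u \<noteq> 0" using z by (auto simp: u_def complex_eq_iff)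
  have v: "v \<noteq> 0" "v + 1 \<noteq> 0" using y by (auto simp: v_def complex_eq_iff)
  have uv: "u + of_real y = z + v" by (simp add: u_def v_def)
  have "Re (u + of_real y) > 0" using z y by (simp add: u_def)
  then have uy: "u + of_real y \<noteq> 0" by (metis less_irrefl zero_complex.sel(1))
  have "1 / u\<^sup>2 * gkw_kernel (1 / u) y = (1 + of_real y) / (u + of_real y)\<^sup>2"
    using u uy by (simp add: gkw_kernel_def field_simps)
  moreover have "gauss_weight k y *\<^sub>R gkw_kernel z (gauss_branch k y) =
      (1 + of_real y) / (v * (v + 1)) * ((1 + 1 / v) / (1 + z / v)\<^sup>2)"
    by (simp add: gkw_kernel_def gauss_weight_def gauss_branch_def v_def scaleR_conv_of_real add_ac)
  moreover have "(1 + of_real y) / (v * (v + 1)) * ((1 + 1 / v) / (1 + z / v)\<^sup>2) =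
      (1 + of_real y) / (z + v)\<^sup>2"
  proof -
    have "1 + 1 / v = (v + 1) / v" "1 + z / v = (z + v) / v" using v by (auto simp: field_simps)
    then show ?thesis using v uy unfolding uv by (simp add: power_divide power2_eq_square)
  qed
  ultimately show "1 / (z + of_nat (Suc k))\<^sup>2 * gkw_kernel (1 / (z + of_nat (Suc k))) y =
      gauss_weight k y *\<^sub>R gkw_kernel z (gauss_branch k y)"
    unfolding u_def[symmetric] uv by simp
qed

definition gkw_bound :: real where
  "gkw_bound = (\<Sum>k. 4 / (real k + 1)\<^sup>2)"

lemma gkw_bound_summable: "summable (\<lambda>k. 4 / (real k + 1)\<^sup>2)"
proof -
  have "summable (\<lambda>k. 4 * (inverse (real (Suc k) ^ 2)))"
    using inverse_power_summable[of 2, where 'a=real]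
      summable_Suc_iff[of "\<lambda>k. inverse (real k ^ 2)"] by (intro summable_mult) blast
  then show ?thesis by (simp add: divide_inverse add.commute)
qed

text \<open>Inversion maps the half plane of real part at least \<open>1/2\<close> to the closed unit disc around \<open>1\<close>. So
  one application of the operator only sees values in that disc, which is compactly contained in the domain of
  holomorphy used below.\<close>

lemma gkw_branch_facts:
  assumes "Re z \<ge> -1/2"
  shows "1 / (z + of_nat (Suc k)) \<in> cball 1 1"
    and "norm (1 / (z + of_nat (Suc k))\<^sup>2) \<le> 4 / (real k + 1)\<^sup>2"
proof -
  define u where "u = z + of_nat (Suc k)"
  have Re: "Re u \<ge> real k + 1/2" using assms by (simp add: u_def)
  then have u: "u \<noteq> 0" by auto
  have nu: "norm u \<ge> (real k + 1) / 2" using Re complex_Re_le_cmod[of u] by simp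
  have "norm (1 - u) \<le> norm u"
  proof (rule power2_le_imp_le)
    have "(norm (1 - u))\<^sup>2 = (norm u)\<^sup>2 + 1 - 2 * Re u"
      unfolding cmod_power2 by (simp add: power2_eq_square algebra_simps)
    then show "(norm (1 - u))\<^sup>2 \<le> (norm u)\<^sup>2" using Re by simp
  qed simp
  moreover have "1 - 1 / u = (u - 1) / u" using u by (simp add: field_simps)
  ultimately have "norm (1 - 1 / u) \<le> 1"
    using u by (simp add: norm_divide norm_minus_commute divide_le_eq_1)
  then show "1 / (z + of_nat (Suc k)) \<in> cball 1 1"
    unfolding u_def mem_cball dist_norm .
  have "norm (1 / u\<^sup>2) = 1 / (norm u)\<^sup>2" by (simp add: norm_divide norm_power)
  also have "\<dots> \<le> 1 / ((real k + 1) / 2)\<^sup>2" using nu u by (intro divide_left_mono power_mono) auto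
  also have "\<dots> = 4 / (real k + 1)\<^sup>2" by (simp add: power_divide)
  finally show "norm (1 / (z + of_nat (Suc k))\<^sup>2) \<le> 4 / (real k + 1)\<^sup>2" by (simp add: u_def)
qed

lemma gkw_operator_sums:
  assumes z: "Re z \<ge> -1/2" and f: "\<And>w. w \<in> cball 1 1 \<Longrightarrow> norm (f w) \<le> B"
  shows "(\<lambda>k. 1 / (z + of_nat (Suc k))\<^sup>2 * f (1 / (z + of_nat (Suc k)))) sums gkw_operator f z"
    and "norm (gkw_operator f z) \<le> gkw_bound * B"
proof -
  let ?a = "\<lambda>k. 1 / (z + of_nat (Suc k))\<^sup>2 * f (1 / (z + of_nat (Suc k)))"
  have le: "norm (?a k) \<le> 4 / (real k + 1)\<^sup>2 * B" for k
    unfolding norm_mult using gkw_branch_facts[OF z, of k] f[of "1 / (z + of_nat (Suc k))"]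
    by (intro mult_mono) auto
  have s: "summable (\<lambda>k. 4 / (real k + 1)\<^sup>2 * B)" by (intro summable_mult2 gkw_bound_summable)
  have sn: "summable (\<lambda>k. norm (?a k))"
    by (rule summable_comparison_test'[OF s, of 0]) (use le in simp)
  show "?a sums gkw_operator f z"
    unfolding gkw_operator_def by (rule summable_sums[OF summable_norm_cancel[OF sn]])
  have "norm (gkw_operator f z) \<le> (\<Sum>k. norm (?a k))"
    unfolding gkw_operator_def by (rule summable_norm[OF sn])
  also have "\<dots> \<le> (\<Sum>k. 4 / (real k + 1)\<^sup>2 * B)" by (rule suminf_le[OF le sn s])
  also have "\<dots> = gkw_bound * B" unfolding gkw_bound_def by (rule suminf_mult2[OF gkw_bound_summable, symmetric])
  finally show "norm (gkw_operator f z) \<le> gkw_bound * B" .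
qed

lemma gkw_operator_diff_le:
  assumes z: "Re z \<ge> -1/2" and f: "\<And>w. w \<in> cball 1 1 \<Longrightarrow> norm (f w) \<le> B"
    and g: "\<And>w. w \<in> cball 1 1 \<Longrightarrow> norm (g w) \<le> C"
    and fg: "\<And>w. w \<in> cball 1 1 \<Longrightarrow> norm (f w - g w) \<le> e"
  shows "norm (gkw_operator f z - gkw_operator g z) \<le> gkw_bound * e"
proof -
  have "(\<lambda>k. 1 / (z + of_nat (Suc k))\<^sup>2 * (f (1 / (z + of_nat (Suc k))) - g (1 / (z + of_nat (Suc k)))))
      sums (gkw_operator f z - gkw_operator g z)"
    using sums_diff[OF gkw_operator_sums(1)[OF z f] gkw_operator_sums(1)[OF z g]]
    by (simp add: right_diff_distrib)
  then have "gkw_operator f z - gkw_operator g z = gkw_operator (\<lambda>w. f w - g w) z"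
    unfolding gkw_operator_def by (simp add: sums_iff)
  then show ?thesis using gkw_operator_sums(2)[OF z fg] by simp
qed

lemma gkw_operator_linear_combination:
  assumes z: "Re z \<ge> -1/2" and f: "\<And>i w. i \<in> I \<Longrightarrow> w \<in> cball 1 1 \<Longrightarrow> norm (f i w) \<le> B"
  shows "gkw_operator (\<lambda>w. \<Sum>i\<in>I. c i * f i w) z = (\<Sum>i\<in>I. c i * gkw_operator (f i) z)"
proof -
  have "(\<lambda>k. \<Sum>i\<in>I. c i * (1 / (z + of_nat (Suc k))\<^sup>2 * f i (1 / (z + of_nat (Suc k)))))
     sums (\<Sum>i\<in>I. c i * gkw_operator (f i) z)"
    by (intro sums_sum sums_mult gkw_operator_sums(1)[OF z f]) auto
  then show ?thesis
    unfolding gkw_operator_def by (simp add: sums_iff sum_distrib_left mult_ac)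
qed

definition kernel_iterate :: "nat \<Rightarrow> complex \<Rightarrow> real \<Rightarrow> complex" where
  "kernel_iterate n z = (gauss_op ^^ n) (gkw_kernel z)"

lemma kernel_iterate_0 [simp]: "kernel_iterate 0 z = gkw_kernel z"
  and kernel_iterate_Suc: "kernel_iterate (Suc n) z = gauss_op (kernel_iterate n z)"
  by (simp_all add: kernel_iterate_def)

text \<open>The disc of radius \<open>8/5\<close> contains the closed disc of radius \<open>3/2\<close> in its interior and
  still keeps away from the singularities \<open>-1/y\<close> of the kernel.\<close>

lemma gkw_kernel_denominator:
  fixes z :: complex
  assumes "z \<in> ball 1 (8/5)" "y \<in> {0..1}"
  shows "norm (1 + z * of_real y) \<ge> 2/5"
proof -
  have "\<bar>Re (1 - z)\<bar> \<le> norm (1 - z)" by (rule abs_Re_le_cmod)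
  then have "Re z \<ge> -3/5" using assms by (simp add: dist_norm abs_le_iff)
  then have "Re z * y \<ge> (-3/5) * y" using assms by (intro mult_right_mono) auto
  then have "2/5 \<le> Re (1 + z * of_real y)" using assms by simp
  also have "\<dots> \<le> norm (1 + z * of_real y)" by (rule complex_Re_le_cmod)
  finally show ?thesis .
qed

lemma norm_kernel_iterate_le:
  assumes "z \<in> ball 1 (8/5)" "y \<in> {0..1}"
  shows "norm (kernel_iterate n z y) \<le> 25/2"
  using assms(2)
proof (induction n arbitrary: y)
  case 0
  have "norm (1 + complex_of_real y) \<le> 2" 
    using norm_triangle_ineq[of 1 "complex_of_real y"] 0 by simp
  moreover have "(2/5)\<^sup>2 \<le> (norm (1 + z * of_real y))\<^sup>2"
    using gkw_kernel_denominator[OF assms(1) 0] by (intro power_mono) auto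
  ultimately have "norm (gkw_kernel z y) \<le> 2 / (2/5)\<^sup>2"
    unfolding gkw_kernel_def norm_divide norm_power by (intro frac_le) auto
  then show ?case by (simp add: power2_eq_square)
next
  case (Suc n)
  then show ?case unfolding kernel_iterate_Suc by (intro norm_gauss_op_le) auto
qed

lemma kernel_iterate_holomorphic:
  assumes "y \<in> {0..1}"
  shows "(\<lambda>z. kernel_iterate n z y) holomorphic_on ball 1 (8/5)"
  using assms
proof (induction n arbitrary: y)
  case 0
  have "1 + z * of_real y \<noteq> 0" if "z \<in> ball 1 (8/5)" for z :: complex
    using gkw_kernel_denominator[OF that 0] by auto
  then show ?case by (auto simp: gkw_kernel_def intro!: holomorphic_intros)
next
  case (Suc n)
  show ?case
  proof (rule holomorphic_uniform_sequence)
    show "(\<lambda>z. \<Sum>k<N. gauss_weight k y *\<^sub>R kernel_iterate n z (gauss_branch k y)) holomorphic_on ball 1 (8/5)" for N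
      unfolding scaleR_conv_of_real using Suc gauss_branch_in[of y] by (intro holomorphic_intros) auto
    fix x :: complex assume "x \<in> ball 1 (8/5)"
    then obtain d where d: "0 < d" "cball x d \<subseteq> ball 1 (8/5)" using open_ball open_contains_cball by metis
    have "uniform_limit (cball x d) (\<lambda>N z. \<Sum>k<N. gauss_weight k y *\<^sub>R kernel_iterate n z (gauss_branch k y))
       (\<lambda>z. \<Sum>k. gauss_weight k y *\<^sub>R kernel_iterate n z (gauss_branch k y)) sequentially"
    proof (rule Weierstrass_m_test)
      show "norm (gauss_weight k y *\<^sub>R kernel_iterate n z (gauss_branch k y)) \<le> gauss_weight k y * (25/2)"
        if "z \<in> cball x d" for k z
      proof -
        have "norm (kernel_iterate n z (gauss_branch k y)) \<le> 25/2"
          using Suc.prems that d gauss_branch_in[of y k] by (intro norm_kernel_iterate_le) auto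
        then show ?thesis
          using gauss_weight_nonneg[of y k] Suc.prems
            mult_left_mono[of "norm (kernel_iterate n z (gauss_branch k y))" "25/2" "gauss_weight k y"] by simp
      qed
      show "summable (\<lambda>k. gauss_weight k y * (25/2))"
        using sums_mult2[OF gauss_weight_sums[of y], of "25/2"] Suc.prems by (simp add: sums_iff)
    qed
    then show "\<exists>d>0. cball x d \<subseteq> ball 1 (8/5) \<and> uniform_limit (cball x d)
      (\<lambda>N z. \<Sum>k<N. gauss_weight k y *\<^sub>R kernel_iterate n z (gauss_branch k y))
      (\<lambda>z. kernel_iterate (Suc n) z y) sequentially"
      using d unfolding kernel_iterate_Suc gauss_op_def by blast
  qed simp
qed

lemma cball_1_1_subset: "cball 1 1 \<subseteq> ball (1::complex) (8/5)"
  by auto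

text \<open>The identity for the kernel is propagated through the series that defines the Gauss operator in the
  second variable. The two series may be exchanged since the partial sums in the second variable converge
  uniformly in the first.\<close>

lemma gkw_operator_kernel_iterate:
  assumes z: "Re z \<ge> -1/2" and y: "y \<in> {0..1}"
  shows "gkw_operator (\<lambda>w. kernel_iterate n w y) z = kernel_iterate (Suc n) z y"
  using y
proof (induction n arbitrary: y)
  case 0
  then show ?case using z by (simp add: gkw_operator_kernel kernel_iterate_Suc)
next
  case (Suc n)
  then have y: "0 \<le> y" by simp
  let ?S = "\<lambda>N w. \<Sum>k<N. of_real (gauss_weight k y) * kernel_iterate n w (gauss_branch k y)"
  have bound: "norm (kernel_iterate n w (gauss_branch k y)) \<le> 25/2" if "w \<in> cball 1 1" for n k w
    using that cball_1_1_subset gauss_branch_in[OF y] by (intro norm_kernel_iterate_le) auto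
  have S_eq: "gkw_operator (?S N) z = (\<Sum>k<N. gauss_weight k y *\<^sub>R kernel_iterate (Suc n) z (gauss_branch k y))" for N
    using Suc.IH[OF gauss_branch_in[OF y]]
    by (subst gkw_operator_linear_combination[OF z bound]) (auto simp: scaleR_conv_of_real)
  have tail: "norm (?S N w - kernel_iterate (Suc n) w y) \<le> 25/2 * (1 - real N / (y + real N + 1))"
    if w: "w \<in> cball 1 1" for N w
  proof -
    let ?a = "\<lambda>k. gauss_weight k y *\<^sub>R kernel_iterate n w (gauss_branch k y)"
    have wS: "w \<in> ball 1 (8/5)" using w cball_1_1_subset by auto
    have s: "summable (\<lambda>k. norm (?a k))"
      by (rule gauss_op_norm_summable[OF y norm_kernel_iterate_le[OF wS]])
    have sw: "(\<lambda>k. gauss_weight k y * (25/2)) sums (25/2)"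
      using sums_mult2[OF gauss_weight_sums[OF y], of "25/2"] by simp
    have "kernel_iterate (Suc n) w y = (\<Sum>k. ?a (k + N)) + ?S N w"
      unfolding kernel_iterate_Suc gauss_op_def
      by (subst suminf_split_initial_segment[OF summable_norm_cancel[OF s], of N])
        (simp add: scaleR_conv_of_real)
    then have "norm (?S N w - kernel_iterate (Suc n) w y) = norm (\<Sum>k. ?a (k + N))"
      by simp
    also have "\<dots> \<le> (\<Sum>k. norm (?a (k + N)))"
      by (rule summable_norm) (rule summable_ignore_initial_segment[OF s])
    also have "\<dots> \<le> (\<Sum>k. gauss_weight (k + N) y * (25/2))"
    proof (rule suminf_le)
      show "norm (?a (k + N)) \<le> gauss_weight (k + N) y * (25/2)" for k
        using gauss_weight_nonneg[OF y, of "k + N"] mult_left_mono[OF bound[OF w, of n "k + N"], of "gauss_weight (k + N) y"]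
        by simp
      show "summable (\<lambda>k. norm (?a (k + N)))" by (rule summable_ignore_initial_segment[OF s])
      show "summable (\<lambda>k. gauss_weight (k + N) y * (25/2))"
        using summable_ignore_initial_segment[of "\<lambda>k. gauss_weight k y * (25/2)" N] sw by (simp add: sums_iff)
    qed
    also have "\<dots> = 25/2 - (\<Sum>k<N. gauss_weight k y * (25/2))"
      using suminf_split_initial_segment[of "\<lambda>k. gauss_weight k y * (25/2)" N] sw by (simp add: sums_iff)
    also have "\<dots> = 25/2 * (1 - real N / (y + real N + 1))"
      unfolding sum_distrib_right[symmetric] sum_gauss_weight[OF y] by (simp add: algebra_simps)
    finally show ?thesis .
  qed
  have diff: "norm (gkw_operator (?S N) z - gkw_operator (\<lambda>w. kernel_iterate (Suc n) w y) z)
      \<le> gkw_bound * (25/2 * (1 - real N / (y + real N + 1)))" for N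
  proof (rule gkw_operator_diff_le[OF z _ _ tail])
    show "norm (?S N w) \<le> (\<Sum>k<N. 25/2)" if "w \<in> cball 1 1" for w
    proof (rule sum_norm_le)
      fix k assume "k \<in> {..<N}"
      have "gauss_weight k y \<le> (\<Sum>k<Suc k. gauss_weight k y)"
        using gauss_weight_nonneg[OF y] by (simp add: sum_nonneg)
      also have "\<dots> \<le> 1" unfolding sum_gauss_weight[OF y] using y by (simp add: field_simps)
      finally have "gauss_weight k y * norm (kernel_iterate n w (gauss_branch k y)) \<le> 1 * (25/2)"
        using bound[OF that, of n k] gauss_weight_nonneg[OF y, of k] by (intro mult_mono) auto
      then show "norm (of_real (gauss_weight k y) * kernel_iterate n w (gauss_branch k y)) \<le> 25/2"
        using gauss_weight_nonneg[OF y, of k] by (simp add: norm_mult)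
    qed
    show "norm (kernel_iterate (Suc n) w y) \<le> 25/2" if "w \<in> cball 1 1" for w
      using that cball_1_1_subset Suc.prems by (intro norm_kernel_iterate_le) auto
  qed
  have lim0: "(\<lambda>N. gkw_bound * (25/2 * (1 - real N / (y + real N + 1)))) \<longlonglongrightarrow> 0"
    by real_asymp
  have "(\<lambda>N. gkw_operator (?S N) z - gkw_operator (\<lambda>w. kernel_iterate (Suc n) w y) z) \<longlonglongrightarrow> 0"
    by (rule Lim_null_comparison[OF always_eventually[OF allI[OF diff]] lim0])
  then have lim1: "(\<lambda>N. gkw_operator (?S N) z) \<longlonglongrightarrow> gkw_operator (\<lambda>w. kernel_iterate (Suc n) w y) z"
    by (rule LIM_zero_cancel)
  have zn: "norm (kernel_iterate (Suc n) z y') \<le> gkw_bound * (25/2)" if "y' \<in> {0..1}" for y'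
    unfolding Suc.IH[OF that, symmetric]
    using that cball_1_1_subset by (intro gkw_operator_sums(2)[OF z] norm_kernel_iterate_le) auto
  have "(\<lambda>N. gkw_operator (?S N) z) \<longlonglongrightarrow> kernel_iterate (Suc (Suc n)) z y"
    unfolding S_eq kernel_iterate_Suc[of "Suc n"] 
    using gauss_op_sums[OF y zn] unfolding sums_def .
  from LIMSEQ_unique[OF lim1 this] show ?case .
qed

text \<open>The sign is absorbed in each step, so that all these functions are increasing.\<close>

definition identity_iterate :: "nat \<Rightarrow> real \<Rightarrow> real" where
  "identity_iterate n = ((\<lambda>g x. - gauss_op g x) ^^ n) (\<lambda>x. x)"

lemma identity_iterate_0 [simp]: "identity_iterate 0 = (\<lambda>x. x)"
  and identity_iterate_Suc: "identity_iterate (Suc n) = (\<lambda>x. - gauss_op (identity_iterate n) x)"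
  by (simp_all add: identity_iterate_def)

lemma identity_iterate_bound:
  assumes "y \<in> {0..1}" shows "\<bar>identity_iterate n y\<bar> \<le> 1"
  using assms
proof (induction n arbitrary: y)
  case (Suc n)
  then show ?case using norm_gauss_op_le[of y "identity_iterate n" 1] by (auto simp: identity_iterate_Suc)
qed auto

lemma variation_le_gauss_op_iterate:
  fixes f :: "real \<Rightarrow> 'a::banach"
  assumes "variation_le f (\<lambda>x. C * identity_iterate n x)"
  shows "variation_le (gauss_op f) (\<lambda>x. C * identity_iterate (Suc n) x)"
proof -
  have "gauss_op (\<lambda>x. C * identity_iterate n x) x = C * gauss_op (identity_iterate n) x" if "0 \<le> x" for x
    using gauss_op_scaleR[OF that, of "identity_iterate n" 1 C] identity_iterate_bound by simp
  then show ?thesis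
    using variation_le_gauss_op[OF assms] unfolding variation_le_def identity_iterate_Suc by simp
qed

definition identity_range :: "nat \<Rightarrow> real" where
  "identity_range n = identity_iterate n 1 - identity_iterate n 0"

lemma identity_iterate_contract:
  "variation_le (identity_iterate (Suc n)) (\<lambda>x. 7/8 * identity_iterate n x)"
proof (induction n)
  case 0
  show ?case using gauss_op_identity_slope_upper
    by (simp add: identity_iterate_Suc variation_le_def abs_minus_commute)
next
  case (Suc n)
  from variation_le_gauss_op_iterate[OF this] show ?case
    unfolding variation_le_def identity_iterate_Suc[of "Suc n"] by (simp add: abs_minus_commute)
qed

lemma identity_iterate_expand:
  "variation_le (\<lambda>x. 1/81 * identity_iterate n x) (identity_iterate (Suc n))"
proof (induction n)
  case 0
  show ?case using gauss_op_identity_slope_lower by (simp add: identity_iterate_Suc)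
next
  case (Suc n)
  define f where "f = (\<lambda>x. 1/81 * identity_iterate n x)"
  have "variation_le (gauss_op f) (identity_iterate (Suc (Suc n)))"
    using variation_le_gauss_op[OF Suc] by (simp add: identity_iterate_Suc[of "Suc n"] f_def)
  moreover have "1/81 * identity_iterate (Suc n) x = - gauss_op f x" if "0 \<le> x" for x
    using gauss_op_scaleR[OF that, of "identity_iterate n" 1 "1/81"] identity_iterate_bound
    by (simp add: identity_iterate_Suc f_def)
  ultimately show ?case
    unfolding variation_le_def by (simp add: abs_minus_commute)
qed

lemma identity_range_bounds:
  "identity_range (Suc n) \<le> 7/8 * identity_range n"
  "1/81 * identity_range n \<le> identity_range (Suc n)"
  "0 < identity_range n"
proof -
  show upper: "identity_range (Suc n) \<le> 7/8 * identity_range n" for n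
    using variation_leD[OF identity_iterate_contract[of n], of 0 1] by (simp add: identity_range_def)
  show lower: "1/81 * identity_range n \<le> identity_range (Suc n)" for n
    using variation_leD[OF identity_iterate_expand[of n], of 0 1] by (simp add: identity_range_def)
  show "0 < identity_range n"
  proof (induction n)
    case 0 show ?case by (simp add: identity_range_def)
  next
    case (Suc n) then show ?case using lower[of n] by simp
  qed
qed

text \<open>The increment has the explicit form \<open>(y - x)\<close> times a polynomial of modulus at most \<open>34\<close>, divided
  by the squares of two denominators of modulus at least \<open>2/5\<close>.\<close>

lemma kernel_variation:
  assumes z: "z \<in> ball 1 (8/5)"
  shows "variation_le (gkw_kernel z) (\<lambda>y. 1400 * y)"
  unfolding variation_le_def
proof (intro allI impI, elim conjE)
  fix x y :: real assume xy: "0 \<le> x" "x \<le> y" "y \<le> 1"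
  define a where "a = complex_of_real x"
  define b where "b = complex_of_real y"
  define p where "p = 1 + z * a"
  define q where "q = 1 + z * b"
  have p: "norm p \<ge> 2/5" and q: "norm q \<ge> 2/5"
    using gkw_kernel_denominator[OF z] xy by (auto simp: p_def q_def a_def b_def)
  then have pq: "p \<noteq> 0" "q \<noteq> 0" by auto
  have ab: "norm a \<le> 1" "norm b \<le> 1" using xy by (auto simp: a_def b_def)
  have "norm z - norm (1::complex) \<le> norm (z - 1)" by (rule norm_triangle_ineq2)
  then have z3: "norm z \<le> 3" using z by (simp add: dist_norm norm_minus_commute)
  have "gkw_kernel z y - gkw_kernel z x = ((1 + b) * p\<^sup>2 - (1 + a) * q\<^sup>2) / (p\<^sup>2 * q\<^sup>2)"
  proof -
    have "gkw_kernel z y = (1 + b) / q\<^sup>2" "gkw_kernel z x = (1 + a) / p\<^sup>2"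
      by (simp_all add: gkw_kernel_def a_def b_def p_def q_def)
    then show ?thesis using pq by (simp add: diff_frac_eq mult.commute)
  qed
  also have "(1 + b) * p\<^sup>2 - (1 + a) * q\<^sup>2 = (b - a) * (1 - 2 * z - z\<^sup>2 * (a + b) - z\<^sup>2 * (a * b))"
    by (simp add: p_def q_def power2_eq_square algebra_simps)
  finally have e: "gkw_kernel z y - gkw_kernel z x =
     (b - a) * (1 - 2 * z - z\<^sup>2 * (a + b) - z\<^sup>2 * (a * b)) / (p\<^sup>2 * q\<^sup>2)" .
  have "norm (z\<^sup>2) \<le> 9" using power_mono[OF z3, of 2] by (simp add: norm_power)
  then have "norm (z\<^sup>2 * (a + b)) \<le> 9 * 2" "norm (z\<^sup>2 * (a * b)) \<le> 9 * (1 * 1)"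
    using ab norm_triangle_ineq[of a b] unfolding norm_mult by (intro mult_mono; simp)+
  moreover have "norm (2 * z) \<le> 6" using z3 by (simp add: norm_mult)
  ultimately have num: "norm (1 - 2 * z - z\<^sup>2 * (a + b) - z\<^sup>2 * (a * b)) \<le> 34"
    using norm_triangle_ineq4[of 1 "2*z"] norm_triangle_ineq4[of "1 - 2 * z" "z\<^sup>2 * (a + b)"]
      norm_triangle_ineq4[of "1 - 2 * z - z\<^sup>2 * (a + b)" "z\<^sup>2 * (a * b)"] by simp
  have "norm (b - a) = y - x" using xy by (simp add: a_def b_def flip: of_real_diff)
  moreover have "(2/5)\<^sup>2 * (2/5)\<^sup>2 \<le> norm (p\<^sup>2 * q\<^sup>2)"
    unfolding norm_mult norm_power using p q by (intro mult_mono power_mono) auto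
  ultimately have "norm (gkw_kernel z y - gkw_kernel z x) \<le> (y - x) * 34 / ((2/5)\<^sup>2 * (2/5)\<^sup>2)"
    unfolding e norm_divide norm_mult[of "b - a"] using num xy by (intro frac_le mult_mono) auto
  also have "\<dots> \<le> 1400 * (y - x)" using xy by (simp add: power2_eq_square)
  finally show "norm (gkw_kernel z y - gkw_kernel z x) \<le> 1400 * y - 1400 * x" by (simp add: algebra_simps)
qed

lemma kernel_iterate_variation:
  assumes z: "z \<in> ball 1 (8/5)"
  shows "variation_le (kernel_iterate n z) (\<lambda>y. 1400 * identity_iterate n y)"
proof (induction n)
  case 0 show ?case using kernel_variation[OF z] by simp
next
  case (Suc n) show ?case unfolding kernel_iterate_Suc by (rule variation_le_gauss_op_iterate[OF Suc])
qed

text \<open>Up to the sign this is the image of the function \<open>2 / (1 + z)\<^sup>2 - 1\<close> under the \<open>n\<close>-th power of the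
  Gauss-Kuzmin-Wirsing operator.\<close>

definition gkw_iterate :: "nat \<Rightarrow> complex \<Rightarrow> complex" where
  "gkw_iterate n z = (-1) ^ n * (kernel_iterate n z 1 - kernel_iterate n z 0)"

lemma norm_gkw_iterate_le:
  assumes "z \<in> ball 1 (8/5)"
  shows "norm (gkw_iterate n z) \<le> 1400 * identity_range n"
proof -
  have "norm (gkw_iterate n z) = norm (kernel_iterate n z 1 - kernel_iterate n z 0)"
    unfolding gkw_iterate_def norm_mult norm_power by simp
  then show ?thesis
    using variation_leD[OF kernel_iterate_variation[OF assms, of n], of 0 1]
    by (simp add: identity_range_def right_diff_distrib)
qed

text \<open>The kernel at \<open>z = 0\<close> is \<open>1 + y\<close>, and constants are fixed by the Gauss operator. This value is the
  yardstick for the whole disc, and it keeps the limit function from vanishing.\<close>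

lemma gkw_iterate_0: "gkw_iterate n 0 = of_real (identity_range n)"
proof -
  have *: "kernel_iterate n 0 y = of_real (1 + (-1) ^ n * identity_iterate n y)" if "y \<in> {0..1}" for y
    using that
  proof (induction n arbitrary: y)
    case 0 show ?case by (simp add: gkw_kernel_def)
  next
    case (Suc n)
    then have y: "0 \<le> y" by simp
    have "(\<lambda>k. gauss_weight k y + (-1) ^ n * (gauss_weight k y *\<^sub>R identity_iterate n (gauss_branch k y)))
       sums (1 + (-1) ^ n * gauss_op (identity_iterate n) y)"
      using identity_iterate_bound
      by (intro sums_add sums_mult gauss_weight_sums[OF y] gauss_op_sums[OF y, where C=1]) auto
    then have "(\<lambda>k. complex_of_real (gauss_weight k y + (-1) ^ n * (gauss_weight k y *\<^sub>R identity_iterate n (gauss_branch k y))))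
       sums of_real (1 + (-1) ^ n * gauss_op (identity_iterate n) y)"
      by (rule sums_of_real)
    moreover have "complex_of_real (gauss_weight k y + (-1) ^ n * (gauss_weight k y *\<^sub>R identity_iterate n (gauss_branch k y)))
       = gauss_weight k y *\<^sub>R kernel_iterate n 0 (gauss_branch k y)" for k
      unfolding Suc.IH[OF gauss_branch_in[OF y]] by (simp add: scaleR_conv_of_real algebra_simps)
    ultimately have "gauss_op (kernel_iterate n 0) y = of_real (1 + (-1) ^ n * gauss_op (identity_iterate n) y)"
      unfolding gauss_op_def by (simp add: sums_iff)
    then show ?case by (simp add: kernel_iterate_Suc identity_iterate_Suc)
  qed
  show ?thesis
    by (simp add: gkw_iterate_def * identity_range_def right_diff_distrib mult.assoc[symmetric] power_mult_distrib[symmetric])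
qed

lemma gkw_iterate_holomorphic: "gkw_iterate n holomorphic_on ball 1 (8/5)"
  unfolding gkw_iterate_def by (intro holomorphic_intros kernel_iterate_holomorphic) auto

lemma gkw_operator_iterate:
  assumes z: "Re z \<ge> -1/2"
  shows "gkw_operator (gkw_iterate n) z = - gkw_iterate (Suc n) z"
proof -
  define f where "f = (\<lambda>(i::bool) w. kernel_iterate n w (if i then 1 else 0))"
  define c where "c = (\<lambda>i. (-1) ^ n * (if i then 1 else -1) :: complex)"
  have B: "norm (f i w) \<le> 25/2" if "w \<in> cball 1 1" for i w
    using that cball_1_1_subset unfolding f_def by (intro norm_kernel_iterate_le) auto
  have "gkw_iterate n = (\<lambda>w. \<Sum>i\<in>UNIV. c i * f i w)"
    by (auto simp: gkw_iterate_def c_def f_def UNIV_bool algebra_simps)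
  then have "gkw_operator (gkw_iterate n) z = (\<Sum>i\<in>UNIV. c i * gkw_operator (f i) z)"
    using gkw_operator_linear_combination[OF z B, of UNIV] by simp
  also have "\<dots> = - gkw_iterate (Suc n) z"
    by (simp add: f_def gkw_operator_kernel_iterate[OF z] c_def UNIV_bool gkw_iterate_def algebra_simps)
  finally show ?thesis .
qed

text \<open>For \<open>s\<close> and \<open>M\<close> from \<open>approximate_growth_rate\<close>, the average of the iterates of order at most \<open>M\<close> with
  weights proportional to \<open>s ^ -n\<close> is normalised by its value \<open>1\<close> at \<open>0\<close>. Applying the operator shifts the sum by
  one, so that it reproduces the average times \<open>-s\<close> up to the two boundary terms, and these are
  negligible. The averages are uniformly bounded on the disc of radius \<open>8/5\<close>, so a subsequence
  converges, and its limit is an eigenfunction.\<close>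

lemma exists_small_gkw_eigenvalue:
  "\<exists>\<mu>. gkw_eigenvalue \<mu> \<and> cmod \<mu> < 1"
proof -
  obtain \<rho> where \<rho>: "1/81 \<le> \<rho>" "\<rho> \<le> 7/8" and approx:
    "\<And>\<epsilon>. 0 < \<epsilon> \<Longrightarrow> \<exists>s M. 0 < s \<and> \<bar>s - \<rho>\<bar> \<le> \<epsilon> \<and>
        identity_range 0 + identity_range (Suc M) / s ^ Suc M \<le> \<epsilon> * (\<Sum>n\<le>M. identity_range n / s ^ n)"
    by (rule approximate_growth_rate[of identity_range "1/81" "7/8"]) (use identity_range_bounds in auto)
  define \<epsilon> where "\<epsilon> = (\<lambda>j::nat. 1 / (real j + 1))"
  have \<epsilon>: "\<epsilon> j > 0" "\<epsilon> j \<le> 1" for j by (auto simp: \<epsilon>_def)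
  have \<epsilon>_lim: "\<epsilon> \<longlonglongrightarrow> 0" unfolding \<epsilon>_def by real_asymp
  obtain s M where s: "\<And>j. 0 < s j" "\<And>j. \<bar>s j - \<rho>\<bar> \<le> \<epsilon> j"
    and sM: "\<And>j. identity_range 0 + identity_range (Suc (M j)) / s j ^ Suc (M j)
       \<le> \<epsilon> j * (\<Sum>n\<le>M j. identity_range n / s j ^ n)"
    using approx[OF \<epsilon>(1)] by metis
  \<comment> \<open>The normalisation gives the averages F the value 1 at the point 0.\<close>
  define A where "A = (\<lambda>j. \<Sum>n\<le>M j. identity_range n / s j ^ n)"
  define F where "F = (\<lambda>j z. \<Sum>n\<le>M j. of_real (1 / (s j ^ n * A j)) * gkw_iterate n z)"
  have A: "A j > 0" for j unfolding A_def using s identity_range_bounds(3) by (intro sum_pos) auto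
  let ?S = "ball (1::complex) (8/5)"
  have F_hol: "F j holomorphic_on ?S" for j
    unfolding F_def by (intro holomorphic_intros gkw_iterate_holomorphic)
  have F_bound: "norm (F j z) \<le> 1400" if "z \<in> ?S" for j z
  proof -
    have "norm (F j z) \<le> (\<Sum>n\<le>M j. 1400 * identity_range n / (s j ^ n * A j))"
      unfolding F_def
    proof (rule sum_norm_le)
      fix n
      have "1 / (s j ^ n * A j) * norm (gkw_iterate n z) \<le> 1 / (s j ^ n * A j) * (1400 * identity_range n)"
        using norm_gkw_iterate_le[OF that, of n] s[of j] A[of j] by (intro mult_left_mono) auto
      then show "norm (of_real (1 / (s j ^ n * A j)) * gkw_iterate n z) \<le> 1400 * identity_range n / (s j ^ n * A j)"
        using s[of j] A[of j] by (simp add: norm_mult norm_divide norm_power)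
    qed
    also have "\<dots> = 1400 * A j / A j"
      unfolding A_def by (simp add: sum_distrib_left sum_divide_distrib)
    finally show ?thesis using A[of j] by simp
  qed
  have F_0: "F j 0 = 1" for j
  proof -
    have "F j 0 = of_real (\<Sum>n\<le>M j. identity_range n / s j ^ n / A j)"
      unfolding F_def gkw_iterate_0 by simp
    also have "(\<Sum>n\<le>M j. identity_range n / s j ^ n / A j) = A j / A j"
      by (simp only: sum_divide_distrib[symmetric] A_def)
    finally show ?thesis using A[of j] by simp
  qed
  have F_approx: "norm (gkw_operator (F j) z + of_real (s j) * F j z) \<le> 1400 * 2 * \<epsilon> j"
    if z: "z \<in> cball 1 (3/2)" for j z
  proof -
    have "\<bar>Re (1 - z)\<bar> \<le> norm (1 - z)" by (rule abs_Re_le_cmod)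
    then have Re: "Re z \<ge> -1/2" using z by (simp add: dist_norm abs_le_iff)
    have zS: "z \<in> ?S" using z by auto
    have "norm (gkw_iterate n w) \<le> 1400" if "w \<in> cball 1 1" for n w
    proof -
      have "identity_range n \<le> 1"
      proof (induction n)
        case (Suc n) then show ?case using identity_range_bounds(1,3)[of n] by linarith
      qed (simp add: identity_range_def)
      then show ?thesis using norm_gkw_iterate_le[of w n] that cball_1_1_subset by force
    qed
    then have "gkw_operator (F j) z = (\<Sum>n\<le>M j. of_real (1 / (s j ^ n * A j)) * (- gkw_iterate (Suc n) z))"
      unfolding F_def by (subst gkw_operator_linear_combination[OF Re]) (auto simp: gkw_operator_iterate[OF Re])
    also have "\<dots> = - (of_real (s j) * (\<Sum>n\<le>M j. of_real (1 / (s j ^ Suc n * A j)) * gkw_iterate (Suc n) z))"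
      using s(1)[of j] by (simp add: sum_distrib_left sum_negf[symmetric])
    also have "(\<Sum>n\<le>M j. of_real (1 / (s j ^ Suc n * A j)) * gkw_iterate (Suc n) z) =
      F j z - of_real (1 / A j) * gkw_iterate 0 z + of_real (1 / (s j ^ Suc (M j) * A j)) * gkw_iterate (Suc (M j)) z"
      unfolding F_def using sum.atMost_Suc_shift[of "\<lambda>n. of_real (1 / (s j ^ n * A j)) * gkw_iterate n z" "M j"]
      by (simp add: algebra_simps)
    finally have "gkw_operator (F j) z + of_real (s j) * F j z = of_real (s j) *
       (of_real (1 / A j) * gkw_iterate 0 z - of_real (1 / (s j ^ Suc (M j) * A j)) * gkw_iterate (Suc (M j)) z)"
      by (simp add: algebra_simps)
    also have "norm \<dots> \<le> s j * (1 / A j * (1400 * identity_range 0) +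
        1 / (s j ^ Suc (M j) * A j) * (1400 * identity_range (Suc (M j))))"
    proof -
      have "norm (of_real (1 / A j) * gkw_iterate 0 z) \<le> 1 / A j * (1400 * identity_range 0)"
        unfolding norm_mult norm_of_real using A[of j] by (intro mult_mono norm_gkw_iterate_le[OF zS]) auto
      moreover have "norm (of_real (1 / (s j ^ Suc (M j) * A j)) * gkw_iterate (Suc (M j)) z)
          \<le> 1 / (s j ^ Suc (M j) * A j) * (1400 * identity_range (Suc (M j)))"
        unfolding norm_mult norm_of_real using A[of j] s(1)[of j]
        by (intro mult_mono norm_gkw_iterate_le[OF zS]) auto
      ultimately show ?thesis
        unfolding norm_mult[of "of_real (s j)"] norm_of_real using s(1)[of j]
          norm_triangle_ineq4[of "of_real (1 / A j) * gkw_iterate 0 z" "of_real (1 / (s j ^ Suc (M j) * A j)) * gkw_iterate (Suc (M j)) z"]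
        by (intro mult_mono) auto
    qed
    also have "\<dots> = s j * (1400 * (identity_range 0 + identity_range (Suc (M j)) / s j ^ Suc (M j)) / A j)"
      using A[of j] by (simp add: field_simps)
    also have "\<dots> \<le> 2 * (1400 * (\<epsilon> j * A j) / A j)"
    proof (intro mult_mono divide_right_mono)
      show "s j \<le> 2" using s(2)[of j] \<epsilon>[of j] \<rho> by (simp add: abs_le_iff)
      show "identity_range 0 + identity_range (Suc (M j)) / s j ^ Suc (M j) \<le> \<epsilon> j * A j"
        using sM[of j] unfolding A_def .
      have "0 \<le> identity_range 0 + identity_range (Suc (M j)) / s j ^ Suc (M j)"
        using s(1)[of j] identity_range_bounds(3) by (intro add_nonneg_nonneg divide_nonneg_nonneg) (auto intro: less_imp_le)
      then show "0 \<le> 1400 * (identity_range 0 + identity_range (Suc (M j)) / s j ^ Suc (M j)) / A j"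
        "0 \<le> identity_range 0 + identity_range (Suc (M j)) / s j ^ Suc (M j)"
        using A[of j] by simp_all
    qed (use A[of j] in auto)
    also have "\<dots> = 1400 * 2 * \<epsilon> j" using A[of j] by simp
    finally show ?thesis .
  qed
  obtain g r where g: "g holomorphic_on ?S" and r: "strict_mono (r :: nat \<Rightarrow> nat)"
    and lim: "\<And>x. x \<in> ?S \<Longrightarrow> (\<lambda>j. F (r j) x) \<longlonglongrightarrow> g x"
    and ulim: "\<And>K. compact K \<Longrightarrow> K \<subseteq> ?S \<Longrightarrow> uniform_limit K (F \<circ> r) g sequentially"
    by (rule Montel[of ?S "range F" F]) (use F_hol F_bound in blast)+
  have g_bound: "norm (g z) \<le> 1400" if "z \<in> ?S" for z
    by (rule LIMSEQ_le_const2[OF tendsto_norm[OF lim[OF that]]]) (use F_bound[OF that] in auto)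
  have "g 0 = 1" using LIMSEQ_unique[OF lim[of 0]] F_0 by (simp add: dist_norm)
  have eigen: "gkw_operator g z = of_real (- \<rho>) * g z" if z: "z \<in> cball 1 (3/2)" for z
  proof -
    have "\<bar>Re (1 - z)\<bar> \<le> norm (1 - z)" by (rule abs_Re_le_cmod)
    then have Re: "Re z \<ge> -1/2" using z by (simp add: dist_norm abs_le_iff)
    have zS: "z \<in> ?S" using z by auto
    have "(\<lambda>j. gkw_operator (F (r j)) z) \<longlonglongrightarrow> gkw_operator g z"
    proof (rule metric_LIMSEQ_I)
      fix e :: real assume e: "0 < e"
      have "gkw_bound \<ge> 0" unfolding gkw_bound_def by (intro suminf_nonneg gkw_bound_summable) auto
      define e' where "e' = e / (2 * (gkw_bound + 1))"
      have e': "0 < e'" "gkw_bound * e' < e" 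
        using e \<open>gkw_bound \<ge> 0\<close> mult_nonneg_nonneg[of gkw_bound e]
        by (auto simp: e'_def field_simps intro: add_nonneg_pos)
      have "\<forall>\<^sub>F j in sequentially. \<forall>w\<in>cball 1 1. dist ((F \<circ> r) j w) (g w) < e'"
        using uniform_limitD[OF ulim[OF compact_cball cball_1_1_subset] e'(1)] .
      then obtain J where J: "\<And>j w. j \<ge> J \<Longrightarrow> w \<in> cball 1 1 \<Longrightarrow> dist (F (r j) w) (g w) < e'"
        unfolding eventually_sequentially comp_def by blast
      have "dist (gkw_operator (F (r j)) z) (gkw_operator g z) < e" if "j \<ge> J" for j
      proof -
        have "norm (gkw_operator (F (r j)) z - gkw_operator g z) \<le> gkw_bound * e'"
          by (rule gkw_operator_diff_le[OF Re F_bound g_bound])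
            (use J[OF that] cball_1_1_subset in \<open>auto simp: dist_norm intro: less_imp_le\<close>)
        then show ?thesis using e'(2) by (simp add: dist_norm)
      qed
      then show "\<exists>J. \<forall>j\<ge>J. dist (gkw_operator (F (r j)) z) (gkw_operator g z) < e" by blast
    qed
    moreover have "(\<lambda>j. s (r j)) \<longlonglongrightarrow> \<rho>"
    proof (rule Lim_transform2)
      show "(\<lambda>j. \<rho>) \<longlonglongrightarrow> \<rho>" by simp
      have "s \<longlonglongrightarrow> \<rho>"
        by (rule LIM_zero_cancel, rule Lim_null_comparison[OF _ \<epsilon>_lim]) (use s(2) in auto)
      then have "(\<lambda>j. s (r j)) \<longlonglongrightarrow> \<rho>" using LIMSEQ_subseq_LIMSEQ[OF _ r] by (auto simp: o_def)
      then show "(\<lambda>j. \<rho> - s (r j)) \<longlonglongrightarrow> 0" using tendsto_diff[OF tendsto_const, of _ \<rho> _ \<rho>] by fastforce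
    qed
    ultimately have "(\<lambda>j. gkw_operator (F (r j)) z + of_real (s (r j)) * F (r j) z)
        \<longlonglongrightarrow> gkw_operator g z + of_real \<rho> * g z"
      using lim[OF zS] by (intro tendsto_intros)
    moreover have "(\<lambda>j. gkw_operator (F (r j)) z + of_real (s (r j)) * F (r j) z) \<longlonglongrightarrow> 0"
    proof (rule Lim_null_comparison)
      show "\<forall>\<^sub>F j in sequentially. norm (gkw_operator (F (r j)) z + of_real (s (r j)) * F (r j) z) \<le> 1400 * 2 * \<epsilon> (r j)"
        using F_approx[OF z] by simp
      have "(\<lambda>j. \<epsilon> (r j)) \<longlonglongrightarrow> 0" using LIMSEQ_subseq_LIMSEQ[OF \<epsilon>_lim r] by (simp add: o_def)
      then show "(\<lambda>j. 1400 * 2 * \<epsilon> (r j)) \<longlonglongrightarrow> 0" using tendsto_mult_right_zero by blast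
    qed
    ultimately have "gkw_operator g z + of_real \<rho> * g z = 0" by (rule LIMSEQ_unique)
    then show ?thesis by (simp add: add_eq_0_iff2)
  qed
  have sub: "cball 1 (3/2) \<subseteq> ?S" by auto
  have "gkw_eigenvalue (of_real (- \<rho>))"
    unfolding gkw_eigenvalue_def
  proof (intro exI[of _ g] conjI)
    show "g holomorphic_on ball 1 (3/2)" using g by (rule holomorphic_on_subset) auto
    show "continuous_on (cball 1 (3/2)) g"
      using g sub by (meson continuous_on_subset holomorphic_on_imp_continuous_on)
    show "\<exists>z\<in>cball 1 (3/2). g z \<noteq> 0" using \<open>g 0 = 1\<close> by (intro bexI[of _ 0]) (auto simp: dist_norm)
  qed (use eigen in blast)
  moreover have "cmod (of_real (- \<rho>)) < 1" using \<rho> by simp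
  ultimately show ?thesis by blast
qed

lemma gkw_constant_le_1: "gkw_constant \<le> 1"
  unfolding gkw_constant_def
  by (rule cSup_least) (use exists_small_gkw_eigenvalue in \<open>auto intro: less_imp_le\<close>)

section \<open>Continued fraction digits and the Gauss map\<close>

definition gauss_map :: "real \<Rightarrow> real" where
  "gauss_map x = frac (1 / x)"

lemma irr_interval_bounds:
  assumes "x \<in> irr_interval" shows "0 < x" "x < 1" "x \<notin> \<rat>"
  using assms by (auto simp: irr_interval_def less_le)

lemma gauss_map_decomposition:
  assumes "x \<in> irr_interval"
  shows "gauss_map x \<in> irr_interval" "1 \<le> nat \<lfloor>1 / x\<rfloor>" "1 / x = real (nat \<lfloor>1 / x\<rfloor>) + gauss_map x"
    "x = 1 / (real (nat \<lfloor>1 / x\<rfloor>) + gauss_map x)"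
proof -
  note x = irr_interval_bounds[OF assms]
  have "1 / x \<notin> \<rat>"
  proof
    assume "1 / x \<in> \<rat>"
    from Rats_divide[OF Rats_1 this] have "1 / (1 / x) \<in> \<rat>" .
    then show False using x by simp
  qed
  have "frac (1 / x) \<notin> \<rat>"
  proof
    assume "frac (1 / x) \<in> \<rat>"
    then have "frac (1 / x) + of_int \<lfloor>1 / x\<rfloor> \<in> \<rat>" by (intro Rats_add) auto
    then show False using \<open>1 / x \<notin> \<rat>\<close> by (simp add: frac_def)
  qed
  then show "gauss_map x \<in> irr_interval"
    using frac_lt_1[of "1/x"] by (auto simp: irr_interval_def gauss_map_def less_imp_le)
  have fl: "1 \<le> \<lfloor>1 / x\<rfloor>" using x by (simp add: le_floor_iff)
  then show "1 \<le> nat \<lfloor>1 / x\<rfloor>" using nat_mono[OF fl] by simp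
  from fl have "real (nat \<lfloor>1 / x\<rfloor>) = of_int \<lfloor>1 / x\<rfloor>" by (intro of_nat_nat) linarith
  then show e: "1 / x = real (nat \<lfloor>1 / x\<rfloor>) + gauss_map x" by (simp add: gauss_map_def frac_def)
  show "x = 1 / (real (nat \<lfloor>1 / x\<rfloor>) + gauss_map x)" unfolding e[symmetric] by simp
qed

lemma cf_value_bounds: "(\<And>a. a \<in> set as \<Longrightarrow> 0 < a) \<Longrightarrow> cf_value as \<in> {0..1}"
proof (induction as)
  case (Cons a as)
  then have "1 \<le> real a + cf_value as" by (fastforce simp: Suc_le_eq)
  then show ?case by (simp add: divide_le_eq_1)
qed simp

text \<open>The digits after the first, renumbered from \<open>1\<close> and with the conventional integer part \<open>0\<close> in front.\<close>

definition tail_digits :: "(nat \<Rightarrow> nat) \<Rightarrow> nat \<Rightarrow> nat" where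
  "tail_digits a j = (if j = 0 then 0 else a (Suc j))"

lemma cf_value_convergent_Suc:
  "cf_value (map a [1..<Suc (Suc n)]) = 1 / (real (a 1) + cf_value (map (tail_digits a) [1..<Suc n]))"
proof -
  have "map a [1..<Suc (Suc n)] = a 1 # map a [Suc 1..<Suc (Suc n)]"
    by (simp add: upt_conv_Cons del: upt_Suc)
  also have "map a [Suc 1..<Suc (Suc n)] = map a (map Suc [1..<Suc n])" by (simp only: map_Suc_upt)
  also have "\<dots> = map (tail_digits a) [1..<Suc n]" by (auto simp: tail_digits_def)
  finally show ?thesis by simp
qed

text \<open>The convergents of the tail are continuous functions of those of the whole expansion, so they converge as
  well. Their limit \<open>1/x - a\<^sub>1\<close> lies in \<open>[0,1]\<close>, and it is not \<open>1\<close> since \<open>x\<close> is irrational; hence it is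
  the fractional part.\<close>

lemma cf_expansion_step:
  assumes a: "is_cf_expansion a x" and x: "x \<in> irr_interval"
  shows "a 1 = nat \<lfloor>1 / x\<rfloor>" "is_cf_expansion (tail_digits a) (gauss_map x)"
proof -
  note x0 = irr_interval_bounds[OF x]
  have pos: "0 < a j" if "j \<ge> 1" for j using a that by (auto simp: is_cf_expansion_def)
  define v where "v = (\<lambda>n. cf_value (map (tail_digits a) [1..<Suc n]))"
  have v01: "v n \<in> {0..1}" for n
    unfolding v_def using pos by (intro cf_value_bounds) (auto simp: tail_digits_def simp del: upt_Suc)
  have "(\<lambda>n. cf_value (map a [1..<Suc n])) \<longlonglongrightarrow> x" using a by (simp add: is_cf_expansion_def)
  then have "(\<lambda>n. cf_value (map a [1..<Suc (Suc n)])) \<longlonglongrightarrow> x" by (rule LIMSEQ_Suc)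
  then have "(\<lambda>n. 1 / (real (a 1) + v n)) \<longlonglongrightarrow> x" unfolding cf_value_convergent_Suc v_def .
  then have "(\<lambda>n. 1 / (1 / (real (a 1) + v n)) - real (a 1)) \<longlonglongrightarrow> 1 / x - real (a 1)"
    using x0(1) by (intro tendsto_diff tendsto_divide tendsto_const) simp_all
  moreover have "1 / (1 / (real (a 1) + v n)) - real (a 1) = v n" for n by simp
  ultimately have lim: "v \<longlonglongrightarrow> 1 / x - real (a 1)" by simp
  have "0 \<le> 1 / x - real (a 1)" by (rule LIMSEQ_le_const[OF lim]) (use v01 in auto)
  moreover have "1 / x - real (a 1) \<le> 1" by (rule LIMSEQ_le_const2[OF lim]) (use v01 in auto)
  moreover have "1 / x - real (a 1) \<noteq> 1"
  proof
    assume "1 / x - real (a 1) = 1"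
    then have "x = 1 / (1 + real (a 1))" using x0 by (simp add: field_simps)
    then have "x \<in> \<rat>" by simp
    then show False using x0 by simp
  qed
  ultimately have y: "0 \<le> 1 / x - real (a 1)" "1 / x - real (a 1) < 1" by auto
  then have fl: "\<lfloor>1 / x\<rfloor> = int (a 1)" by (intro floor_unique) auto
  then show "a 1 = nat \<lfloor>1 / x\<rfloor>" by simp
  have "gauss_map x = 1 / x - real (a 1)" by (simp add: gauss_map_def frac_def fl)
  then show "is_cf_expansion (tail_digits a) (gauss_map x)"
    using lim pos unfolding is_cf_expansion_def v_def by (auto simp: tail_digits_def)
qed

fun gauss_digit :: "nat \<Rightarrow> real \<Rightarrow> nat" where
  "gauss_digit 0 x = 0"
| "gauss_digit (Suc 0) x = nat \<lfloor>1 / x\<rfloor>"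
| "gauss_digit (Suc (Suc n)) x = gauss_digit (Suc n) (gauss_map x)"

lemma cf_expansion_unique:
  assumes "is_cf_expansion a x" "x \<in> irr_interval"
  shows "a j = gauss_digit j x"
  using assms
proof (induction j x arbitrary: a rule: gauss_digit.induct)
  case (1 x) then show ?case by (simp add: is_cf_expansion_def)
next
  case (2 x) then show ?case using cf_expansion_step(1) by simp
next
  case (3 n x)
  have "tail_digits a (Suc n) = gauss_digit (Suc n) (gauss_map x)"
    using 3 cf_expansion_step(2) gauss_map_decomposition(1) by blast
  then show ?case by (simp add: tail_digits_def)
qed

lemma gauss_digit_pos:
  assumes "x \<in> irr_interval" "j \<ge> 1" shows "0 < gauss_digit j x"
  using assms
proof (induction j x rule: gauss_digit.induct)
  case (2 x)
  then have "1 \<le> nat \<lfloor>1 / x\<rfloor>" by (intro gauss_map_decomposition(2))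
  then show ?case by (simp only: gauss_digit.simps)
next
  case (3 n x) then show ?case using gauss_map_decomposition(1)[of x] by simp
qed simp

text \<open>One step of the Gauss map multiplies the error by at most \<open>x\<close>, two steps by at most
  \<open>x \<cdot> gauss_map x \<le> 1/2\<close>, and \<open>1/2 \<le> (3/4)\<^sup>2\<close>.\<close>

lemma gauss_digit_convergents:
  assumes "x \<in> irr_interval"
  shows "\<bar>cf_value (map (\<lambda>j. gauss_digit j x) [1..<Suc n]) - x\<bar> \<le> 2 * (3/4) ^ n"
  using assms
proof (induction n arbitrary: x rule: less_induct)
  case (less n)
  define v where "v = (\<lambda>n x. cf_value (map (\<lambda>j. gauss_digit j x) [1..<Suc n]))"
  have v01: "v n x \<in> {0..1}" if "x \<in> irr_interval" for n x
    unfolding v_def using gauss_digit_pos[OF that] by (intro cf_value_bounds) (auto simp del: upt_Suc)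
  have tail: "tail_digits (\<lambda>j. gauss_digit j x) = (\<lambda>j. gauss_digit j (gauss_map x))" for x
  proof
    show "tail_digits (\<lambda>j. gauss_digit j x) j = gauss_digit j (gauss_map x)" for j
      by (cases j) (auto simp: tail_digits_def)
  qed
  have step: "\<bar>v (Suc n) x - x\<bar> \<le> x * \<bar>v n (gauss_map x) - gauss_map x\<bar>"
    if x: "x \<in> irr_interval" for n x
  proof -
    define a where "a = real (nat \<lfloor>1 / x\<rfloor>)"
    define t where "t = gauss_map x"
    define u where "u = v n t"
    have a: "a \<ge> 1" unfolding a_def using gauss_map_decomposition(2)[OF x] by (simp only: real_of_nat_ge_one_iff)
    have t: "t \<ge> 0" "t \<in> irr_interval"
      using gauss_map_decomposition(1)[OF x] irr_interval_bounds(1)[of t] by (auto simp: t_def)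
    have u: "u \<ge> 0" using v01[OF t(2), of n] by (simp add: u_def)
    have xe: "x = 1 / (a + t)" using gauss_map_decomposition(4)[OF x] by (simp add: a_def t_def)
    have "v (Suc n) x = 1 / (a + u)"
      unfolding v_def cf_value_convergent_Suc tail by (simp add: a_def u_def v_def t_def)
    then have "v (Suc n) x - x = 1 / (a + u) - 1 / (a + t)" using xe by simp
    also have "\<dots> = (1 / (a + t)) * (1 / (a + u)) * (t - u)" using a t u by (simp add: field_simps)
    finally have "\<bar>v (Suc n) x - x\<bar> = x * (1 / (a + u)) * \<bar>u - t\<bar>"
      unfolding xe[symmetric] using irr_interval_bounds(1)[OF x] a u by (simp add: abs_mult abs_minus_commute)
    also have "\<dots> \<le> x * 1 * \<bar>u - t\<bar>"
      using irr_interval_bounds(1)[OF x] a u by (intro mult_right_mono mult_left_mono) auto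
    finally show ?thesis by (simp add: u_def t_def)
  qed
  consider "n = 0" | "n = 1" | m where "n = Suc (Suc m)" by (metis One_nat_def not0_implies_Suc)
  then have "\<bar>v n x - x\<bar> \<le> 2 * (3/4) ^ n"
  proof cases
    case 1
    then show ?thesis using irr_interval_bounds[OF less.prems] by (simp add: v_def)
  next
    case 2
    then show ?thesis using irr_interval_bounds[OF less.prems] v01[OF less.prems, of 1] by (auto simp: abs_if)
  next
    case (3 m)
    let ?t = "gauss_map x"
    have t: "?t \<in> irr_interval" using gauss_map_decomposition(1)[OF less.prems] .
    have tt: "gauss_map ?t \<in> irr_interval" using gauss_map_decomposition(1)[OF t] .
    note x0 = irr_interval_bounds[OF less.prems] and t0 = irr_interval_bounds[OF t]
    define a where "a = real (nat \<lfloor>1 / x\<rfloor>)"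
    have a: "a \<ge> 1" unfolding a_def using gauss_map_decomposition(2)[OF less.prems] by (simp only: real_of_nat_ge_one_iff)
    have "x * ?t = 1 / (a + ?t) * ?t"
      using gauss_map_decomposition(4)[OF less.prems] unfolding a_def by (rule arg_cong)
    then have "x * ?t = ?t / (a + ?t)" by simp
    also have "\<dots> \<le> 1 / 2" using a t0 by (simp add: field_simps)
    finally have xt: "x * ?t \<le> 1 / 2" .
    have "\<bar>v n x - x\<bar> \<le> x * \<bar>v (Suc m) ?t - ?t\<bar>" unfolding 3 by (rule step[OF less.prems])
    also have "\<dots> \<le> x * (?t * \<bar>v m (gauss_map ?t) - gauss_map ?t\<bar>)"
      using step[OF t, of m] x0 by (intro mult_left_mono) auto
    also have "\<dots> = (x * ?t) * \<bar>v m (gauss_map ?t) - gauss_map ?t\<bar>" by simp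
    also have "\<dots> \<le> (1 / 2) * (2 * (3/4) ^ m)"
      using xt less.IH[OF _ tt, of m] 3 x0 t0 unfolding v_def by (intro mult_mono) auto
    also have "\<dots> \<le> 2 * (3/4) ^ n" unfolding 3 by simp
    finally show ?thesis .
  qed
  then show ?case by (simp add: v_def del: upt_Suc)
qed

lemma cf_digit_eq:
  assumes "x \<in> irr_interval"
  shows "cf_digit x j = gauss_digit j x"
proof -
  have "(\<lambda>n. cf_value (map (\<lambda>j. gauss_digit j x) [1..<Suc n])) \<longlonglongrightarrow> x"
  proof (rule LIM_zero_cancel, rule Lim_null_comparison)
    show "\<forall>\<^sub>F n in sequentially. norm (cf_value (map (\<lambda>j. gauss_digit j x) [1..<Suc n]) - x) \<le> 2 * (3/4) ^ n"
      using gauss_digit_convergents[OF assms] by (simp del: upt_Suc)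
    show "(\<lambda>n. 2 * (3/4) ^ n :: real) \<longlonglongrightarrow> 0" by real_asymp
  qed
  then have exp: "is_cf_expansion (\<lambda>j. gauss_digit j x) x"
    using gauss_digit_pos[OF assms] unfolding is_cf_expansion_def by simp
  have "cf_digit x = (\<lambda>j. gauss_digit j x)"
    unfolding cf_digit_def by (rule the_equality, rule exp, rule ext, rule cf_expansion_unique[OF _ assms])
  then show ?thesis by simp
qed

lemma digit_prod_Suc:
  assumes "x \<in> irr_interval"
  shows "digit_prod (Suc n) x = nat \<lfloor>1 / x\<rfloor> * digit_prod n (gauss_map x)"
proof -
  have "digit_prod (Suc n) x = cf_digit x 1 * (\<Prod>j=Suc 1..Suc n. cf_digit x j)"
    unfolding digit_prod_def by (subst prod.atLeast_Suc_atMost) auto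
  also have "(\<Prod>j=Suc 1..Suc n. cf_digit x j) = (\<Prod>j=1..n. cf_digit x (Suc j))"
    by (rule prod.shift_bounds_cl_Suc_ivl)
  also have "\<dots> = digit_prod n (gauss_map x)"
    unfolding digit_prod_def
  proof (rule prod.cong)
    fix j assume "j \<in> {1..n}"
    then show "cf_digit x (Suc j) = cf_digit (gauss_map x) j"
      using assms gauss_map_decomposition(1)[OF assms] by (cases j) (auto simp: cf_digit_eq)
  qed simp
  finally show ?thesis using assms by (simp add: cf_digit_eq)
qed

section \<open>Integration against the Gauss measure\<close>

lemma irr_interval_borel [measurable]: "irr_interval \<in> sets borel"
proof -
  have "\<rat> \<in> sets (borel :: real measure)" by (rule sets.countable[OF _ countable_rat]) simp
  then show ?thesis unfolding irr_interval_def by (rule sets.Diff[rotated]) simp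
qed

lemma sets_gauss_measure: "sets gauss_measure = sets (restrict_space borel irr_interval)"
  and space_gauss_measure [simp]: "space gauss_measure = irr_interval"
  by (auto simp: gauss_measure_def sets_restrict_space space_restrict_space)

lemma measurable_gauss_measureI:
  "f \<in> borel_measurable borel \<Longrightarrow> f \<in> borel_measurable gauss_measure"
  by (simp add: measurable_restrict_space1 cong: measurable_cong_sets[OF sets_gauss_measure refl])

lemma nn_integral_gauss_measure:
  assumes [measurable]: "g \<in> borel_measurable borel"
  shows "(\<integral>\<^sup>+x. g x \<partial>gauss_measure) =
    (\<integral>\<^sup>+x. ennreal (1 / ((1 + x) * ln 2)) * g x * indicator irr_interval x \<partial>lborel)"
  unfolding gauss_measure_def
  by (subst nn_integral_density)
    (auto simp: nn_integral_restrict_space intro!: measurable_restrict_space1)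

lemma AE_lborel_irr_interval: "AE x in lborel. x \<in> irr_interval \<longleftrightarrow> x \<in> {0..1}"
proof -
  have "\<rat> \<in> null_sets (lborel :: real measure)" by (rule countable_imp_null_set_lborel[OF countable_rat])
  then have "AE x::real in lborel. x \<notin> \<rat>" by (rule AE_not_in)
  then show ?thesis by eventually_elim (auto simp: irr_interval_def)
qed

lemma emeasure_gauss_measure_space: "emeasure gauss_measure irr_interval = 1"
proof -
  have "emeasure gauss_measure irr_interval = (\<integral>\<^sup>+x. 1 \<partial>gauss_measure)" by simp
  also have "\<dots> = (\<integral>\<^sup>+x. ennreal (1 / ((1 + x) * ln 2)) * indicator {0..1} x \<partial>lborel)"
  proof (subst nn_integral_gauss_measure)
    show "(\<integral>\<^sup>+x. ennreal (1 / ((1 + x) * ln 2)) * 1 * indicator irr_interval x \<partial>lborel) =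
        (\<integral>\<^sup>+x. ennreal (1 / ((1 + x) * ln 2)) * indicator {0..1} x \<partial>lborel)"
      using AE_lborel_irr_interval by (intro nn_integral_cong_AE) (auto simp: indicator_def)
  qed simp
  also have "\<dots> = ennreal (ln (1 + 1) / ln 2 - ln (1 + 0) / ln 2)"
  proof (rule nn_integral_FTC_Icc[where F="\<lambda>x. ln (1 + x) / ln 2"])
    fix x :: real assume x: "x \<in> {0..1}"
    then have "((\<lambda>x. ln (1 + x)) has_real_derivative 1 / (1 + x)) (at x)"
      by (auto intro!: derivative_eq_intros)
    from DERIV_cdivide[OF this, of "ln 2"]
    show "((\<lambda>x. ln (1 + x) / ln 2) has_real_derivative 1 / ((1 + x) * ln 2)) (at x)" by simp
    show "0 \<le> 1 / ((1 + x) * ln 2)" using x by simp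
  qed auto
  finally show ?thesis by simp
qed

lemma gauss_branch_irr_iff:
  assumes "x \<in> {0..1}" shows "gauss_branch k x \<in> irr_interval \<longleftrightarrow> x \<in> irr_interval"
proof -
  have b: "gauss_branch k x \<in> {0..1}" using assms by (intro gauss_branch_in) auto
  have "gauss_branch k x \<in> \<rat> \<longleftrightarrow> x \<in> \<rat>"
  proof
    assume "gauss_branch k x \<in> \<rat>"
    then have "1 / gauss_branch k x - real (k + 1) \<in> \<rat>" by (intro Rats_diff Rats_divide) auto
    then show "x \<in> \<rat>" by (simp add: gauss_branch_def)
  qed (auto simp: gauss_branch_def intro!: Rats_divide Rats_add)
  then show ?thesis using b assms by (auto simp: irr_interval_def)
qed

lemma gauss_branch_inverse:
  assumes "x \<in> irr_interval"
  shows "nat \<lfloor>1 / gauss_branch k x\<rfloor> = Suc k" "gauss_map (gauss_branch k x) = x"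
proof -
  note x = irr_interval_bounds[OF assms]
  have e: "1 / gauss_branch k x = x + real (Suc k)" by (simp add: gauss_branch_def)
  have f: "\<lfloor>x + real (Suc k)\<rfloor> = int (Suc k)" using x by (intro floor_unique) auto
  show "nat \<lfloor>1 / gauss_branch k x\<rfloor> = Suc k" unfolding e f by simp
  show "gauss_map (gauss_branch k x) = x" unfolding gauss_map_def e frac_def f by simp
qed

lemma gauss_weight_measurable [measurable]: "gauss_weight k \<in> borel_measurable borel"
  and gauss_branch_measurable [measurable]: "gauss_branch k \<in> borel_measurable borel"
  and gauss_map_measurable [measurable]: "gauss_map \<in> borel_measurable borel"
  unfolding gauss_weight_def[abs_def] gauss_branch_def[abs_def] gauss_map_def[abs_def] frac_def
  by measurable

text \<open>On the points with first digit \<open>k + 1\<close> one substitutes \<open>\<omega> = 1 / (x + k + 1)\<close>, and the density turns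
  into the density at \<open>x\<close> times the weight of the branch.\<close>

lemma nn_integral_gauss_transfer:
  assumes [measurable]: "g \<in> borel_measurable borel"
  shows "(\<integral>\<^sup>+x. g x \<partial>gauss_measure) =
    (\<integral>\<^sup>+x. (\<Sum>k. ennreal (gauss_weight k x) * g (gauss_branch k x)) \<partial>gauss_measure)"
proof -
  define W where "W = (\<lambda>x. ennreal (1 / ((1 + x) * ln 2)) * g x * indicator irr_interval x)"
  have W[measurable]: "W \<in> borel_measurable borel" unfolding W_def by measurable
  define A where "A = (\<lambda>k::nat. {1 / (real k + 2)<..1 / (real k + 1)})"
  have branch: "(\<integral>\<^sup>+x. W x * indicator (A k) x \<partial>lborel) =
     (\<integral>\<^sup>+x. ennreal (1 / ((1 + x) * ln 2)) * (ennreal (gauss_weight k x) * g (gauss_branch k x)) *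
       indicator irr_interval x \<partial>lborel)" for k
  proof -
    \<comment> \<open>The substitution rule is for increasing maps, so the branch is composed with the
      reflection of the unit interval, which is undone afterwards.\<close>
    define h where "h = (\<lambda>t. 1 / (real k + 2 - t))"
    have h01: "h 0 = 1 / (real k + 2)" "h 1 = 1 / (real k + 1)" by (simp_all add: h_def add.commute)
    have "(\<integral>\<^sup>+x. W x * indicator (A k) x \<partial>lborel) = (\<integral>\<^sup>+x. W x * indicator {h 0..h 1} x \<partial>lborel)"
    proof (rule nn_integral_cong)
      fix x
      show "W x * indicator (A k) x = W x * indicator {h 0..h 1} x"
      proof (cases "x = h 0")
        case True
        then have "x \<in> \<rat>" by (auto simp: h_def intro!: Rats_divide Rats_add)
        then show ?thesis by (simp add: W_def irr_interval_def)
      qed (auto simp: A_def h01 indicator_def)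
    qed
    also have "\<dots> = (\<integral>\<^sup>+t. W (h t) * ennreal (1 / (real k + 2 - t)\<^sup>2) * indicator {0..1} t \<partial>lborel)"
    proof (rule nn_integral_substitution_aux)
      show "(h has_real_derivative 1 / (real k + 2 - t)\<^sup>2) (at t)" if "t \<in> {0..1}" for t
        unfolding h_def using that by (auto intro!: derivative_eq_intros simp: power2_eq_square)
      show "continuous_on {0..1} (\<lambda>t. 1 / (real k + 2 - t)\<^sup>2)"
        by (intro continuous_intros) auto
    qed auto
    also have "\<dots> = (\<integral>\<^sup>+t. W (h (1 + -1 * t)) * ennreal (1 / (real k + 2 - (1 + -1 * t))\<^sup>2) * indicator {0..1} (1 + -1 * t) \<partial>lborel)"
      by (subst nn_integral_real_affine[where c="-1" and t=1]) (auto simp: h_def)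
    also have "\<dots> = (\<integral>\<^sup>+x. ennreal (1 / ((1 + x) * ln 2)) * (ennreal (gauss_weight k x) * g (gauss_branch k x)) *
       indicator irr_interval x \<partial>lborel)"
    proof (rule nn_integral_cong)
      fix t :: real
      show "W (h (1 + -1 * t)) * ennreal (1 / (real k + 2 - (1 + -1 * t))\<^sup>2) * indicator {0..1} (1 + -1 * t) =
        ennreal (1 / ((1 + t) * ln 2)) * (ennreal (gauss_weight k t) * g (gauss_branch k t)) * indicator irr_interval t"
      proof (cases "t \<in> {0..1}")
        case False
        then show ?thesis by (auto simp: irr_interval_def)
      next
        case True
        have ht: "h (1 + -1 * t) = gauss_branch k t" by (simp add: h_def gauss_branch_def algebra_simps)
        have e: "real k + 2 - (1 + -1 * t) = t + real k + 1" by simp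
        have "1 / ((1 + gauss_branch k t) * ln 2) * (1 / (t + real k + 1)\<^sup>2) = 1 / ((1 + t) * ln 2) * gauss_weight k t"
        proof -
          define a where "a = t + real k + 1"
          have a: "a > 0" using True by (simp add: a_def)
          have e: "t + real k + 2 = a + 1" by (simp add: a_def)
          have t: "1 + t > 0" using True by simp
          have "1 + 1 / a = (a + 1) / a" using a by (simp add: field_simps)
          then show ?thesis unfolding gauss_branch_def gauss_weight_def e a_def[symmetric]
            using a t by (simp add: power2_eq_square)
        qed
        then have "ennreal (1 / ((1 + gauss_branch k t) * ln 2)) * ennreal (1 / (t + real k + 1)\<^sup>2) =
          ennreal (1 / ((1 + t) * ln 2)) * ennreal (gauss_weight k t)"
          using True gauss_weight_nonneg[of t k] gauss_branch_in[of t k] by (simp flip: ennreal_mult)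
        then show ?thesis
          using True gauss_branch_irr_iff[OF True, of k] unfolding ht e W_def
          by (cases "t \<in> irr_interval") (simp_all add: mult_ac)
      qed
    qed
    finally show ?thesis .
  qed
  have disj: "disjoint_family A"
    unfolding disjoint_family_on_def
  proof (intro ballI impI)
    have *: "A i \<inter> A j = {}" if "i < j" for i j
    proof -
      have "1 / (real j + 1) \<le> 1 / (real i + 2)" using that by (intro divide_left_mono) auto
      then show ?thesis by (auto simp: A_def)
    qed
    show "A i \<inter> A j = {}" if "i \<noteq> j" for i j using *[of i j] *[of j i] that by (cases i j rule: linorder_cases) auto
  qed
  have split: "W x = (\<Sum>k. W x * indicator (A k) x)" for x
  proof (cases "x \<in> irr_interval")
    case True
    note x = irr_interval_bounds[OF True]
    define k where "k = nat \<lfloor>1 / x\<rfloor> - 1"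
    have k: "real k + 1 = real (nat \<lfloor>1 / x\<rfloor>)" unfolding k_def using gauss_map_decomposition(2)[OF True] by (simp only: of_nat_diff of_nat_1)
    have "1 / x = real k + 1 + gauss_map x" unfolding k by (rule gauss_map_decomposition(3)[OF True])
    moreover have "0 < gauss_map x" "gauss_map x < 1"
      using irr_interval_bounds[OF gauss_map_decomposition(1)[OF True]] by auto
    ultimately have "real k + 1 \<le> 1 / x" "1 / x < real k + 2" by auto
    then have "x \<in> A k" using x by (simp add: A_def field_simps)
    then show ?thesis by (subst suminf_cmult_indicator[OF disj]) auto
  qed (simp add: W_def)
  have "(\<integral>\<^sup>+x. g x \<partial>gauss_measure) = (\<integral>\<^sup>+x. W x \<partial>lborel)"
    unfolding W_def by (rule nn_integral_gauss_measure[OF assms])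
  also have "\<dots> = (\<integral>\<^sup>+x. (\<Sum>k. W x * indicator (A k) x) \<partial>lborel)"
    by (rule nn_integral_cong[OF split])
  also have "\<dots> = (\<Sum>k. \<integral>\<^sup>+x. W x * indicator (A k) x \<partial>lborel)"
    by (rule nn_integral_suminf) (auto simp: A_def)
  also have "\<dots> = (\<Sum>k. \<integral>\<^sup>+x. ennreal (gauss_weight k x) * g (gauss_branch k x) \<partial>gauss_measure)"
    unfolding branch by (subst nn_integral_gauss_measure) auto
  also have "\<dots> = (\<integral>\<^sup>+x. (\<Sum>k. ennreal (gauss_weight k x) * g (gauss_branch k x)) \<partial>gauss_measure)"
    by (intro nn_integral_suminf[symmetric] measurable_gauss_measureI) auto
  finally show ?thesis .
qed

section \<open>The mean of the first digit logarithm\<close>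

text \<open>The conditional mean of the logarithm of the first digit, given the image under the Gauss map.\<close>

definition log_mean :: "real \<Rightarrow> real" where
  "log_mean x = (\<Sum>k. gauss_weight k x * ln (real k + 1))"

lemma reciprocal_pair_sums: "(\<lambda>k. 1 / ((real k + 1) * (real k + 2))) sums 1"
proof -
  have "(\<lambda>k. 1 / (real k + 1)) \<longlonglongrightarrow> 0" by real_asymp
  from telescope_sums'[OF this] have "(\<lambda>k. 1 / (real k + 1) - 1 / (real (Suc k) + 1)) sums 1" by simp
  moreover have "1 / (real k + 1) - 1 / (real (Suc k) + 1) = 1 / ((real k + 1) * (real k + 2))" for k
    by (simp add: divide_simps)
  ultimately show ?thesis by simp
qed

text \<open>The probability that the first digit exceeds \<open>k + 1\<close>, times the increment of the logarithm from
  \<open>k + 1\<close> to \<open>k + 2\<close>. Summed this way, the mean has nonnegative terms whose variation in \<open>x\<close>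
  is small enough to be summable.\<close>

definition log_tail_term :: "nat \<Rightarrow> real \<Rightarrow> real" where
  "log_tail_term k x = (1 + x) / (x + real k + 2) * (ln (real k + 2) - ln (real k + 1))"

lemma log_increment_bounds: "0 \<le> ln (real k + 2) - ln (real k + 1)"
  "ln (real k + 2) - ln (real k + 1) \<le> 1 / (real k + 1)"
proof -
  show "0 \<le> ln (real k + 2) - ln (real k + 1)" by simp
  have "ln (real k + 2) - ln (real k + 1) = ln ((real k + 2) / (real k + 1))" by (simp add: ln_div)
  also have "(real k + 2) / (real k + 1) = 1 + 1 / (real k + 1)" by (simp add: field_simps)
  also have "ln \<dots> \<le> 1 / (real k + 1)" by (rule ln_add_one_self_le_self) simp
  finally show "ln (real k + 2) - ln (real k + 1) \<le> 1 / (real k + 1)" .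
qed

lemma log_tail_term_bounds:
  assumes "x \<in> {0..1}"
  shows "0 \<le> log_tail_term k x" "log_tail_term k x \<le> 2 * (1 / ((real k + 1) * (real k + 2)))"
proof -
  show "0 \<le> log_tail_term k x"
    unfolding log_tail_term_def using assms log_increment_bounds[of k] by (intro mult_nonneg_nonneg divide_nonneg_nonneg) auto
  have "log_tail_term k x \<le> 2 / (real k + 2) * (1 / (real k + 1))"
    unfolding log_tail_term_def using assms log_increment_bounds[of k] by (intro mult_mono frac_le) auto
  then show "log_tail_term k x \<le> 2 * (1 / ((real k + 1) * (real k + 2)))" by (simp add: mult.commute)
qed

lemma log_tail_summable:
  assumes "x \<in> {0..1}" shows "summable (\<lambda>k. log_tail_term k x)"
proof (rule summable_comparison_test')
  show "summable (\<lambda>k. 2 * (1 / ((real k + 1) * (real k + 2))))"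
    using sums_mult[OF reciprocal_pair_sums, of 2] by (simp add: sums_iff)
  show "norm (log_tail_term k x) \<le> 2 * (1 / ((real k + 1) * (real k + 2)))" for k
    using log_tail_term_bounds[OF assms, of k] by simp
qed

lemma log_mean_sums:
  assumes "x \<in> {0..1}"
  shows "(\<lambda>k. gauss_weight k x * ln (real k + 1)) sums log_mean x"
    and "(\<lambda>k. log_tail_term k x) sums log_mean x"
proof -
  define e where "e = (\<lambda>k. (1 + x) / (x + real k + 1) * ln (real k + 1))"
  have "e \<longlonglongrightarrow> 0" unfolding e_def by real_asymp
  then have 1: "(\<lambda>k. e k - e (Suc k)) sums (e 0 - 0)" by (rule telescope_sums')
  have 2: "(\<lambda>k. log_tail_term k x) sums (\<Sum>k. log_tail_term k x)"
    by (rule summable_sums[OF log_tail_summable[OF assms]])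
  \<comment> \<open>Abel summation, with e the boundary term.\<close>
  have eq: "(e k - e (Suc k)) + log_tail_term k x = gauss_weight k x * ln (real k + 1)" for k
  proof -
    define a where "a = x + real k + 1"
    define l where "l = ln (real k + 1)"
    define l' where "l' = ln (real k + 2)"
    have a: "a > 0" using assms by (simp add: a_def)
    have "(e k - e (Suc k)) + log_tail_term k x =
      ((1 + x) / a * l - (1 + x) / (a + 1) * l') + (1 + x) / (a + 1) * (l' - l)"
      by (simp add: e_def log_tail_term_def a_def l_def l'_def add_ac)
    also have "\<dots> = (1 + x) * l * (1 / a - 1 / (a + 1))"
      by (simp add: divide_inverse algebra_simps)
    also have "1 / a - 1 / (a + 1) = 1 / (a * (a + 1))" using a by (simp add: field_simps)
    also have "(1 + x) * l * (1 / (a * (a + 1))) = gauss_weight k x * ln (real k + 1)"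
      by (simp add: gauss_weight_def a_def l_def add_ac)
    finally show ?thesis .
  qed
  have "(\<lambda>k. gauss_weight k x * ln (real k + 1)) sums (\<Sum>k. log_tail_term k x)"
    using sums_add[OF 1 2] unfolding eq by (simp add: e_def)
  moreover from this have "log_mean x = (\<Sum>k. log_tail_term k x)"
    unfolding log_mean_def by (simp add: sums_iff)
  ultimately show "(\<lambda>k. gauss_weight k x * ln (real k + 1)) sums log_mean x"
    "(\<lambda>k. log_tail_term k x) sums log_mean x"
    using 2 by auto
qed

lemma log_mean_bounds:
  assumes "x \<in> {0..1}" shows "log_mean x \<in> {0..2}"
proof -
  have "0 \<le> log_mean x"
    using sums_le[OF log_tail_term_bounds(1)[OF assms] sums_zero log_mean_sums(2)[OF assms]] .
  moreover have "log_mean x \<le> 2 * 1"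
    by (rule sums_le[OF log_tail_term_bounds(2)[OF assms] log_mean_sums(2)[OF assms] sums_mult[OF reciprocal_pair_sums]])
  ultimately show ?thesis by simp
qed

lemma log_mean_variation: "variation_le log_mean (\<lambda>x. x)"
  unfolding variation_le_def
proof (intro allI impI, elim conjE)
  fix x y :: real assume xy: "0 \<le> x" "x \<le> y" "y \<le> 1"
  have s: "(\<lambda>k. log_tail_term k y - log_tail_term k x) sums (log_mean y - log_mean x)"
    by (intro sums_diff log_mean_sums) (use xy in auto)
  have b: "log_tail_term k y - log_tail_term k x \<in> {0..(y - x) * (1 / ((real k + 1) * (real k + 2)))}" for k
  proof -
    define m where "m = real k + 1"
    define l where "l = ln (real k + 2) - ln (real k + 1)"
    have m: "m \<ge> 1" by (simp add: m_def)
    have l: "0 \<le> l" "l \<le> 1 / m" using log_increment_bounds[of k] by (auto simp: l_def m_def)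
    have "log_tail_term k y - log_tail_term k x = ((1 + y) / (y + (m + 1)) - (1 + x) / (x + (m + 1))) * l"
      by (simp add: log_tail_term_def l_def m_def left_diff_distrib add_ac)
    also have "(1 + y) / (y + (m + 1)) - (1 + x) / (x + (m + 1)) = (y - x) * (m / ((y + (m + 1)) * (x + (m + 1))))"
      using xy m by (simp add: divide_simps) (simp add: algebra_simps)
    finally have e: "log_tail_term k y - log_tail_term k x = (y - x) * (m / ((y + (m + 1)) * (x + (m + 1)))) * l" .
    have le: "m / ((y + (m + 1)) * (x + (m + 1))) \<le> m / ((m + 1) * m)"
      using xy m by (intro divide_left_mono mult_mono mult_pos_pos) auto
    have "(y - x) * (m / ((y + (m + 1)) * (x + (m + 1)))) * l \<le> (y - x) * (m / ((m + 1) * m)) * (1 / m)"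
      using xy m l le by (intro mult_mono mult_nonneg_nonneg) auto
    also have "\<dots> = (y - x) * (1 / (m * (m + 1)))" using m by simp
    finally have "log_tail_term k y - log_tail_term k x \<le> (y - x) * (1 / (m * (m + 1)))" unfolding e .
    moreover have "0 \<le> (y - x) * (m / ((y + (m + 1)) * (x + (m + 1)))) * l"
      using xy m l by (intro mult_nonneg_nonneg divide_nonneg_nonneg) auto
    ultimately show ?thesis unfolding e by (simp add: m_def add_ac)
  qed
  have "0 \<le> log_mean y - log_mean x" using sums_le[OF _ sums_zero s] b by auto
  moreover have "log_mean y - log_mean x \<le> (y - x) * 1"
    by (rule sums_le[OF _ s sums_mult[OF reciprocal_pair_sums]]) (use b in auto)
  ultimately show "norm (log_mean y - log_mean x) \<le> y - x" by simp
qed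

text \<open>The Gauss operator contracts Lipschitz constants by the factor \<open>7/8\<close>.\<close>

lemma variation_le_gauss_op_linear:
  assumes "variation_le f (\<lambda>x. c * x)" "0 \<le> c"
  shows "variation_le (gauss_op f) (\<lambda>x. 7/8 * c * x)"
  unfolding variation_le_def
proof (intro allI impI, elim conjE)
  fix x y :: real assume xy: "0 \<le> x" "x \<le> y" "y \<le> 1"
  have *: "gauss_op (\<lambda>x. c * x) z = c * gauss_op (\<lambda>x. x) z" if "0 \<le> z" for z
    using gauss_op_scaleR[OF that, of "\<lambda>x. x" 1 c] by simp
  have "norm (gauss_op f y - gauss_op f x) \<le> c * (gauss_op (\<lambda>x. x) x - gauss_op (\<lambda>x. x) y)"
    using variation_leD[OF variation_le_gauss_op[OF assms(1)] xy] xy by (simp add: * right_diff_distrib)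
  also have "\<dots> \<le> c * (7/8 * (y - x))"
    using variation_leD[OF gauss_op_identity_slope_upper xy] assms(2)
    by (intro mult_left_mono) (auto simp: right_diff_distrib)
  finally show "norm (gauss_op f y - gauss_op f x) \<le> 7/8 * c * y - 7/8 * c * x"
    by (simp add: algebra_simps)
qed

definition mean_iterate :: "nat \<Rightarrow> real \<Rightarrow> real" where
  "mean_iterate j = (gauss_op ^^ j) log_mean"

lemma mean_iterate_0 [simp]: "mean_iterate 0 = log_mean"
  and mean_iterate_Suc: "mean_iterate (Suc j) = gauss_op (mean_iterate j)"
  by (simp_all add: mean_iterate_def)

lemma mean_iterate_variation: "variation_le (mean_iterate j) (\<lambda>x. (7/8) ^ j * x)"
proof (induction j)
  case 0 show ?case using log_mean_variation by simp
next
  case (Suc j) show ?case using variation_le_gauss_op_linear[OF Suc] by (simp add: mean_iterate_Suc)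
qed

lemma mean_iterate_bounds: "x \<in> {0..1} \<Longrightarrow> mean_iterate j x \<in> {0..2}"
proof (induction j arbitrary: x)
  case 0 then show ?case using log_mean_bounds by simp
next
  case (Suc j)
  then have x: "0 \<le> x" by simp
  have n: "norm (mean_iterate j y) \<le> 2" if "y \<in> {0..1}" for y using Suc.IH[OF that] by simp
  have "0 \<le> gauss_op (mean_iterate j) x"
    using sums_le[OF _ sums_zero gauss_op_sums[of x "mean_iterate j", OF x n]] gauss_weight_nonneg[OF x]
      Suc.IH[OF gauss_branch_in[OF x]] by (auto intro!: mult_nonneg_nonneg)
  then show ?case using norm_gauss_op_le[of x "mean_iterate j", OF x n] by (simp add: mean_iterate_Suc)
qed

lemma gauss_op_measurable:
  fixes f :: "real \<Rightarrow> real"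
  assumes [measurable]: "f \<in> borel_measurable borel"
  shows "gauss_op f \<in> borel_measurable borel"
  unfolding gauss_op_def[abs_def] by measurable

lemma mean_iterate_measurable [measurable]: "mean_iterate j \<in> borel_measurable borel"
proof (induction j)
  case 0
  have "log_mean \<in> borel_measurable borel" unfolding log_mean_def[abs_def] by measurable
  then show ?case by simp
next
  case (Suc j) then show ?case unfolding mean_iterate_Suc by (rule gauss_op_measurable)
qed

definition first_digit_log :: "real \<Rightarrow> real" where
  "first_digit_log x = ln (real (nat \<lfloor>1 / x\<rfloor>))"

lemma first_digit_log_measurable [measurable]: "first_digit_log \<in> borel_measurable borel"
  unfolding first_digit_log_def[abs_def] by measurable

text \<open>The Gauss measure is invariant, in the sense that the Gauss operator preserves integrals.\<close>

lemma nn_integral_mean_iterate: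
  "(\<integral>\<^sup>+x. ennreal (mean_iterate j x) \<partial>gauss_measure) = (\<integral>\<^sup>+x. ennreal (first_digit_log x) \<partial>gauss_measure)"
proof (induction j)
  case 0
  have "(\<integral>\<^sup>+x. ennreal (first_digit_log x) \<partial>gauss_measure) =
     (\<integral>\<^sup>+x. (\<Sum>k. ennreal (gauss_weight k x) * ennreal (first_digit_log (gauss_branch k x))) \<partial>gauss_measure)"
    by (rule nn_integral_gauss_transfer) measurable
  also have "\<dots> = (\<integral>\<^sup>+x. ennreal (mean_iterate 0 x) \<partial>gauss_measure)"
  proof (rule nn_integral_cong)
    fix x assume "x \<in> space gauss_measure"
    then have x: "x \<in> irr_interval" by simp
    then have x01: "x \<in> {0..1}" using irr_interval_bounds[OF x] by auto
    have "first_digit_log (gauss_branch k x) = ln (real k + 1)" for k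
      unfolding first_digit_log_def gauss_branch_inverse(1)[OF x] by (simp add: add.commute)
    then have "(\<Sum>k. ennreal (gauss_weight k x) * ennreal (first_digit_log (gauss_branch k x))) =
       (\<Sum>k. ennreal (gauss_weight k x * ln (real k + 1)))"
      using gauss_weight_nonneg[of x] x01 by (simp add: ennreal_mult)
    also have "\<dots> = ennreal (\<Sum>k. gauss_weight k x * ln (real k + 1))"
      using gauss_weight_nonneg[of x] x01 log_mean_sums(1)[OF x01]
      by (intro suminf_ennreal2) (auto simp: sums_iff)
    finally show "(\<Sum>k. ennreal (gauss_weight k x) * ennreal (first_digit_log (gauss_branch k x))) =
       ennreal (mean_iterate 0 x)" by (simp add: log_mean_def)
  qed
  finally show ?case ..
next
  case (Suc j)
  have "(\<integral>\<^sup>+x. ennreal (mean_iterate j x) \<partial>gauss_measure) =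
     (\<integral>\<^sup>+x. (\<Sum>k. ennreal (gauss_weight k x) * ennreal (mean_iterate j (gauss_branch k x))) \<partial>gauss_measure)"
    by (rule nn_integral_gauss_transfer) measurable
  also have "\<dots> = (\<integral>\<^sup>+x. ennreal (mean_iterate (Suc j) x) \<partial>gauss_measure)"
  proof (rule nn_integral_cong)
    fix x assume "x \<in> space gauss_measure"
    then have x: "0 \<le> x" using irr_interval_bounds[of x] by auto
    have n: "norm (mean_iterate j y) \<le> 2" if "y \<in> {0..1}" for y using mean_iterate_bounds[OF that, of j] by simp
    have nn: "0 \<le> mean_iterate j (gauss_branch k x)" for k
      using mean_iterate_bounds[OF gauss_branch_in[OF x], of j k] by simp
    have "(\<Sum>k. ennreal (gauss_weight k x) * ennreal (mean_iterate j (gauss_branch k x))) =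
       (\<Sum>k. ennreal (gauss_weight k x * mean_iterate j (gauss_branch k x)))"
      using gauss_weight_nonneg[OF x] nn by (simp add: ennreal_mult)
    also have "\<dots> = ennreal (\<Sum>k. gauss_weight k x * mean_iterate j (gauss_branch k x))"
      using gauss_weight_nonneg[OF x] nn gauss_op_sums[of x "mean_iterate j", OF x n]
      by (intro suminf_ennreal2) (auto simp: sums_iff)
    finally show "(\<Sum>k. ennreal (gauss_weight k x) * ennreal (mean_iterate j (gauss_branch k x))) =
       ennreal (mean_iterate (Suc j) x)" by (simp add: mean_iterate_Suc gauss_op_def)
  qed
  finally show ?case using Suc by simp
qed

lemma kappa_eq: "kappa = enn2real (\<integral>\<^sup>+x. ennreal (first_digit_log x) \<partial>gauss_measure)"
proof -
  have "kappa = (\<integral>x. first_digit_log x \<partial>gauss_measure)"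
    unfolding kappa_def
  proof (rule Bochner_Integration.integral_cong)
    show "ln (real (cf_digit x 1)) = first_digit_log x" if "x \<in> space gauss_measure" for x
      using that by (simp add: cf_digit_eq first_digit_log_def)
  qed simp
  also have "\<dots> = enn2real (\<integral>\<^sup>+x. ennreal (first_digit_log x) \<partial>gauss_measure)"
  proof (rule integral_eq_nn_integral)
    show "first_digit_log \<in> borel_measurable gauss_measure" by (rule measurable_gauss_measureI) measurable
    show "AE x in gauss_measure. 0 \<le> first_digit_log x"
    proof (rule AE_I2)
      fix x assume "x \<in> space gauss_measure"
      then have "1 \<le> nat \<lfloor>1 / x\<rfloor>" by (intro gauss_map_decomposition(2)) simp
      then have "1 \<le> real (nat \<lfloor>1 / x\<rfloor>)" by (simp only: real_of_nat_ge_one_iff)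
      then show "0 \<le> first_digit_log x" unfolding first_digit_log_def by (rule ln_ge_zero)
    qed
  qed
  finally show ?thesis .
qed

text \<open>The iterate has oscillation at most \<open>(7/8) ^ j\<close> on the unit interval and has mean \<open>kappa\<close>.\<close>

lemma mean_iterate_near_kappa:
  assumes x: "x \<in> {0..1}"
  shows "\<bar>mean_iterate j x - kappa\<bar> \<le> (7/8) ^ j"
proof -
  let ?I = "\<integral>\<^sup>+y. ennreal (mean_iterate j y) \<partial>gauss_measure"
  have I: "kappa = enn2real ?I" unfolding kappa_eq nn_integral_mean_iterate ..
  have near: "\<bar>mean_iterate j y - mean_iterate j x\<bar> \<le> (7/8) ^ j" if y: "y \<in> {0..1}" for y
  proof -
    have "\<bar>mean_iterate j y - mean_iterate j x\<bar> \<le> (7/8) ^ j * \<bar>y - x\<bar>"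
    proof (cases "x \<le> y")
      case True
      then show ?thesis using variation_leD[OF mean_iterate_variation[of j], of x y] x y
        by (simp add: right_diff_distrib)
    next
      case False
      then show ?thesis using variation_leD[OF mean_iterate_variation[of j], of y x] x y
        by (simp add: right_diff_distrib abs_minus_commute)
    qed
    also have "\<dots> \<le> (7/8) ^ j * 1" using x y by (intro mult_left_mono) auto
    finally show ?thesis by simp
  qed
  have irr: "y \<in> {0..1}" if "y \<in> space gauss_measure" for y using that irr_interval_bounds[of y] by auto
  have one: "(\<integral>\<^sup>+y. ennreal c \<partial>gauss_measure) = ennreal c" for c
    by (simp add: emeasure_gauss_measure_space)
  have m0: "0 \<le> mean_iterate j x" using mean_iterate_bounds[OF x, of j] by simp
  have "?I \<le> (\<integral>\<^sup>+y. ennreal (mean_iterate j x + (7/8) ^ j) \<partial>gauss_measure)"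
    using near[OF irr] by (intro nn_integral_mono ennreal_leI) (force simp: abs_le_iff)
  then have up: "?I \<le> ennreal (mean_iterate j x + (7/8) ^ j)" unfolding one .
  then have fin: "?I < top" using ennreal_less_top le_less_trans by blast
  have "(\<integral>\<^sup>+y. ennreal (mean_iterate j x - (7/8) ^ j) \<partial>gauss_measure) \<le> ?I"
    using near[OF irr] by (intro nn_integral_mono ennreal_leI) (force simp: abs_le_iff)
  then have low: "ennreal (mean_iterate j x - (7/8) ^ j) \<le> ?I" unfolding one .
  have "kappa \<le> mean_iterate j x + (7/8) ^ j"
    unfolding I using m0 by (intro enn2real_leI[OF _ up]) simp
  moreover have "mean_iterate j x - (7/8) ^ j \<le> kappa"
  proof (cases "0 \<le> mean_iterate j x - (7/8) ^ j")
    case True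
    then show ?thesis unfolding I using enn2real_mono[OF low fin] by simp
  next
    case False
    then show ?thesis unfolding I using enn2real_nonneg[of ?I] by linarith
  qed
  ultimately show ?thesis by (simp add: abs_le_iff)
qed

section \<open>Exponential moments of the digit product\<close>

lemma kappa_bounds: "kappa \<in> {0..2}"
proof -
  have lim: "(\<lambda>j. (7/8::real) ^ j) \<longlonglongrightarrow> 0" by real_asymp
  have up: "kappa \<le> 2 + (7/8) ^ j" and low: "- ((7/8) ^ j) \<le> kappa" for j
    using mean_iterate_near_kappa[of 0 j] mean_iterate_bounds[of 0 j] by (auto simp: abs_le_iff)
  have "kappa \<le> 2 + 0" by (rule LIMSEQ_le_const[OF tendsto_add[OF tendsto_const lim]]) (use up in auto)
  moreover have "- 0 \<le> kappa" by (rule LIMSEQ_le_const2[OF tendsto_minus[OF lim]]) (use low in auto)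
  ultimately show ?thesis by simp
qed

text \<open>A truncated solution of the Poisson equation; truncation replaces an infinite series by an error that is as
  small as needed.\<close>

definition potential :: "nat \<Rightarrow> real \<Rightarrow> real" where
  "potential J x = (\<Sum>j<J. mean_iterate j x)"

lemma potential_measurable [measurable]: "potential J \<in> borel_measurable borel"
  unfolding potential_def[abs_def] by measurable

lemma potential_diff_le:
  assumes "x \<in> {0..1}" "y \<in> {0..1}"
  shows "\<bar>potential J y - potential J x\<bar> \<le> 8"
proof -
  have geo: "(\<Sum>j<J. (7/8::real) ^ j) \<le> 8"
    using sum_le_suminf[OF summable_geometric[of "7/8::real"], of "{..<J}"] by (simp add: suminf_geometric)
  have "\<bar>potential J y - potential J x\<bar> \<le> 8" if xy: "0 \<le> x" "x \<le> y" "y \<le> 1" for x y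
  proof -
    have "\<bar>mean_iterate j y - mean_iterate j x\<bar> \<le> (7/8) ^ j" for j
    proof -
      have "\<bar>mean_iterate j y - mean_iterate j x\<bar> \<le> (7/8) ^ j * (y - x)"
        using variation_leD[OF mean_iterate_variation[of j] xy] by (simp add: right_diff_distrib)
      also have "\<dots> \<le> (7/8) ^ j * 1" using xy by (intro mult_left_mono) auto
      finally show ?thesis by simp
    qed
    then have "\<bar>\<Sum>j<J. mean_iterate j y - mean_iterate j x\<bar> \<le> (\<Sum>j<J. (7/8) ^ j)"
      by (intro order_trans[OF sum_abs] sum_mono)
    then show ?thesis using geo by (simp add: potential_def sum_subtractf)
  qed
  from this[of x y] this[of y x] show ?thesis
    using assms by (cases "x \<le> y") (auto simp: abs_minus_commute)
qed

lemma gauss_op_potential: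
  assumes "0 \<le> x"
  shows "(\<lambda>k. gauss_weight k x * potential J (gauss_branch k x)) sums (\<Sum>j<J. mean_iterate (Suc j) x)"
proof -
  have "(\<lambda>k. gauss_weight k x *\<^sub>R mean_iterate j (gauss_branch k x)) sums mean_iterate (Suc j) x" for j
    unfolding mean_iterate_Suc using mean_iterate_bounds[of _ j]
    by (intro gauss_op_sums[of x "mean_iterate j" 2] assms) fastforce
  then have "(\<lambda>k. \<Sum>j<J. gauss_weight k x *\<^sub>R mean_iterate j (gauss_branch k x)) sums (\<Sum>j<J. mean_iterate (Suc j) x)"
    by (rule sums_sum)
  then show ?thesis by (simp add: potential_def sum_distrib_left)
qed

text \<open>The sums \<open>log_mean + P u - u\<close> telescope to the first iterate that is not part of \<open>u\<close>.\<close>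

lemma potential_poisson:
  fixes J :: nat
  assumes x: "x \<in> {0..1}"
  defines "w \<equiv> \<lambda>k. ln (real k + 1) - kappa + potential J (gauss_branch k x) - potential J x"
  shows "(\<lambda>k. gauss_weight k x * w k) sums (mean_iterate J x - kappa)"
proof -
  have x0: "0 \<le> x" using x by simp
  have "(\<lambda>k. gauss_weight k x * ln (real k + 1) + gauss_weight k x * potential J (gauss_branch k x)
      - gauss_weight k x * (kappa + potential J x)) sums
     (log_mean x + (\<Sum>j<J. mean_iterate (Suc j) x) - 1 * (kappa + potential J x))"
    by (intro sums_add sums_diff sums_mult2 log_mean_sums(1)[OF x] gauss_op_potential[OF x0] gauss_weight_sums[OF x0])
  moreover have "(\<Sum>j<J. mean_iterate (Suc j) x) = potential J x + mean_iterate J x - log_mean x"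
    using sum.lessThan_Suc_shift[of "\<lambda>j. mean_iterate j x" J] by (simp add: potential_def)
  ultimately show ?thesis by (simp add: w_def algebra_simps)
qed

lemma exp_le_quadratic:
  fixes t :: real shows "exp t \<le> 1 + t + t\<^sup>2 * exp \<bar>t\<bar>"
proof -
  have "norm (exp t - (\<Sum>i\<le>1. t ^ i / fact i)) \<le> exp (norm t) * (norm t ^ Suc 1) / fact 1"
    by (rule Taylor_exp_field)
  then have "\<bar>exp t - (1 + t)\<bar> \<le> exp \<bar>t\<bar> * t\<^sup>2" by (simp add: power2_eq_square abs_mult_self_eq)
  then show ?thesis by (simp add: abs_le_iff mult.commute)
qed

text \<open>The terms are dominated by the telescoping differences \<open>4/\<surd>(k+1) - 4/\<surd>(k+2)\<close>.\<close>

lemma sqrt_moment_bound: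
  assumes x: "x \<in> {0..1}"
  shows "summable (\<lambda>k. gauss_weight k x * sqrt (real k + 1))"
    "(\<Sum>k. gauss_weight k x * sqrt (real k + 1)) \<le> 4"
proof -
  define r where "r = (\<lambda>k. 4 / sqrt (real k + 1))"
  have "r \<longlonglongrightarrow> 0" unfolding r_def by real_asymp
  then have "(\<lambda>k. r k - r (Suc k)) sums (r 0 - 0)" by (rule telescope_sums')
  then have s: "(\<lambda>k. r k - r (Suc k)) sums 4" by (simp add: r_def)
  have le: "gauss_weight k x * sqrt (real k + 1) \<le> r k - r (Suc k)" for k
  proof -
    define a where "a = sqrt (real k + 1)"
    define b where "b = sqrt (real k + 2)"
    have ab: "0 < a" "a \<le> b" "a\<^sup>2 = real k + 1" "b\<^sup>2 = real k + 2" by (auto simp: a_def b_def)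
    have "gauss_weight k x \<le> 2 / (a\<^sup>2 * b\<^sup>2)"
      unfolding gauss_weight_def using x ab by (intro frac_le mult_mono mult_pos_pos) auto
    then have "gauss_weight k x * a \<le> 2 / (a\<^sup>2 * b\<^sup>2) * a" using ab by (intro mult_right_mono) auto
    also have "\<dots> = 2 / (a * b\<^sup>2)" using ab(1,2) by (simp add: power2_eq_square)
    also have "\<dots> = 4 / (2 * b * a * b)" using ab(1,2) by (simp add: power2_eq_square)
    also have "\<dots> \<le> 4 / ((a + b) * a * b)"
      using ab by (intro divide_left_mono mult_right_mono mult_pos_pos) auto
    also have "\<dots> = 4 * (b\<^sup>2 - a\<^sup>2) / ((a + b) * a * b)" using ab(3,4) by simp
    also have "b\<^sup>2 - a\<^sup>2 = (a + b) * (b - a)" by (simp add: power2_eq_square algebra_simps)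
    also have "4 * ((a + b) * (b - a)) / ((a + b) * a * b) = 4 * (b - a) / (a * b)"
    proof -
      have "4 * ((a + b) * (b - a)) / ((a + b) * a * b) = ((a + b) * (4 * (b - a))) / ((a + b) * (a * b))"
        by (simp only: mult_ac)
      also have "\<dots> = 4 * (b - a) / (a * b)"
        by (rule nonzero_mult_divide_mult_cancel_left) (use ab(1,2) in auto)
      finally show ?thesis .
    qed
    also have "\<dots> = 4 / a - 4 / b" using ab(1,2) by (simp add: field_simps)
    finally show ?thesis by (simp add: r_def a_def b_def add.commute)
  qed
  have nn: "0 \<le> gauss_weight k x * sqrt (real k + 1)" for k using gauss_weight_nonneg[of x k] x by simp
  show sm: "summable (\<lambda>k. gauss_weight k x * sqrt (real k + 1))"
    by (rule summable_comparison_test'[of "\<lambda>k. r k - r (Suc k)" 0]) (use s le nn in \<open>auto simp: sums_iff\<close>)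
  show "(\<Sum>k. gauss_weight k x * sqrt (real k + 1)) \<le> 4"
    using sums_le[OF le summable_sums[OF sm] s] .
qed

lemma exp_5_2_le: "exp (5/2) \<le> (16::real)"
proof (rule power2_le_imp_le)
  have "(exp (5/2))\<^sup>2 = exp (1::real) ^ 5" by (simp add: exp_of_nat_mult[symmetric] exp_double[symmetric] power2_eq_square mult_exp_exp)
  also have "\<dots> \<le> 3 ^ 5" using exp_le by (intro power_mono) auto
  finally show "(exp (5/2))\<^sup>2 \<le> (16::real)\<^sup>2" by simp
qed simp

text \<open>One step of the exponential supermartingale. The increments \<open>w\<close> have conditional mean of modulus at
  most \<open>\<bar>s\<bar>\<close> and satisfy \<open>\<bar>w\<bar> \<le> log a\<^sub>1 + 10\<close>. The quadratic remainder in the expansion of \<open>exp (s w)\<close> is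
  therefore at most \<open>s\<^sup>2\<close> times \<open>50 exp (\<bar>w\<bar>/4) \<le> 800 \<surd>a\<^sub>1\<close>, whose conditional mean is at
  most \<open>3200 s\<^sup>2\<close>.\<close>

lemma tilted_weight_bound:
  assumes x: "x \<in> {0..1}" and s: "\<bar>s\<bar> \<le> 1/20" and J: "(7/8) ^ J \<le> \<bar>s\<bar>"
  defines "f \<equiv> \<lambda>k. gauss_weight k x * (exp (s * (ln (real k + 1) - kappa)) * exp (s * (potential J (gauss_branch k x) - potential J 0)))"
  shows "summable f" "(\<Sum>k. f k) \<le> exp (3201 * s\<^sup>2) * exp (s * (potential J x - potential J 0))"
proof -
  have x0: "0 \<le> x" using x by simp
  define w where "w = (\<lambda>k. ln (real k + 1) - kappa + potential J (gauss_branch k x) - potential J x)"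
  define v where "v = exp (s * (potential J x - potential J 0))"
  have f_eq: "f k = v * (gauss_weight k x * exp (s * w k))" for k
    unfolding f_def v_def w_def by (simp add: exp_add[symmetric] algebra_simps)
  have w_bound: "exp (s * w k) \<le> 1 + s * w k + 800 * s\<^sup>2 * sqrt (real k + 1)" for k
  proof -
    have "\<bar>potential J (gauss_branch k x) - potential J x\<bar> \<le> 8"
      by (intro potential_diff_le x gauss_branch_in x0)
    moreover have ln0: "0 \<le> ln (real k + 1)" by simp
    ultimately have w: "\<bar>w k\<bar> \<le> ln (real k + 1) + 10" 
      using kappa_bounds unfolding w_def abs_le_iff atLeastAtMost_iff by linarith
    have "(\<bar>w k\<bar> / 5)\<^sup>2 / 2 \<le> exp (\<bar>w k\<bar> / 5)" using exp_lower_Taylor_quadratic[of "\<bar>w k\<bar> / 5"] by simp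
    then have w2: "(w k)\<^sup>2 \<le> 50 * exp (\<bar>w k\<bar> / 5)" by (simp add: power_divide)
    have "\<bar>s * w k\<bar> \<le> 1/20 * \<bar>w k\<bar>" unfolding abs_mult using s by (intro mult_right_mono) auto
    then have "(s * w k)\<^sup>2 * exp \<bar>s * w k\<bar> \<le> s\<^sup>2 * (50 * exp (\<bar>w k\<bar> / 5)) * exp (\<bar>w k\<bar> / 20)"
      using w2 unfolding power_mult_distrib by (intro mult_mono mult_left_mono) auto
    also have "\<dots> = 50 * s\<^sup>2 * exp (\<bar>w k\<bar> / 4)" by (simp add: mult_exp_exp)
    also have "exp (\<bar>w k\<bar> / 4) \<le> exp (5/2 + ln (real k + 1) / 2)"
      unfolding exp_le_cancel_iff using w ln0 by linarith
    also have "\<dots> = exp (5/2) * sqrt (real k + 1)"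
      by (simp add: exp_add powr_half_sqrt[symmetric] powr_def)
    also have "\<dots> \<le> 16 * sqrt (real k + 1)" using exp_5_2_le by (intro mult_right_mono) auto
    finally have "(s * w k)\<^sup>2 * exp \<bar>s * w k\<bar> \<le> 800 * s\<^sup>2 * sqrt (real k + 1)" by (simp add: mult_left_mono)
    then show ?thesis using exp_le_quadratic[of "s * w k"] by linarith
  qed
  have "(\<lambda>k. gauss_weight k x + s * (gauss_weight k x * w k) + 800 * s\<^sup>2 * (gauss_weight k x * sqrt (real k + 1)))
    sums (1 + s * (mean_iterate J x - kappa) + 800 * s\<^sup>2 * (\<Sum>k. gauss_weight k x * sqrt (real k + 1)))"
    unfolding w_def
    by (intro sums_add sums_mult gauss_weight_sums[OF x0] potential_poisson[OF x] summable_sums sqrt_moment_bound(1)[OF x])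
  then have S: "(\<lambda>k. gauss_weight k x * (1 + s * w k + 800 * s\<^sup>2 * sqrt (real k + 1)))
    sums (1 + s * (mean_iterate J x - kappa) + 800 * s\<^sup>2 * (\<Sum>k. gauss_weight k x * sqrt (real k + 1)))"
    by (simp add: algebra_simps)
  have g_le: "gauss_weight k x * exp (s * w k) \<le> gauss_weight k x * (1 + s * w k + 800 * s\<^sup>2 * sqrt (real k + 1))" for k
    using w_bound gauss_weight_nonneg[OF x0] by (intro mult_left_mono) auto
  have sg: "summable (\<lambda>k. gauss_weight k x * exp (s * w k))"
    by (rule summable_comparison_test'[OF sums_summable[OF S], of 0]) (use g_le gauss_weight_nonneg[OF x0] in auto)
  have "(\<Sum>k. gauss_weight k x * exp (s * w k)) \<le>
      1 + s * (mean_iterate J x - kappa) + 800 * s\<^sup>2 * (\<Sum>k. gauss_weight k x * sqrt (real k + 1))"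
    by (rule sums_le[OF g_le summable_sums[OF sg] S])
  also have "\<dots> \<le> 1 + s\<^sup>2 + 800 * s\<^sup>2 * 4"
  proof (intro add_mono mult_left_mono sqrt_moment_bound(2)[OF x])
    have "s * (mean_iterate J x - kappa) \<le> \<bar>s\<bar> * \<bar>mean_iterate J x - kappa\<bar>"
      by (metis abs_ge_self abs_mult)
    also have "\<dots> \<le> \<bar>s\<bar> * \<bar>s\<bar>" using mean_iterate_near_kappa[OF x, of J] J by (intro mult_left_mono) auto
    finally show "s * (mean_iterate J x - kappa) \<le> s\<^sup>2" by (simp add: power2_eq_square)
  qed auto
  also have "\<dots> = 1 + 3201 * s\<^sup>2" by simp
  also have "\<dots> \<le> exp (3201 * s\<^sup>2)" by (rule exp_ge_add_one_self)
  finally have le: "(\<Sum>k. gauss_weight k x * exp (s * w k)) \<le> exp (3201 * s\<^sup>2)" .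
  show "summable f" unfolding f_eq[abs_def] by (rule summable_mult[OF sg])
  have "(\<Sum>k. f k) = v * (\<Sum>k. gauss_weight k x * exp (s * w k))"
    unfolding f_eq by (rule suminf_mult[OF sg])
  also have "\<dots> \<le> v * exp (3201 * s\<^sup>2)" using le by (intro mult_left_mono) (auto simp: v_def)
  finally show "(\<Sum>k. f k) \<le> exp (3201 * s\<^sup>2) * exp (s * (potential J x - potential J 0))"
    by (simp add: v_def mult.commute)
qed

text \<open>On irrational points this is the logarithm of the digit product. Unlike the digits themselves, it is defined
  by a Borel formula on the whole line.\<close>

fun log_digit_sum :: "nat \<Rightarrow> real \<Rightarrow> real" where
  "log_digit_sum 0 x = 0"
| "log_digit_sum (Suc n) x = first_digit_log x + log_digit_sum n (gauss_map x)"

lemma log_digit_sum_measurable [measurable]: "log_digit_sum n \<in> borel_measurable borel"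
proof (induction n)
  case (Suc n)
  note [measurable] = Suc
  show ?case unfolding log_digit_sum.simps[abs_def] by measurable
qed simp

lemma digit_prod_eq_exp:
  assumes "x \<in> irr_interval" shows "real (digit_prod n x) = exp (log_digit_sum n x)"
  using assms
proof (induction n arbitrary: x)
  case 0 then show ?case by (simp add: digit_prod_def)
next
  case (Suc n)
  have "0 < real (nat \<lfloor>1 / x\<rfloor>)" using gauss_map_decomposition(2)[OF Suc.prems] by linarith
  then show ?case
    using Suc.IH[OF gauss_map_decomposition(1)[OF Suc.prems]]
    by (simp add: digit_prod_Suc[OF Suc.prems] exp_add first_digit_log_def)
qed

text \<open>Transferring the integral along the Gauss map removes the first digit, and \<open>tilted_weight_bound\<close>
  restores the potential term at the cost of a factor \<open>exp (3201 s\<^sup>2)\<close>.\<close>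

lemma exponential_moment_tilted:
  assumes s: "\<bar>s\<bar> \<le> 1/20" and J: "(7/8) ^ J \<le> \<bar>s\<bar>"
  shows "(\<integral>\<^sup>+x. ennreal (exp (s * (log_digit_sum n x - kappa * real n)) * exp (s * (potential J x - potential J 0))) \<partial>gauss_measure)
     \<le> ennreal (exp (3201 * s\<^sup>2 * real n) * exp (8 * \<bar>s\<bar>))"
proof (induction n)
  case 0
  have "exp (s * (potential J x - potential J 0)) \<le> exp (8 * \<bar>s\<bar>)" if "x \<in> irr_interval" for x
  proof -
    have "s * (potential J x - potential J 0) \<le> \<bar>s\<bar> * \<bar>potential J x - potential J 0\<bar>"
      by (metis abs_ge_self abs_mult)
    also have "\<dots> \<le> \<bar>s\<bar> * 8"
      using irr_interval_bounds[OF that] by (intro mult_left_mono potential_diff_le) auto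
    finally show ?thesis by simp
  qed
  then have "(\<integral>\<^sup>+x. ennreal (exp (s * (potential J x - potential J 0))) \<partial>gauss_measure)
     \<le> (\<integral>\<^sup>+x. ennreal (exp (8 * \<bar>s\<bar>)) \<partial>gauss_measure)"
    by (intro nn_integral_mono ennreal_leI) auto
  then show ?case by (simp add: emeasure_gauss_measure_space)
next
  case (Suc n)
  define v where "v = (\<lambda>x. exp (s * (potential J x - potential J 0)))"
  have v[measurable]: "v \<in> borel_measurable borel" unfolding v_def by measurable
  have "(\<integral>\<^sup>+x. ennreal (exp (s * (log_digit_sum (Suc n) x - kappa * real (Suc n))) * v x) \<partial>gauss_measure) =
    (\<integral>\<^sup>+x. (\<Sum>k. ennreal (gauss_weight k x) * ennreal (exp (s * (log_digit_sum (Suc n) (gauss_branch k x) - kappa * real (Suc n))) * v (gauss_branch k x))) \<partial>gauss_measure)"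
    by (rule nn_integral_gauss_transfer) measurable
  also have "\<dots> \<le> (\<integral>\<^sup>+x. ennreal (exp (3201 * s\<^sup>2)) * ennreal (exp (s * (log_digit_sum n x - kappa * real n)) * v x) \<partial>gauss_measure)"
  proof (rule nn_integral_mono)
    fix x assume "x \<in> space gauss_measure"
    then have x: "x \<in> irr_interval" by simp
    then have x01: "x \<in> {0..1}" using irr_interval_bounds[OF x] by auto
    define e where "e = exp (s * (log_digit_sum n x - kappa * real n))"
    define f where "f = (\<lambda>k. gauss_weight k x * (exp (s * (ln (real k + 1) - kappa)) * v (gauss_branch k x)))"
    have f: "summable f" "(\<Sum>k. f k) \<le> exp (3201 * s\<^sup>2) * v x"
      using tilted_weight_bound[OF x01 s J] unfolding f_def v_def by auto
    have f0: "0 \<le> f k" for k unfolding f_def v_def using gauss_weight_nonneg[of x k] x01 by auto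
    have "ennreal (gauss_weight k x) * ennreal (exp (s * (log_digit_sum (Suc n) (gauss_branch k x) - kappa * real (Suc n))) * v (gauss_branch k x))
       = ennreal (e * f k)" for k
    proof -
      have "log_digit_sum (Suc n) (gauss_branch k x) = ln (real k + 1) + log_digit_sum n x"
        by (simp add: gauss_branch_inverse[OF x] first_digit_log_def add.commute)
      then have "exp (s * (log_digit_sum (Suc n) (gauss_branch k x) - kappa * real (Suc n))) =
          e * exp (s * (ln (real k + 1) - kappa))"
        by (simp add: e_def exp_add[symmetric] algebra_simps)
      then show ?thesis
        using gauss_weight_nonneg[of x k] x01 by (simp add: f_def v_def ennreal_mult'[symmetric] mult_ac)
    qed
    then have "(\<Sum>k. ennreal (gauss_weight k x) * ennreal (exp (s * (log_digit_sum (Suc n) (gauss_branch k x) - kappa * real (Suc n))) * v (gauss_branch k x)))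
       = (\<Sum>k. ennreal (e * f k))" by simp
    also have "\<dots> = ennreal (\<Sum>k. e * f k)"
      using f f0 by (intro suminf_ennreal2 summable_mult) (auto simp: e_def)
    also have "(\<Sum>k. e * f k) = e * (\<Sum>k. f k)" by (rule suminf_mult[OF f(1)])
    also have "ennreal \<dots> \<le> ennreal (e * (exp (3201 * s\<^sup>2) * v x))"
      using f(2) by (intro ennreal_leI mult_left_mono) (auto simp: e_def)
    also have "\<dots> = ennreal (exp (3201 * s\<^sup>2)) * ennreal (e * v x)"
      by (simp add: ennreal_mult'[symmetric] e_def v_def mult_ac)
    finally show "(\<Sum>k. ennreal (gauss_weight k x) * ennreal (exp (s * (log_digit_sum (Suc n) (gauss_branch k x) - kappa * real (Suc n))) * v (gauss_branch k x)))
      \<le> ennreal (exp (3201 * s\<^sup>2)) * ennreal (exp (s * (log_digit_sum n x - kappa * real n)) * v x)"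
      by (simp add: e_def)
  qed
  also have "\<dots> = ennreal (exp (3201 * s\<^sup>2)) * (\<integral>\<^sup>+x. ennreal (exp (s * (log_digit_sum n x - kappa * real n)) * v x) \<partial>gauss_measure)"
    by (intro nn_integral_cmult measurable_gauss_measureI) measurable
  also have "\<dots> \<le> ennreal (exp (3201 * s\<^sup>2)) * ennreal (exp (3201 * s\<^sup>2 * real n) * exp (8 * \<bar>s\<bar>))"
    using Suc unfolding v_def by (intro mult_left_mono) auto
  also have "\<dots> = ennreal (exp (3201 * s\<^sup>2 * real (Suc n)) * exp (8 * \<bar>s\<bar>))"
    by (simp add: ennreal_mult'[symmetric] exp_add[symmetric] algebra_simps)
  finally show ?case unfolding v_def .
qed

text \<open>The potential has oscillation at most \<open>8\<close>, so inserting it and removing it costs \<open>exp (16 \<bar>s\<bar>)\<close> altogether.\<close>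

lemma exponential_moment_bound:
  assumes s: "0 < \<bar>s\<bar>" "\<bar>s\<bar> \<le> 1/20"
  shows "(\<integral>\<^sup>+x. ennreal (exp (s * (log_digit_sum n x - kappa * real n))) \<partial>gauss_measure)
     \<le> ennreal (exp (3201 * s\<^sup>2 * real n + 16 * \<bar>s\<bar>))"
proof -
  obtain J where J: "(7/8::real) ^ J < \<bar>s\<bar>" using real_arch_pow_inv[of "\<bar>s\<bar>" "7/8"] s by auto
  have "(\<integral>\<^sup>+x. ennreal (exp (s * (log_digit_sum n x - kappa * real n))) \<partial>gauss_measure) \<le>
    (\<integral>\<^sup>+x. ennreal (exp (8 * \<bar>s\<bar>)) * ennreal (exp (s * (log_digit_sum n x - kappa * real n)) * exp (s * (potential J x - potential J 0))) \<partial>gauss_measure)"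
  proof (rule nn_integral_mono)
    fix x assume "x \<in> space gauss_measure"
    then have x: "x \<in> {0..1}" using irr_interval_bounds[of x] by auto
    have "- (s * (potential J x - potential J 0)) \<le> \<bar>s\<bar> * \<bar>potential J x - potential J 0\<bar>"
      by (metis abs_ge_minus_self abs_mult)
    also have "\<dots> \<le> \<bar>s\<bar> * 8" using x by (intro mult_left_mono potential_diff_le) auto
    finally have "1 \<le> exp (8 * \<bar>s\<bar> + s * (potential J x - potential J 0))" by simp
    then have "exp (s * (log_digit_sum n x - kappa * real n)) * 1 \<le>
       exp (s * (log_digit_sum n x - kappa * real n)) * exp (8 * \<bar>s\<bar> + s * (potential J x - potential J 0))"
      by (intro mult_left_mono) auto
    then show "ennreal (exp (s * (log_digit_sum n x - kappa * real n))) \<le>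
       ennreal (exp (8 * \<bar>s\<bar>)) * ennreal (exp (s * (log_digit_sum n x - kappa * real n)) * exp (s * (potential J x - potential J 0)))"
      by (simp add: ennreal_mult'[symmetric] exp_add mult_ac)
  qed
  also have "\<dots> = ennreal (exp (8 * \<bar>s\<bar>)) * (\<integral>\<^sup>+x. ennreal (exp (s * (log_digit_sum n x - kappa * real n)) * exp (s * (potential J x - potential J 0))) \<partial>gauss_measure)"
    by (intro nn_integral_cmult measurable_gauss_measureI) measurable
  also have "\<dots> \<le> ennreal (exp (8 * \<bar>s\<bar>)) * ennreal (exp (3201 * s\<^sup>2 * real n) * exp (8 * \<bar>s\<bar>))"
    using exponential_moment_tilted[OF s(2) less_imp_le[OF J]] by (intro mult_left_mono) auto
  also have "\<dots> = ennreal (exp (3201 * s\<^sup>2 * real n + 16 * \<bar>s\<bar>))"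
    by (simp add: ennreal_mult'[symmetric] exp_add[symmetric] algebra_simps)
  finally show ?thesis .
qed

text \<open>The sign \<open>\<sigma>\<close> treats both tails at once.\<close>

lemma chernoff_bound:
  fixes T \<sigma> \<theta> :: real and n :: nat
  assumes \<sigma>: "\<sigma> \<in> {1, -1}" and \<theta>: "0 < \<theta>" "\<theta> \<le> 1/20"
  defines "B \<equiv> {x \<in> irr_interval. T * real n < \<sigma> * (log_digit_sum n x - kappa * real n)}"
  shows "B \<in> sets gauss_measure"
    "emeasure gauss_measure B \<le> ennreal (exp (3201 * \<theta>\<^sup>2 * real n + 16 * \<theta> - \<theta> * T * real n))"
proof -
  have "{x. T * real n < \<sigma> * (log_digit_sum n x - kappa * real n)} \<in> sets borel" by measurable
  moreover have "B = irr_interval \<inter> {x. T * real n < \<sigma> * (log_digit_sum n x - kappa * real n)}"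
    by (auto simp: B_def)
  ultimately show B: "B \<in> sets gauss_measure"
    unfolding sets_gauss_measure sets_restrict_space by auto
  define s where "s = \<sigma> * \<theta>"
  have s: "\<bar>s\<bar> = \<theta>" "s\<^sup>2 = \<theta>\<^sup>2" using \<sigma> \<theta> by (auto simp: s_def)
  have "emeasure gauss_measure B = (\<integral>\<^sup>+x. indicator B x \<partial>gauss_measure)" using B by simp
  also have "\<dots> \<le> (\<integral>\<^sup>+x. ennreal (exp (- (\<theta> * T * real n))) * ennreal (exp (s * (log_digit_sum n x - kappa * real n))) \<partial>gauss_measure)"
  proof (rule nn_integral_mono)
    fix x assume "x \<in> space gauss_measure"
    show "indicator B x \<le> ennreal (exp (- (\<theta> * T * real n))) * ennreal (exp (s * (log_digit_sum n x - kappa * real n)))"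
    proof (cases "x \<in> B")
      case True
      then have "T * real n \<le> \<sigma> * (log_digit_sum n x - kappa * real n)" by (auto simp: B_def)
      then have "\<theta> * (T * real n) \<le> \<theta> * (\<sigma> * (log_digit_sum n x - kappa * real n))"
        using \<theta> by (intro mult_left_mono) auto
      then have "1 \<le> exp (- (\<theta> * T * real n) + s * (log_digit_sum n x - kappa * real n))"
        by (simp add: s_def mult_ac)
      then have "1 \<le> ennreal (exp (- (\<theta> * T * real n) + s * (log_digit_sum n x - kappa * real n)))"
        by (metis ennreal_1 ennreal_leI)
      then show ?thesis using True by (simp add: ennreal_mult'[symmetric] exp_add[symmetric])
    qed simp
  qed
  also have "\<dots> = ennreal (exp (- (\<theta> * T * real n))) * (\<integral>\<^sup>+x. ennreal (exp (s * (log_digit_sum n x - kappa * real n))) \<partial>gauss_measure)"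
    by (intro nn_integral_cmult measurable_gauss_measureI) measurable
  also have "\<dots> \<le> ennreal (exp (- (\<theta> * T * real n))) * ennreal (exp (3201 * s\<^sup>2 * real n + 16 * \<bar>s\<bar>))"
    using \<theta> s by (intro mult_left_mono exponential_moment_bound) auto
  also have "\<dots> = ennreal (exp (3201 * \<theta>\<^sup>2 * real n + 16 * \<theta> - \<theta> * T * real n))"
    by (simp add: ennreal_mult'[symmetric] exp_add[symmetric] s algebra_simps)
  finally show "emeasure gauss_measure B \<le> ennreal (exp (3201 * \<theta>\<^sup>2 * real n + 16 * \<theta> - \<theta> * T * real n))" .
qed

section \<open>Comparison with the stretched exponential rate\<close>

lemma Lambda_bar_ge_1: "1 \<le> Lambda_bar"
proof -
  have l: "2/3 \<le> ln (2::real)" by (rule ln2_ge_two_thirds)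
  have "3\<^sup>2 \<le> pi\<^sup>2" using pi_gt3 by (intro power_mono) auto
  then have "3\<^sup>2 * (2/3) \<le> pi\<^sup>2 * ln 2" using l by (intro mult_mono) auto
  then have "0 \<le> pi\<^sup>2 * ln 2 / 12 - 1/2" by simp
  moreover have "sqrt gkw_constant \<le> 1" using gkw_constant_le_1 by simp
  ultimately show ?thesis unfolding Lambda_bar_def using l by simp
qed

text \<open>The denominator in the exponent of \<open>Xi\<close>, up to the factor \<open>2\<close>.\<close>

definition rate_scale :: "real \<Rightarrow> real" where
  "rate_scale T = (128 * r_bar\<^sup>2 * Lambda_bar + (16 * r_bar * Lambda_bar) powr (1/3) * T) powr (3/2)"

lemma Xi_eq: "Xi T = exp (- (T\<^sup>2 / (2 * rate_scale T)))"
  by (simp add: Xi_def rate_scale_def)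

text \<open>The inequality of the arithmetic and geometric means makes the \<open>3/2\<close>-th power of \<open>A + B T\<close>
  at least linear in \<open>T\<close>. This is all that the final comparison needs to know about the constants.\<close>

lemma rate_scale_bounds:
  assumes T: "0 < T"
  shows "0 < rate_scale T" "120 * T \<le> rate_scale T"
proof -
  define A where "A = 128 * r_bar\<^sup>2 * Lambda_bar"
  define B where "B = (16 * r_bar * Lambda_bar) powr (1/3)"
  have l: "0 < ln (2::real)" "ln 2 \<le> (25/36::real)" using ln2_le_25_over_36 by auto
  have "108 / 50 = 3 / (2 * (25/36::real))" by simp
  also have "\<dots> \<le> 3 / (2 * ln 2)" using l by (intro divide_left_mono) auto
  finally have r2: "108 / 50 \<le> 3 / (2 * ln (2::real))" .
  then have r2': "108 / 50 \<le> r_bar\<^sup>2" using l by (simp add: r_bar_def)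
  have "sqrt ((146/100)\<^sup>2) \<le> r_bar"
    unfolding r_bar_def using r2 by (intro real_sqrt_le_mono) (simp add: power2_eq_square)
  then have r: "146/100 \<le> r_bar" by simp
  have "128 * (108/50) * 1 \<le> A" unfolding A_def using r2' Lambda_bar_ge_1 by (intro mult_mono) auto
  then have A: "276 \<le> A" by simp
  have "16 * (146/100) * 1 \<le> 16 * r_bar * Lambda_bar" using r Lambda_bar_ge_1 by (intro mult_mono) auto
  moreover have "(14/5::real) powr 3 = (14/5) ^ 3" using powr_realpow[of "14/5::real" 3] by simp
  ultimately have cube: "(14/5::real) powr 3 \<le> 16 * r_bar * Lambda_bar" by (simp add: power3_eq_cube)
  have "((14/5) powr 3) powr (1/3) \<le> B"
    unfolding B_def by (rule powr_mono2[OF _ _ cube]) simp_all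
  moreover have "((14/5) powr 3) powr (1/3) = (14/5::real) powr (3 * (1/3))" by (rule powr_powr)
  ultimately have B: "14/5 \<le> B" by simp
  define b where "b = B * T"
  have b: "14/5 * T \<le> b" "0 < b" using B T by (auto simp: b_def intro: mult_right_mono)
  have scale: "rate_scale T = (A + b) powr (3/2)" by (simp add: rate_scale_def A_def B_def b_def)
  have Ab: "0 < A + b" using A b by simp
  show "0 < rate_scale T" unfolding scale using Ab by simp
  have "(rate_scale T)\<^sup>2 = (A + b) powr 3"
    unfolding scale power2_eq_square by (simp add: powr_add[symmetric])
  also have "\<dots> = (A + b) ^ 3" using Ab powr_realpow[of "A + b" 3] by simp
  finally have D2: "(rate_scale T)\<^sup>2 = (A + b) ^ 3" .
  (* the arithmetic-geometric mean inequality for A, b/2, b/2 *)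
  have "(A + b) ^ 3 - 27/4 * (A * b\<^sup>2) = (b - 2 * A)\<^sup>2 * (b + A / 4)"
    by (simp add: power2_eq_square power3_eq_cube algebra_simps)
  moreover have "0 \<le> (b - 2 * A)\<^sup>2 * (b + A / 4)" using A b by (intro mult_nonneg_nonneg) auto
  ultimately have amgm: "27/4 * (A * b\<^sup>2) \<le> (A + b) ^ 3" by linarith
  have "(14/5 * T)\<^sup>2 \<le> b\<^sup>2" using b T by (intro power_mono) auto
  then have "27/4 * (276 * (14/5 * T)\<^sup>2) \<le> 27/4 * (A * b\<^sup>2)" using A by (intro mult_left_mono mult_mono) auto
  moreover have "(120 * T)\<^sup>2 \<le> 27/4 * (276 * (14/5 * T)\<^sup>2)" by (simp add: power_mult_distrib power2_eq_square)
  ultimately have "(120 * T)\<^sup>2 \<le> (rate_scale T)\<^sup>2" using amgm unfolding D2 by linarith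
  then show "120 * T \<le> rate_scale T" by (rule power2_le_imp_le) (use Ab in \<open>simp add: scale\<close>)
qed

text \<open>The optimal \<open>\<theta> = T / 6402\<close> is admissible for \<open>T \<le> 320\<close>. In that range the hypothesis \<open>big\<close> bounds
  \<open>n T\<^sup>2\<close> from below by \<open>\<surd>n\<close> times the rate scale, which absorbs both the term \<open>16 \<theta>\<close> and the asserted exponent. For larger
  \<open>T\<close> the endpoint \<open>\<theta> = 1/20\<close> gives an exponent linear in \<open>n T\<close>, whereas the asserted one is at most
  \<open>\<surd>n T / 240\<close>.\<close>

lemma chernoff_exponent:
  fixes T :: real and n :: nat
  assumes T: "0 < T" and n: "1 \<le> n" and big: "1/2 \<le> T\<^sup>2 / (2 * rate_scale T) * sqrt (real n)"
  obtains \<theta> where "0 < \<theta>" "\<theta> \<le> 1/20"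
    "3201 * \<theta>\<^sup>2 * real n + 16 * \<theta> - \<theta> * T * real n \<le> - (T\<^sup>2 / (2 * rate_scale T) * sqrt (real n))"
proof -
  define D where "D = rate_scale T"
  have D: "0 < D" "120 * T \<le> D" using rate_scale_bounds[OF T] by (auto simp: D_def)
  define x where "x = sqrt (real n)"
  have x: "1 \<le> x" "x\<^sup>2 = real n" using n by (auto simp: x_def)
  then have x_le: "x \<le> real n" using self_le_power[of x 2] by simp
  have TD: "T\<^sup>2 / D \<le> T / 120"
  proof -
    have "120 * T * T \<le> D * T" using D T by (intro mult_right_mono) auto
    then show ?thesis using D(1) by (simp add: field_simps power2_eq_square)
  qed
  show ?thesis
  proof (cases "T \<le> 320")
    case True
    have "D \<le> x * T\<^sup>2" using big D(1) by (simp add: D_def x_def field_simps)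
    then have "x * D \<le> x * (x * T\<^sup>2)" using x by (intro mult_left_mono) auto
    also have "x * (x * T\<^sup>2) = real n * T\<^sup>2" unfolding x(2)[symmetric] by (simp add: power2_eq_square)
    finally have 1: "x * D \<le> real n * T\<^sup>2" .
    have "D \<le> x * D" using x(1) D(1) by simp
    then have 2: "120 * T \<le> x * D" using D by linarith
    have "T / 120 \<le> D / 14400" using D by simp
    with TD have "T\<^sup>2 / D \<le> D / 14400" by (rule order_trans)
    then have "x * (T\<^sup>2 / D) \<le> x * (D / 14400)" using x by (intro mult_left_mono) auto
    then have 3: "T\<^sup>2 / (2 * D) * x \<le> x * D / 28800" by (simp add: field_simps)
    have "3201 * (T / 6402)\<^sup>2 * real n + 16 * (T / 6402) - T / 6402 * T * real n = 16 * T / 6402 - real n * T\<^sup>2 / 12804"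
      by (simp add: power2_eq_square)
    also have "\<dots> \<le> - (T\<^sup>2 / (2 * D) * x)" using 1 2 3 T by linarith
    finally show ?thesis using that[of "T / 6402"] T True by (simp add: D_def x_def)
  next
    case False
    have "T\<^sup>2 / (2 * D) * x \<le> T / 240 * real n"
    proof (rule mult_mono)
      have "T\<^sup>2 / (2 * D) = T\<^sup>2 / D / 2" by simp
      also have "\<dots> \<le> T / 120 / 2" by (rule divide_right_mono[OF TD]) simp
      finally show "T\<^sup>2 / (2 * D) \<le> T / 240" by simp
    qed (use x x_le T in auto)
    moreover have "320 * real n \<le> T * real n" using False by (intro mult_right_mono) auto
    moreover have "1 \<le> real n" using n by simp
    ultimately have "3201/400 * real n + 16 * (1/20) - 1/20 * (T * real n) \<le> - (T\<^sup>2 / (2 * D) * x)"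
      by linarith
    moreover have "3201 * (1/20)\<^sup>2 * real n + 16 * (1/20) - 1/20 * T * real n =
        3201/400 * real n + 16 * (1/20) - 1/20 * (T * real n)"
      by (simp add: power2_eq_square)
    ultimately have "3201 * (1/20)\<^sup>2 * real n + 16 * (1/20) - 1/20 * T * real n \<le> - (T\<^sup>2 / (2 * D) * x)"
      by (simp only:)
    then show ?thesis unfolding D_def x_def by (intro that[of "1/20"]) simp_all
  qed
qed

text \<open>On the integers from \<open>k\<^sup>2\<close> to \<open>(k+1)\<^sup>2 - 1\<close> each term is at most \<open>q ^ k\<close>, and there are \<open>2k + 1\<close> of
  them. The expression on the right is the sum of the series of \<open>(2k+1) q ^ k\<close> from \<open>K\<close> on, so it loses
  exactly this amount when its index increases by one.\<close>

lemma weighted_geometric_tail: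
  fixes q :: real and K L :: nat
  assumes q: "0 < q" "q < 1" and "K \<le> L"
  shows "(\<Sum>n=K\<^sup>2..<L\<^sup>2. q powr sqrt (real n)) + q ^ L / (1 - q) * (2 * real L + 1 + 2 * q / (1 - q))
    \<le> q ^ K / (1 - q) * (2 * real K + 1 + 2 * q / (1 - q))"
  using \<open>K \<le> L\<close>
proof (induction L rule: dec_induct)
  case (step k)
  define p where "p = 1 - q"
  have p: "p > 0" "q = 1 - p" using q by (auto simp: p_def)
  have "(\<Sum>n=k\<^sup>2..<(Suc k)\<^sup>2. q powr sqrt (real n)) \<le> (\<Sum>n=k\<^sup>2..<(Suc k)\<^sup>2. q ^ k)"
  proof (rule sum_mono)
    fix n assume "n \<in> {k\<^sup>2..<(Suc k)\<^sup>2}"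
    then have "real k ^ 2 \<le> real n" by (metis atLeastLessThan_iff of_nat_le_iff of_nat_power)
    then have "real k \<le> sqrt (real n)" by (rule real_le_rsqrt)
    then have "q powr sqrt (real n) \<le> q powr real k" using q by (intro powr_mono') auto
    then show "q powr sqrt (real n) \<le> q ^ k" using q by (simp add: powr_realpow)
  qed
  also have "\<dots> = (2 * real k + 1) * q ^ k" by (simp add: power2_eq_square algebra_simps)
  also have "\<dots> = q ^ k / (1 - q) * (2 * real k + 1 + 2 * q / (1 - q)) -
      q ^ Suc k / (1 - q) * (2 * real (Suc k) + 1 + 2 * q / (1 - q))"
  proof -
    have "(2 * real k + 1) * p\<^sup>2 = (2 * real k + 1) * p + 2 * q - q * ((2 * real k + 3) * p + 2 * q)"
      unfolding p(2) by (simp add: power2_eq_square algebra_simps)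
    then have "2 * real k + 1 = ((2 * real k + 1) * p + 2 * q - q * ((2 * real k + 3) * p + 2 * q)) / p\<^sup>2"
      using p(1) by (simp add: eq_divide_eq)
    also have "\<dots> = (2 * real k + 1 + 2 * q / p) / p - q * (2 * real k + 3 + 2 * q / p) / p"
      using p(1) by (simp add: field_simps power2_eq_square)
    finally have e: "2 * real k + 1 = (2 * real k + 1 + 2 * q / p) / p - q * (2 * real k + 3 + 2 * q / p) / p" .
    define X where "X = 2 * real k + 1 + 2 * q / p"
    define Y where "Y = 2 * real k + 3 + 2 * q / p"
    have Y: "2 * real (Suc k) + 1 + 2 * q / p = Y" by (simp add: Y_def)
    have "(2 * real k + 1) * q ^ k = (X / p - q * Y / p) * q ^ k"
      using e unfolding X_def Y_def by (rule arg_cong)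
    also have "\<dots> = q ^ k / p * X - q ^ Suc k / p * Y" by (simp add: divide_inverse algebra_simps)
    finally show ?thesis unfolding p_def[symmetric] Y X_def .
  qed
  finally have "(\<Sum>n=k\<^sup>2..<(Suc k)\<^sup>2. q powr sqrt (real n)) \<le>
      q ^ k / (1 - q) * (2 * real k + 1 + 2 * q / (1 - q)) -
      q ^ Suc k / (1 - q) * (2 * real (Suc k) + 1 + 2 * q / (1 - q))" .
  moreover have "(\<Sum>n=K\<^sup>2..<(Suc k)\<^sup>2. q powr sqrt (real n)) =
     (\<Sum>n=K\<^sup>2..<k\<^sup>2. q powr sqrt (real n)) + (\<Sum>n=k\<^sup>2..<(Suc k)\<^sup>2. q powr sqrt (real n))"
    using step by (intro sum.atLeastLessThan_concat[symmetric] power_mono) auto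
  ultimately show ?case using step.IH by linarith
qed simp

lemma sum_powr_sqrt_le:
  fixes q :: real and N K m :: nat
  assumes q: "0 < q" "q < 1" and NK: "N \<le> K\<^sup>2"
  shows "(\<Sum>n=N..<m. q powr sqrt (real n)) \<le>
    (\<Sum>n=N..<K\<^sup>2. q powr sqrt (real n)) + q ^ K / (1 - q) * (2 * real K + 1 + 4 * q / (1 - q))"
proof -
  define L where "L = max K m"
  have "m \<le> L\<^sup>2" using self_le_power[of L 2] by (cases "L = 0") (auto simp: L_def)
  then have "(\<Sum>n=N..<m. q powr sqrt (real n)) \<le> (\<Sum>n=N..<L\<^sup>2. q powr sqrt (real n))"
    by (intro sum_mono2) auto
  also have "\<dots> = (\<Sum>n=N..<K\<^sup>2. q powr sqrt (real n)) + (\<Sum>n=K\<^sup>2..<L\<^sup>2. q powr sqrt (real n))"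
    using NK by (intro sum.atLeastLessThan_concat[symmetric] power_mono) (auto simp: L_def)
  also have "(\<Sum>n=K\<^sup>2..<L\<^sup>2. q powr sqrt (real n)) \<le> q ^ K / (1 - q) * (2 * real K + 1 + 2 * q / (1 - q))"
  proof -
    have "0 \<le> q ^ L / (1 - q) * (2 * real L + 1 + 2 * q / (1 - q))"
      using q by (intro mult_nonneg_nonneg add_nonneg_nonneg divide_nonneg_nonneg) auto
    then show ?thesis using weighted_geometric_tail[OF q, of K L] by (simp add: L_def)
  qed
  also have "\<dots> \<le> q ^ K / (1 - q) * (2 * real K + 1 + 4 * q / (1 - q))"
    using q by (intro mult_left_mono add_left_mono divide_right_mono) auto
  finally show ?thesis by simp
qed

text \<open>If the asserted lower bound is not positive there is nothing to prove. Otherwise \<open>3 q ^ K < 1\<close> for \<open>q = Xi T\<close>, and as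
  \<open>K \<le> 2 \<surd>N\<close> this is the size condition under which Chernoff's bound beats \<open>q powr \<surd>n\<close> for every \<open>n \<ge> N\<close>.
  A union bound finishes the proof.\<close>

lemma gauss_measure_all_deviations:
  fixes T \<sigma> :: real and N K :: nat
  assumes N: "1 \<le> N" and T: "0 < T" and K: "K = nat \<lceil>sqrt (real N)\<rceil>" and \<sigma>: "\<sigma> \<in> {1, -1}"
  shows "measure gauss_measure {x \<in> irr_interval. \<forall>n\<ge>N. \<sigma> * (log_digit_sum n x - kappa * real n) \<le> T * real n} \<ge>
     1 - ((\<Sum>n=N..K\<^sup>2 - 1. Xi T powr sqrt (real n)) +
       Xi T ^ K / (1 - Xi T) * (2 * real K + 1 + 4 * Xi T / (1 - Xi T)))"
    (is "measure gauss_measure ?G \<ge> 1 - ?bound")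
proof (cases "?bound < 1")
  case False
  then show ?thesis using measure_nonneg[of gauss_measure ?G] by linarith
next
  case True
  define \<epsilon> where "\<epsilon> = T\<^sup>2 / (2 * rate_scale T)"
  define q where "q = Xi T"
  have \<epsilon>: "0 < \<epsilon>" using rate_scale_bounds(1)[OF T] T by (simp add: \<epsilon>_def)
  have q_eq: "q = exp (- \<epsilon>)" by (simp add: q_def Xi_eq \<epsilon>_def)
  have q: "0 < q" "q < 1" using \<epsilon> by (auto simp: q_eq)
  have q_powr: "q powr sqrt (real n) = exp (- (\<epsilon> * sqrt (real n)))" for n
    using q by (simp add: powr_def q_eq mult.commute)
  have sN: "1 \<le> sqrt (real N)" using N by simp
  have K_ge: "sqrt (real N) \<le> real K" unfolding K by (rule of_nat_ceiling)
  have K_le: "real K \<le> 2 * sqrt (real N)" using sN unfolding K by linarith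
  have K1: "1 \<le> K" using K_ge sN by linarith
  have "(sqrt (real N))\<^sup>2 \<le> (real K)\<^sup>2" using K_ge by (intro power_mono) auto
  then have NK: "N \<le> K\<^sup>2" by (simp flip: of_nat_power)
  have "1 \<le> K\<^sup>2" using K1 by simp
  then have set_eq: "{N..K\<^sup>2 - 1} = {N..<K\<^sup>2}" by auto
  \<comment> \<open>The tail term of a bound below 1 already controls q ^ K.\<close>
  have big: "1/2 \<le> \<epsilon> * sqrt (real n)" if "n \<ge> N" for n
  proof -
    have "q ^ K * 3 \<le> q ^ K / (1 - q) * (2 * real K + 1 + 4 * q / (1 - q))"
    proof (rule mult_mono)
      show "q ^ K \<le> q ^ K / (1 - q)" using q by (simp add: le_divide_eq)
      have "0 \<le> 4 * q / (1 - q)" using q by simp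
      then show "3 \<le> 2 * real K + 1 + 4 * q / (1 - q)" using K1 by linarith
    qed (use q in auto)
    also have "\<dots> \<le> ?bound" unfolding q_def by (simp add: sum_nonneg)
    also have "\<dots> < 1" by fact
    finally have "3 * exp (- (\<epsilon> * real K)) < 1" by (simp add: q_eq exp_of_nat_mult[symmetric] mult.commute)
    then have "3 < exp (\<epsilon> * real K)" by (simp add: exp_minus field_simps)
    then have "exp 1 < exp (\<epsilon> * real K)" using exp_le by linarith
    then have "1 < \<epsilon> * real K" by simp
    also have "\<dots> \<le> \<epsilon> * (2 * sqrt (real n))"
    proof (rule mult_left_mono)
      have "sqrt (real N) \<le> sqrt (real n)" using that by simp
      then show "real K \<le> 2 * sqrt (real n)" using K_le by linarith
    qed (use \<epsilon> in simp)
    finally show ?thesis by simp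
  qed
  define Bad where "Bad = (\<lambda>n. {x \<in> irr_interval. T * real n < \<sigma> * (log_digit_sum n x - kappa * real n)})"
  have Bad: "Bad n \<in> sets gauss_measure" for n
    unfolding Bad_def by (rule chernoff_bound(1)[OF \<sigma>, of "1/20"]) auto
  have Bad_le: "emeasure gauss_measure (Bad n) \<le> ennreal (q powr sqrt (real n))" if n: "n \<ge> N" for n
  proof -
    obtain \<theta> where \<theta>: "0 < \<theta>" "\<theta> \<le> 1/20"
      and e: "3201 * \<theta>\<^sup>2 * real n + 16 * \<theta> - \<theta> * T * real n \<le> - (\<epsilon> * sqrt (real n))"
      using chernoff_exponent[of T n] T N n big[OF n] unfolding \<epsilon>_def by auto
    have "emeasure gauss_measure (Bad n) \<le> ennreal (exp (3201 * \<theta>\<^sup>2 * real n + 16 * \<theta> - \<theta> * T * real n))"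
      unfolding Bad_def by (rule chernoff_bound(2)[OF \<sigma> \<theta>])
    also have "\<dots> \<le> ennreal (exp (- (\<epsilon> * sqrt (real n))))" using e by (intro ennreal_leI) simp
    finally show ?thesis by (simp add: q_powr)
  qed
  have bound0: "0 \<le> ?bound"
    using q by (auto simp: q_def[symmetric] intro!: add_nonneg_nonneg sum_nonneg mult_nonneg_nonneg)
  have "emeasure gauss_measure (\<Union>i. Bad (N + i)) \<le> (\<Sum>i. emeasure gauss_measure (Bad (N + i)))"
    using Bad by (intro emeasure_subadditive_countably) auto
  also have "\<dots> \<le> ennreal ?bound"
  proof (rule suminf_le_const[OF summableI])
    fix m
    have "(\<Sum>i<m. emeasure gauss_measure (Bad (N + i))) \<le> (\<Sum>i<m. ennreal (q powr sqrt (real (N + i))))"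
      by (intro sum_mono Bad_le) auto
    also have "\<dots> = ennreal (\<Sum>i<m. q powr sqrt (real (N + i)))" by (rule sum_ennreal) simp
    also have "(\<Sum>i<m. q powr sqrt (real (N + i))) = (\<Sum>n=N..<N + m. q powr sqrt (real n))"
      using sum.shift_bounds_nat_ivl[of "\<lambda>n. q powr sqrt (real n)" 0 N m]
      by (simp add: lessThan_atLeast0 add.commute)
    also have "ennreal \<dots> \<le> ennreal ?bound"
      using sum_powr_sqrt_le[OF q NK, of "N + m"] unfolding set_eq q_def by (intro ennreal_leI) simp
    finally show "(\<Sum>i<m. emeasure gauss_measure (Bad (N + i))) \<le> ennreal ?bound" .
  qed
  finally have U: "emeasure gauss_measure (\<Union>i. Bad (N + i)) \<le> ennreal ?bound" .
  have G_eq: "?G = space gauss_measure - (\<Union>i. Bad (N + i))"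
  proof -
    have shift: "(\<forall>n\<ge>N. P n) \<longleftrightarrow> (\<forall>i. P (N + i))" for P :: "nat \<Rightarrow> bool" by (metis le_Suc_ex le_add1)
    have "Bad n = irr_interval - {x. \<sigma> * (log_digit_sum n x - kappa * real n) \<le> T * real n}" for n
      by (auto simp: Bad_def)
    then show ?thesis unfolding shift space_gauss_measure by blast
  qed
  have US: "(\<Union>i. Bad (N + i)) \<in> sets gauss_measure" using Bad by auto
  interpret finite_measure gauss_measure
    by standard (simp add: emeasure_gauss_measure_space)
  have "measure gauss_measure ?G = measure gauss_measure (space gauss_measure) - measure gauss_measure (\<Union>i. Bad (N + i))"
    unfolding G_eq by (rule finite_measure_compl[OF US])
  moreover have "measure gauss_measure (space gauss_measure) = 1"
    by (simp add: measure_def emeasure_gauss_measure_space)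
  moreover have "measure gauss_measure (\<Union>i. Bad (N + i)) \<le> ?bound"
    unfolding measure_def using U by (intro enn2real_leI[OF bound0])
  ultimately show ?thesis by linarith
qed

lemma KL_plus_eq: "KL_plus T N = {x \<in> irr_interval. \<forall>n\<ge>N. 1 * (log_digit_sum n x - kappa * real n) \<le> T * real n}"
  unfolding KL_plus_def by (auto simp: digit_prod_eq_exp algebra_simps)

lemma KL_minus_eq: "KL_minus T N = {x \<in> irr_interval. \<forall>n\<ge>N. (-1) * (log_digit_sum n x - kappa * real n) \<le> T * real n}"
  unfolding KL_minus_def by (auto simp: digit_prod_eq_exp algebra_simps)

theorem theorem2p2:
  fixes N K :: nat and T :: real
  assumes "N \<ge> 1"
    and "T > 0"
    and "K = nat \<lceil>sqrt (real N)\<rceil>"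
  shows "(\<forall>A \<in> {KL_plus T N, KL_minus T N}.
            measure gauss_measure A \<ge>
              1 - ((\<Sum>n=N..K\<^sup>2 - 1. Xi T powr sqrt (real n)) +
                   Xi T ^ K / (1 - Xi T) * (2 * real K + 1 + 4 * Xi T / (1 - Xi T)))) \<and>
         ((\<exists>k::nat. N = k\<^sup>2) \<longrightarrow>
          (\<forall>A \<in> {KL_plus T N, KL_minus T N}.
            measure gauss_measure A \<ge>
              1 - inverse (1 - Xi T) * (2 * sqrt (real N) + 1 + 4 * Xi T / (1 - Xi T)) *
                  Xi T powr sqrt (real N)))"
proof (intro conjI impI)
  show general: "\<forall>A \<in> {KL_plus T N, KL_minus T N}. measure gauss_measure A \<ge>
      1 - ((\<Sum>n=N..K\<^sup>2 - 1. Xi T powr sqrt (real n)) +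
           Xi T ^ K / (1 - Xi T) * (2 * real K + 1 + 4 * Xi T / (1 - Xi T)))"
    using gauss_measure_all_deviations[OF assms, of 1] gauss_measure_all_deviations[OF assms, of "-1"]
    unfolding KL_plus_eq KL_minus_eq by blast
  assume "\<exists>k::nat. N = k\<^sup>2"
  then obtain k where k: "N = k\<^sup>2" by blast
  then have sN: "sqrt (real N) = real k" by simp
  then have K: "K = k" using assms(3) by simp
  have "{N..K\<^sup>2 - 1} = {}" using assms(1) k K by auto
  moreover have "Xi T ^ K = Xi T powr sqrt (real N)" by (simp add: K sN powr_realpow Xi_def)
  ultimately show "\<forall>A \<in> {KL_plus T N, KL_minus T N}. measure gauss_measure A \<ge>
      1 - inverse (1 - Xi T) * (2 * sqrt (real N) + 1 + 4 * Xi T / (1 - Xi T)) * Xi T powr sqrt (real N)"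
    using general by (simp add: K sN divide_inverse mult_ac)
qed

end
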